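(* Let $G$ be a compact group, $K$ a closed subgroup of $G$, and $\mathcal{T}(G)$ the space of trigonometric polynomials on $G$. Let $\mathcal{A}(G)$ be a regular Banach algebra of continuous functions on $G$ which is closed under right translations and such that for every $f\in\mathcal{A}(G)$ one has $\|R_sf\|_{\mathcal{A}}=\|f\|_{\mathcal{A}}$ for all $s\in G$, and the map $s\mapsto R_sf$ from $G$ to $\mathcal{A}(G)$ is continuous. Suppose additionally that $\mathcal{T}(G)\mathcal{A}(G)\subseteq\mathcal{A}(G)$. Let $E$ be a closed subset of $G/K$ and let $E^*=\{s\in G\mid sK\in E\}$. Then for every $d\in\mathbb{N}$: $E$ is a set of weak synthesis for $\mathcal{A}(G/K)$ of degree at most $d$ if and only if $E^*$ is a set of weak synthesis for $\mathcal{A}(G)$ of degree at most $d$; and $E$ is a set of local weak synthesis for $\mathcal{A}(G/K)$ of degree at most $d$ if and only if $E^*$ is a set of local weak synthesis for $\mathcal{A}(G)$ of degree at most $d$.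
   Context: $(R_sf)(t)=f(ts)$ is right translation. Trigonometric polynomials are the linear combinations of matrix coefficients of continuous finite-dimensional unitary representations of $G$. $G/K$ is the space of left cosets with the quotient topology. Let $\mathcal{A}(G:K)=\{f\in\mathcal{A}(G)\mid R_kf=f\text{ for each }k\in K\}$, a closed subalgebra of $\mathcal{A}(G)$. The map $M:\mathcal{A}(G:K)\to C_b(G/K)$, $Mf(sK)=f(s)$, is an injective homomorphism; its range is denoted $\mathcal{A}(G/K)$ and is given the norm making $M$ an isometry. Let $\mathcal{A}$ be a regular Banach algebra contained in $C_0(X)$, $X$ a locally compact Hausdorff space, and $E\subseteq X$ closed. Put $I(E)=\{f\in\mathcal{A}\mid f(x)=0\ \text{for all } x\in E\}$; $I_0(E)=\{f\in\mathcal{A}\mid \mathrm{supp} f\cap E=\varnothing,\ \mathrm{supp} f \text{ compact}\}$; $J(E)=\overline{\{f\in I(E)\mid \mathrm{supp} f\text{ compact}\}}$. Closures are in the norm of $\mathcal{A}$, and $\mathrm{supp} f=\overline{\{x\mid f(x)\ne 0\}}$. For a positive integer $d$, $E$ is a set of weak synthesis (respectively local weak synthesis) for $\mathcal{A}$ of degree at most $d$ if $I(E)^d=\overline{I_0(E)}$ (respectively $J(E)^d=\overline{I_0(E)}$), i.e. if $I(E)/\overline{I_0(E)}$ (respectively $J(E)/\overline{I_0(E)}$) is nilpotent of degree at most $d$; powers of ideals denote closed linear spans of products of $d$ elements. *)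

theory Defs
  imports
    "HOL-Analysis.Analysis"
    "HOL-Library.Function_Algebras"
    "Jordan_Normal_Form.Schur_Decomposition"
begin

section \<open>Banach algebras of continuous functions\<close>

text \<open>
  Functions on a space \<open>X :: 'x topology\<close> are total functions \<open>'x \<Rightarrow> complex\<close> that are \<open>0\<close> outside
  \<open>topspace X\<close>, so that equality of such functions is equality on \<open>X\<close>. Sums and products are
  the pointwise ones.
\<close>

interpretation cfun: vector_space
  "(\<lambda>c f x. c * f x) :: complex \<Rightarrow> ('x \<Rightarrow> complex) \<Rightarrow> 'x \<Rightarrow> complex"
  by unfold_locales (auto simp: fun_eq_iff algebra_simps)

definition C0 :: "'x topology \<Rightarrow> ('x \<Rightarrow> complex) set" where
  "C0 X = {f. continuous_map X euclidean f \<and> (\<forall>x. x \<notin> topspace X \<longrightarrow> f x = 0) \<and>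
              (\<forall>e>0. compactin X {x \<in> topspace X. e \<le> norm (f x)})}"

text \<open>
  An algebra \<open>A\<close> of functions carries a norm \<open>N\<close>, of which only the values on \<open>A\<close> matter. The
  library's \<open>Metric_space\<close> requires symmetry and nonnegativity off the carrier as well, whence the
  case distinction.
\<close>

definition alg_dist ::
  "('x \<Rightarrow> complex) set \<Rightarrow> (('x \<Rightarrow> complex) \<Rightarrow> real) \<Rightarrow> ('x \<Rightarrow> complex) \<Rightarrow> ('x \<Rightarrow> complex) \<Rightarrow> real" where
  "alg_dist A N f g = (if f \<in> A \<and> g \<in> A then N (f - g) else 0)"

definition alg_topology ::
  "('x \<Rightarrow> complex) set \<Rightarrow> (('x \<Rightarrow> complex) \<Rightarrow> real) \<Rightarrow> ('x \<Rightarrow> complex) topology" where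
  "alg_topology A N = Metric_space.mtopology A (alg_dist A N)"

locale normed_function_algebra =
  fixes X :: "'x topology"
    and A :: "('x \<Rightarrow> complex) set"
    and N :: "('x \<Rightarrow> complex) \<Rightarrow> real"
  assumes subset_C0: "A \<subseteq> C0 X"
    and subspace: "cfun.subspace A"
    and mult_closed: "f \<in> A \<Longrightarrow> g \<in> A \<Longrightarrow> f * g \<in> A"
    and norm_nonneg: "f \<in> A \<Longrightarrow> 0 \<le> N f"
    and norm_eq_0: "f \<in> A \<Longrightarrow> N f = 0 \<Longrightarrow> f = 0"
    and norm_scale: "f \<in> A \<Longrightarrow> N (\<lambda>x. c * f x) = norm c * N f"
    and norm_triangle: "f \<in> A \<Longrightarrow> g \<in> A \<Longrightarrow> N (f + g) \<le> N f + N g"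
    and norm_mult: "f \<in> A \<Longrightarrow> g \<in> A \<Longrightarrow> N (f * g) \<le> N f * N g"
begin

lemma diff_closed: "f \<in> A \<Longrightarrow> g \<in> A \<Longrightarrow> f - g \<in> A"
  using subspace by (rule cfun.subspace_diff)

lemma norm_minus_commute: "f \<in> A \<Longrightarrow> g \<in> A \<Longrightarrow> N (f - g) = N (g - f)"
  using norm_scale[of "f - g" "-1"] diff_closed[of f g]
  by (simp add: fun_diff_def)

lemma norm_0: "N 0 = 0"
  using norm_scale[of 0 0] cfun.subspace_0[OF subspace]
  by (simp add: zero_fun_def)

sublocale Metric_space A "alg_dist A N"
proof
  show "0 \<le> alg_dist A N f g" for f g
    by (simp add: alg_dist_def norm_nonneg diff_closed)
  show "alg_dist A N f g = alg_dist A N g f" for f g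
    by (simp add: alg_dist_def norm_minus_commute)
  show "alg_dist A N f g = 0 \<longleftrightarrow> f = g" if "f \<in> A" "g \<in> A" for f g
    using that norm_eq_0[of "f - g"] diff_closed[of f g] norm_0
    by (auto simp: alg_dist_def)
  show "alg_dist A N f h \<le> alg_dist A N f g + alg_dist A N g h"
    if "f \<in> A" "g \<in> A" "h \<in> A" for f g h
    using that norm_triangle[of "f - g" "g - h"] by (simp add: alg_dist_def diff_closed)
qed

end

locale banach_function_algebra = normed_function_algebra +
  assumes complete: "Metric_space.mcomplete A (alg_dist A N)"

text \<open>Regularity: points are separated from closed sets by elements of the algebra.\<close>

locale regular_banach_function_algebra = banach_function_algebra +
  assumes regular: "closedin X F \<Longrightarrow> x \<in> topspace X - F \<Longrightarrow> \<exists>f\<in>A. f x = 1 \<and> (\<forall>y\<in>F. f y = 0)"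


section \<open>Ideals and weak synthesis\<close>

definition supp :: "'x topology \<Rightarrow> ('x \<Rightarrow> complex) \<Rightarrow> 'x set" where
  "supp X f = X closure_of {x \<in> topspace X. f x \<noteq> 0}"

definition ideal_I :: "('x \<Rightarrow> complex) set \<Rightarrow> 'x set \<Rightarrow> ('x \<Rightarrow> complex) set" where
  "ideal_I A E = {f \<in> A. \<forall>x\<in>E. f x = 0}"

definition ideal_I0 :: "'x topology \<Rightarrow> ('x \<Rightarrow> complex) set \<Rightarrow> 'x set \<Rightarrow> ('x \<Rightarrow> complex) set" where
  "ideal_I0 X A E = {f \<in> A. supp X f \<inter> E = {} \<and> compactin X (supp X f)}"

definition ideal_J ::
  "'x topology \<Rightarrow> ('x \<Rightarrow> complex) set \<Rightarrow> (('x \<Rightarrow> complex) \<Rightarrow> real) \<Rightarrow> 'x set \<Rightarrow> ('x \<Rightarrow> complex) set" where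
  "ideal_J X A N E = alg_topology A N closure_of {f \<in> ideal_I A E. compactin X (supp X f)}"

definition ideal_power ::
  "('x \<Rightarrow> complex) set \<Rightarrow> (('x \<Rightarrow> complex) \<Rightarrow> real) \<Rightarrow> ('x \<Rightarrow> complex) set \<Rightarrow> nat \<Rightarrow> ('x \<Rightarrow> complex) set" where
  "ideal_power A N I d =
     alg_topology A N closure_of cfun.span {(\<Prod>i<d. f i) | f. \<forall>i<d. f i \<in> I}"

definition weak_synthesis ::
  "'x topology \<Rightarrow> ('x \<Rightarrow> complex) set \<Rightarrow> (('x \<Rightarrow> complex) \<Rightarrow> real) \<Rightarrow> nat \<Rightarrow> 'x set \<Rightarrow> bool" where
  "weak_synthesis X A N d E \<longleftrightarrow>
     ideal_power A N (ideal_I A E) d = alg_topology A N closure_of ideal_I0 X A E"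

definition local_weak_synthesis ::
  "'x topology \<Rightarrow> ('x \<Rightarrow> complex) set \<Rightarrow> (('x \<Rightarrow> complex) \<Rightarrow> real) \<Rightarrow> nat \<Rightarrow> 'x set \<Rightarrow> bool" where
  "local_weak_synthesis X A N d E \<longleftrightarrow>
     ideal_power A N (ideal_J X A N E) d = alg_topology A N closure_of ideal_I0 X A E"


section \<open>Topological groups and coset spaces\<close>

text \<open>
  Topological groups are types of class \<open>topological_group_add\<close>. That class does not assume
  commutativity; \<open>s + t\<close> is the product \<open>st\<close>, \<open>0\<close> the identity and \<open>- s\<close> the inverse of \<open>s\<close>.
\<close>

definition is_subgroup :: "'g::group_add set \<Rightarrow> bool" where
  "is_subgroup K \<longleftrightarrow> 0 \<in> K \<and> (\<forall>s\<in>K. \<forall>t\<in>K. s + t \<in> K) \<and> (\<forall>s\<in>K. - s \<in> K)"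

definition right_transl :: "'g::group_add \<Rightarrow> ('g \<Rightarrow> complex) \<Rightarrow> 'g \<Rightarrow> complex" where
  "right_transl s f = (\<lambda>t. f (t + s))"

definition left_coset :: "'g::group_add set \<Rightarrow> 'g \<Rightarrow> 'g set" where
  "left_coset K s = (\<lambda>k. s + k) ` K"

definition coset_space :: "'g::{group_add,topological_space} set \<Rightarrow> 'g set topology" where
  "coset_space K = topology (\<lambda>U. U \<subseteq> range (left_coset K) \<and> open (left_coset K -` U))"

lemma openin_coset_space:
  "openin (coset_space K) U \<longleftrightarrow> U \<subseteq> range (left_coset K) \<and> open (left_coset K -` U)"
proof -
  have "istopology (\<lambda>U. U \<subseteq> range (left_coset K) \<and> open (left_coset K -` U))"
    unfolding istopology_def by (auto simp: vimage_Union)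
  then show ?thesis
    by (simp add: coset_space_def)
qed

lemma topspace_coset_space: "topspace (coset_space K) = range (left_coset K)"
proof
  have "openin (coset_space K) (range (left_coset K))"
    by (simp add: openin_coset_space vimage_def)
  then show "range (left_coset K) \<subseteq> topspace (coset_space K)"
    by (rule openin_subset)
  show "topspace (coset_space K) \<subseteq> range (left_coset K)"
    using openin_topspace openin_coset_space by blast
qed

lemma quotient_map_left_coset: "quotient_map euclidean (coset_space K) (left_coset K)"
  by (auto simp: quotient_map_def topspace_coset_space openin_coset_space vimage_def)


section \<open>Trigonometric polynomials\<close>

definition unitary_rep :: "nat \<Rightarrow> ('g::{group_add,topological_space} \<Rightarrow> complex mat) \<Rightarrow> bool" where
  "unitary_rep n \<pi> \<longleftrightarrow>
     (\<forall>s. \<pi> s \<in> carrier_mat n n \<and> \<pi> s * mat_adjoint (\<pi> s) = 1\<^sub>m n) \<and>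
     (\<forall>s t. \<pi> (s + t) = \<pi> s * \<pi> t) \<and>
     (\<forall>i<n. \<forall>j<n. continuous_on UNIV (\<lambda>s. \<pi> s $$ (i, j)))"

definition trig_polys :: "('g::{group_add,topological_space} \<Rightarrow> complex) set" where
  "trig_polys = cfun.span {(\<lambda>s. (\<pi> s *\<^sub>v \<xi>) \<bullet>c \<eta>) | n \<pi> \<xi> \<eta>.
     unitary_rep n \<pi> \<and> \<xi> \<in> carrier_vec n \<and> \<eta> \<in> carrier_vec n}"


section \<open>The algebra of a coset space\<close>

definition inv_alg :: "'g::group_add set \<Rightarrow> ('g \<Rightarrow> complex) set \<Rightarrow> ('g \<Rightarrow> complex) set" where
  "inv_alg K A = {f \<in> A. \<forall>k\<in>K. right_transl k f = f}"

definition coset_map :: "'g::group_add set \<Rightarrow> ('g \<Rightarrow> complex) \<Rightarrow> 'g set \<Rightarrow> complex" where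
  "coset_map K f C = (if C \<in> range (left_coset K) then f (SOME s. left_coset K s = C) else 0)"

definition coset_alg :: "'g::group_add set \<Rightarrow> ('g \<Rightarrow> complex) set \<Rightarrow> ('g set \<Rightarrow> complex) set" where
  "coset_alg K A = coset_map K ` inv_alg K A"

definition coset_norm ::
  "'g::group_add set \<Rightarrow> ('g \<Rightarrow> complex) set \<Rightarrow> (('g \<Rightarrow> complex) \<Rightarrow> real) \<Rightarrow> ('g set \<Rightarrow> complex) \<Rightarrow> real" where
  "coset_norm K A N F = N (the_inv_into (inv_alg K A) (coset_map K) F)"

text \<open>The choice of a representative in \<open>coset_map\<close> is immaterial, and \<open>coset_map\<close> is isometric.\<close>

lemma coset_map_left_coset:
  assumes "is_subgroup K" "f \<in> inv_alg K A"
  shows "coset_map K f (left_coset K s) = f s"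
proof -
  define t where "t = (SOME t. left_coset K t = left_coset K s)"
  have "left_coset K t = left_coset K s"
    unfolding t_def by (rule someI[of _ s]) simp
  moreover have "t + 0 \<in> left_coset K t"
    using assms(1) unfolding left_coset_def is_subgroup_def by blast
  ultimately obtain k where k: "k \<in> K" "t = s + k"
    by (auto simp: left_coset_def)
  have "f (s + k) = f s"
    using assms(2) k(1) by (auto simp: inv_alg_def right_transl_def fun_eq_iff)
  then show ?thesis
    using k(2) by (simp add: coset_map_def flip: t_def)
qed

lemma inj_on_coset_map:
  assumes "is_subgroup K"
  shows "inj_on (coset_map K) (inv_alg K A)"
  by (rule inj_onI, rule ext) (metis assms coset_map_left_coset)

lemma coset_norm_coset_map:
  assumes "is_subgroup K" "f \<in> inv_alg K A"
  shows "coset_norm K A N (coset_map K f) = N f"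
  by (simp add: coset_norm_def the_inv_into_f_f[OF inj_on_coset_map] assms)

end

theory Submission
  imports Defs
begin

text \<open>
  Averaging over \<open>K\<close> is a projection of the algebra onto its right \<open>K\<close>-invariant elements, under
  which closed right \<open>K\<close>-invariant ideals \<open>S\<close> are mapped onto \<open>S \<inter> inv_alg K A\<close>. Such an ideal is
  recovered from its invariant part: if a trigonometric polynomial \<open>h\<close> is close to an approximate
  identity on \<open>K\<close>, then \<open>f\<close> is close to the average of \<open>h(k) f(sk)\<close> over \<open>k\<close>, and expanding \<open>h\<close>
  through \<open>\<rho>(k) = \<rho>(s)\<^sup>* \<rho>(sk)\<close> turns this average into a sum of products of trigonometric
  polynomials with invariant elements of \<open>S\<close>. The powers of \<open>I(E\<^sup>*)\<close> and the closure of \<open>I\<^sub>0(E\<^sup>*)\<close> are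
  ideals of this kind, and their invariant parts are the corresponding ideals for \<open>E\<close>; so one of the
  two equalities holds iff the other does. The spaces being compact, \<open>J(E) = I(E)\<close>, and the local
  statement is the same. The Haar mean of \<open>f\<close> is the constant in the closed convex hull of the
  translates of \<open>f\<close>.
\<close>

section \<open>The Haar mean of a compact group\<close>

text \<open>At the outset trigonometric polynomials are only multipliers of the algebra. To use them
  as elements one needs the constant 1, which is obtained by averaging over the whole group. Their
  density is the Peter-Weyl theorem, proved from the mean alone: eigenspaces of
  \<open>T\<^sup>*T\<close> for convolution operators \<open>T\<close> are finite-dimensional and
  right invariant, the functions in them lead to separation of points, and Stone-Weierstrass
  applies. All functions there are real, so the representations are orthogonal. Integrals of
  algebra-valued functions are norm limits of Riemann sums, identified with the pointwise integrals
  because the norm dominates evaluation. The obstacle for d > 1 is that the average of a product is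
  not the product of the averages, so the invariant part of a power is not found by averaging each
  factor. Instead each factor is approximated by sums of \<open>a * b\<close> with \<open>a\<close>
  in the algebra and \<open>b\<close> invariant in the ideal; products of such sums are sums of
  terms \<open>a * (b\<^sub>1 * ... * b\<^sub>d)\<close>, and averaging affects only
  \<open>a\<close>.\<close>

definition right_avg :: "'g::group_add list \<Rightarrow> ('g \<Rightarrow> real) \<Rightarrow> 'g \<Rightarrow> real" where
  "right_avg ks f x = (\<Sum>k\<leftarrow>ks. f (x + k)) / real (length ks)"

definition left_avg :: "'g::group_add list \<Rightarrow> ('g \<Rightarrow> real) \<Rightarrow> 'g \<Rightarrow> real" where
  "left_avg ks f x = (\<Sum>k\<leftarrow>ks. f (k + x)) / real (length ks)"

lemma sum_list_le_length:
  fixes h :: "'a \<Rightarrow> real"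
  shows "(\<And>k. k \<in> set ks \<Longrightarrow> h k \<le> b) \<Longrightarrow> (\<Sum>k\<leftarrow>ks. h k) \<le> real (length ks) * b"
  by (induction ks) (auto simp: algebra_simps add_mono)

lemma sum_list_ge_length:
  fixes h :: "'a \<Rightarrow> real"
  shows "(\<And>k. k \<in> set ks \<Longrightarrow> b \<le> h k) \<Longrightarrow> real (length ks) * b \<le> (\<Sum>k\<leftarrow>ks. h k)"
  by (induction ks) (auto simp: algebra_simps add_mono)

lemma sum_list_product:
  fixes h :: "'a \<Rightarrow> 'b \<Rightarrow> real"
  shows "(\<Sum>(k, l)\<leftarrow>List.product ks ls. h k l) = (\<Sum>k\<leftarrow>ks. \<Sum>l\<leftarrow>ls. h k l)"
  by (induction ks) (auto simp: comp_def)

lemma sum_list_swap: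
  fixes h :: "'a \<Rightarrow> 'b \<Rightarrow> real"
  shows "(\<Sum>k\<leftarrow>ks. \<Sum>l\<leftarrow>ls. h k l) = (\<Sum>l\<leftarrow>ls. \<Sum>k\<leftarrow>ks. h k l)"
  by (induction ks) (auto simp: sum_list_addf)

lemma right_avg_le:
  "ks \<noteq> [] \<Longrightarrow> (\<And>k. k \<in> set ks \<Longrightarrow> f (x + k) \<le> b) \<Longrightarrow> right_avg ks f x \<le> b"
  using sum_list_le_length[of ks "\<lambda>k. f (x + k)" b]
  by (simp add: right_avg_def field_simps)

lemma right_avg_ge:
  "ks \<noteq> [] \<Longrightarrow> (\<And>k. k \<in> set ks \<Longrightarrow> b \<le> f (x + k)) \<Longrightarrow> b \<le> right_avg ks f x"
  using sum_list_ge_length[of ks b "\<lambda>k. f (x + k)"]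
  by (simp add: right_avg_def field_simps)

lemma left_avg_le:
  "ks \<noteq> [] \<Longrightarrow> (\<And>k. k \<in> set ks \<Longrightarrow> f (k + x) \<le> b) \<Longrightarrow> left_avg ks f x \<le> b"
  using sum_list_le_length[of ks "\<lambda>k. f (k + x)" b]
  by (simp add: left_avg_def field_simps)

lemma left_avg_ge:
  "ks \<noteq> [] \<Longrightarrow> (\<And>k. k \<in> set ks \<Longrightarrow> b \<le> f (k + x)) \<Longrightarrow> b \<le> left_avg ks f x"
  using sum_list_ge_length[of ks b "\<lambda>k. f (k + x)"]
  by (simp add: left_avg_def field_simps)

lemma right_avg_close:
  "ks \<noteq> [] \<Longrightarrow> (\<And>k. k \<in> set ks \<Longrightarrow> \<bar>f (x + k) - c\<bar> \<le> e) \<Longrightarrow> \<bar>right_avg ks f x - c\<bar> \<le> e"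
  using right_avg_le[of ks f x "c + e"] right_avg_ge[of ks "c - e" f x]
  by (force simp: abs_le_iff)

lemma left_avg_close:
  "ks \<noteq> [] \<Longrightarrow> (\<And>k. k \<in> set ks \<Longrightarrow> \<bar>f (k + x) - c\<bar> \<le> e) \<Longrightarrow> \<bar>left_avg ks f x - c\<bar> \<le> e"
  using left_avg_le[of ks f x "c + e"] left_avg_ge[of ks "c - e" f x]
  by (force simp: abs_le_iff)

lemma right_avg_add: "right_avg ks (\<lambda>x. f x + g x) x = right_avg ks f x + right_avg ks g x"
  by (simp add: right_avg_def sum_list_addf add_divide_distrib)

lemma left_avg_add: "left_avg ks (\<lambda>x. f x + g x) x = left_avg ks f x + left_avg ks g x"
  by (simp add: left_avg_def sum_list_addf add_divide_distrib)

text \<open>Averages are indexed by lists because multiplicities count here: distinct pairs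
  \<open>(k, l)\<close> may have the same sum \<open>k + l\<close>.\<close>

lemma right_avg_right_avg:
  "right_avg ks (right_avg ls f) = right_avg (map (\<lambda>(k, l). k + l) (List.product ks ls)) f"
proof
  fix x
  have "(\<Sum>p\<leftarrow>List.product ks ls. f (x + (case p of (k, l) \<Rightarrow> k + l))) =
        (\<Sum>(k, l)\<leftarrow>List.product ks ls. f (x + k + l))"
    by (simp add: split_def add.assoc)
  then show "right_avg ks (right_avg ls f) x = right_avg (map (\<lambda>(k, l). k + l) (List.product ks ls)) f x"
    by (simp add: right_avg_def comp_def sum_list_product divide_inverse sum_list_mult_const mult.assoc)
qed

text \<open>Associativity alone makes the two kinds of average commute. Every comparison of left and
  right averages below, and with it the additivity and invariance of the mean, rests on
  this.\<close>

lemma left_avg_right_avg: "left_avg ls (right_avg ks f) = right_avg ks (left_avg ls f)"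
proof
  fix x
  have "(\<Sum>l\<leftarrow>ls. \<Sum>k\<leftarrow>ks. f (l + (x + k))) = (\<Sum>k\<leftarrow>ks. \<Sum>l\<leftarrow>ls. f (l + (x + k)))"
    by (rule sum_list_swap)
  then show "left_avg ls (right_avg ks f) x = right_avg ks (left_avg ls f) x"
    by (simp add: left_avg_def right_avg_def divide_inverse sum_list_mult_const add.assoc)
qed

section \<open>Existence and uniqueness of the constant approached by averages over a compact
  subgroup\<close>

locale compact_subgroup =
  fixes K :: "'g::{topological_group_add,t2_space} set"
  assumes subgroup: "is_subgroup K" and compact: "compact K"
begin

lemma zero_mem: "0 \<in> K" and add_mem: "\<And>s t. s \<in> K \<Longrightarrow> t \<in> K \<Longrightarrow> s + t \<in> K"
  and uminus_mem: "\<And>s. s \<in> K \<Longrightarrow> - s \<in> K"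
  using subgroup by (auto simp: is_subgroup_def)

definition K_list :: "'g list \<Rightarrow> bool" where
  "K_list ks \<longleftrightarrow> ks \<noteq> [] \<and> set ks \<subseteq> K"

lemma K_list_product:
  "K_list ks \<Longrightarrow> K_list ls \<Longrightarrow> K_list (map (\<lambda>(k, l). k + l) (List.product ks ls))"
  by (cases ks; cases ls) (auto simp: K_list_def intro!: add_mem)

lemma continuous_on_translate_right:
  "continuous_on K f \<Longrightarrow> k \<in> K \<Longrightarrow> continuous_on K (\<lambda>x. f (x + k))"
  by (rule continuous_on_compose2[of K f]) (auto intro!: continuous_intros add_mem)

lemma continuous_on_translate_left:
  "continuous_on K f \<Longrightarrow> k \<in> K \<Longrightarrow> continuous_on K (\<lambda>x. f (k + x))"
  by (rule continuous_on_compose2[of K f]) (auto intro!: continuous_intros add_mem)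

lemma continuous_on_inverse:
  "continuous_on K f \<Longrightarrow> continuous_on K (\<lambda>x. f (- x))"
  by (rule continuous_on_compose2[of K f]) (auto intro!: continuous_intros uminus_mem)

lemma continuous_on_right_avg:
  "continuous_on K f \<Longrightarrow> K_list ks \<Longrightarrow> continuous_on K (right_avg ks f)"
proof -
  assume f: "continuous_on K f" and "K_list ks"
  then have "set ks \<subseteq> K" by (simp add: K_list_def)
  then have "continuous_on K (\<lambda>x. \<Sum>k\<leftarrow>ks. f (x + k))"
    by (induction ks) (auto intro!: continuous_intros continuous_on_translate_right f)
  then show ?thesis
    unfolding right_avg_def[abs_def] divide_inverse by (intro continuous_intros)
qed

lemma continuous_on_left_avg:
  "continuous_on K f \<Longrightarrow> K_list ks \<Longrightarrow> continuous_on K (left_avg ks f)"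
proof -
  assume f: "continuous_on K f" and "K_list ks"
  then have "set ks \<subseteq> K" by (simp add: K_list_def)
  then have "continuous_on K (\<lambda>x. \<Sum>k\<leftarrow>ks. f (k + x))"
    by (induction ks) (auto intro!: continuous_intros continuous_on_translate_left f)
  then show ?thesis
    unfolding left_avg_def[abs_def] divide_inverse by (intro continuous_intros)
qed

text \<open>The translation is on the left because right averages commute with it: every right
  average of \<open>f\<close> then inherits the same \<open>U\<close>.\<close>

lemma uniform_continuity:
  fixes f :: "'g \<Rightarrow> real"
  assumes "continuous_on K f" "e > 0"
  obtains U where "open U" "0 \<in> U" "\<And>u x. u \<in> U \<Longrightarrow> u \<in> K \<Longrightarrow> x \<in> K \<Longrightarrow> \<bar>f (u + x) - f x\<bar> \<le> e"
proof -
  have "continuous_on (K \<times> K) (\<lambda>p. f (fst p + snd p))"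
    by (rule continuous_on_compose2[OF assms(1)]) (auto intro!: continuous_intros add_mem)
  then show thesis
  proof (rule continuous_on_prod_compactE[OF _ compact zero_mem assms(2)])
    fix U assume "0 \<in> U" "open U"
      and U: "\<forall>x\<in>U \<inter> K. \<forall>t\<in>K. dist (f (fst (x, t) + snd (x, t))) (f (fst (0, t) + snd (0, t))) \<le> e"
    have "\<bar>f (u + x) - f x\<bar> \<le> e" if "u \<in> U" "u \<in> K" "x \<in> K" for u x
      using U that by (force simp: dist_real_def)
    with \<open>0 \<in> U\<close> \<open>open U\<close> show thesis by (intro that[of U]) auto
  qed
qed

text \<open>For a single \<open>x\<close> the witness is \<open>p = - x + u\<close>; compactness
  leaves finitely many.\<close>

lemma finite_translate_cover:
  assumes "open U" "u \<in> U" "u \<in> K"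
  obtains ps where "K_list ps" "\<And>x. x \<in> K \<Longrightarrow> \<exists>p\<in>set ps. x + p \<in> U"
proof -
  have op: "open ((\<lambda>x. x + p) -` U)" for p :: 'g
    by (rule open_vimage[OF assms(1)]) (intro continuous_intros)
  have "K \<subseteq> (\<Union>p\<in>K. (\<lambda>x. x + p) -` U)"
  proof
    fix x assume "x \<in> K"
    then have "- x + u \<in> K" using assms(3) by (intro add_mem uminus_mem)
    moreover have "x + (- x + u) = u" by (simp add: add.assoc[symmetric])
    ultimately show "x \<in> (\<Union>p\<in>K. (\<lambda>x. x + p) -` U)" using assms(2) by force
  qed
  with op obtain D where D: "D \<subseteq> K" "finite D" "K \<subseteq> (\<Union>p\<in>D. (\<lambda>x. x + p) -` U)"
    using compactE_image[OF compact, of K "\<lambda>p. (\<lambda>x. x + p) -` U"] by metis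
  from finite_list[OF D(2)] obtain ps where ps: "set ps = D" by blast
  moreover have "ps \<noteq> []" using D(3) zero_mem ps by auto
  ultimately show thesis
    using D by (intro that[of ps]) (auto simp: K_list_def)
qed

text \<open>If the maximum of an average \<open>g\<close> of \<open>f\<close> is close to the infimum of such maxima, then \<open>g\<close> is
  nearly constant: averaging \<open>g\<close> once more, over translates that bring a point where \<open>g\<close> is small
  near every point of \<open>K\<close>, would lower the maximum by an amount depending only on the modulus of
  continuity of \<open>f\<close>.\<close>

lemma ex_right_avg:
  assumes f: "continuous_on K f"
  shows "\<exists>c. \<forall>e>0. \<exists>ks. K_list ks \<and> (\<forall>x\<in>K. \<bar>right_avg ks f x - c\<bar> \<le> e)"
proof -
  define B where "B = {b. \<exists>ks. K_list ks \<and> (\<forall>x\<in>K. right_avg ks f x \<le> b)}"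
  define M where "M = Inf B"
  have "bounded (f ` K)"
    using compact_continuous_image[OF f compact] compact_imp_bounded by blast
  then obtain C where C: "\<And>x. x \<in> K \<Longrightarrow> \<bar>f x\<bar> \<le> C"
    by (auto simp: bounded_iff)
  have fC: "\<bar>right_avg ks f x\<bar> \<le> C" if "K_list ks" "x \<in> K" for ks x
    using right_avg_close[of ks f x 0 C] that C by (auto simp: K_list_def add_mem subset_iff)
  have K0: "K_list [0]" by (simp add: K_list_def zero_mem)
  have ne: "B \<noteq> {}"
    using K0 fC[OF K0] unfolding B_def by (force simp: abs_le_iff)
  have bb: "bdd_below B"
  proof (rule bdd_belowI[of _ "- C"])
    fix b assume "b \<in> B"
    then obtain ks where "K_list ks" "\<forall>x\<in>K. right_avg ks f x \<le> b" by (auto simp: B_def)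
    with fC[of ks 0] zero_mem show "- C \<le> b" by force
  qed
  have M_le: "M \<le> b" if "K_list ks" "\<forall>x\<in>K. right_avg ks f x \<le> b" for ks b
    unfolding M_def using that by (intro cInf_lower[OF _ bb]) (auto simp: B_def)
  have "\<exists>ks. K_list ks \<and> (\<forall>x\<in>K. \<bar>right_avg ks f x - M\<bar> \<le> e)" if "e > 0" for e
  proof -
    have e4: "e / 4 > 0" using \<open>e > 0\<close> by simp
    obtain U where U: "open U" "0 \<in> U"
      and Uf: "\<And>u x. u \<in> U \<Longrightarrow> u \<in> K \<Longrightarrow> x \<in> K \<Longrightarrow> \<bar>f (u + x) - f x\<bar> \<le> e / 4"
      by (rule uniform_continuity[OF f e4]) blast
    obtain ps where ps: "K_list ps" "\<And>x. x \<in> K \<Longrightarrow> \<exists>p\<in>set ps. x + p \<in> U"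
      using finite_translate_cover[OF U zero_mem] by auto
    define n where "n = real (length ps)"
    have n: "n \<ge> 1" using ps(1) by (cases ps) (auto simp: n_def K_list_def)
    \<comment> \<open>With \<open>n\<close> translates, a single small summand lowers the new
      maximum by an \<open>n\<close>-th part only; hence the tolerance
      \<open>e / (4 * n)\<close>.\<close>
    have "Inf B < M + e / (4 * n)" using \<open>e > 0\<close> n by (simp add: M_def)
    then obtain b where b: "b \<in> B" "b < M + e / (4 * n)"
      using cInf_lessD[OF ne] by blast
    then obtain ks where ks: "K_list ks" "\<And>x. x \<in> K \<Longrightarrow> right_avg ks f x \<le> b"
      by (auto simp: B_def)
    define g where "g = right_avg ks f"
    have Mb: "M \<le> b" using M_le[of ks b] ks by blast
    have en: "e / (4 * n) \<le> e"
      using \<open>e > 0\<close> n by (simp add: field_simps)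
    have "M - e \<le> g x0" if x0: "x0 \<in> K" for x0
    proof (rule ccontr)
      assume "\<not> M - e \<le> g x0"
      have near: "g (u + x0) \<le> M - 3 * e / 4" if u: "u \<in> U" "u \<in> K" for u
      proof -
        have "right_avg ks (\<lambda>x. f (u + x) - f x) x0 \<le> e / 4"
        proof (rule right_avg_le)
          show "ks \<noteq> []" using ks(1) by (simp add: K_list_def)
          fix k assume "k \<in> set ks"
          then have "x0 + k \<in> K" using ks(1) x0 by (auto simp: K_list_def intro!: add_mem)
          from Uf[OF u this] show "f (u + (x0 + k)) - f (x0 + k) \<le> e / 4" by linarith
        qed
        moreover have "right_avg ks (\<lambda>x. f (u + x) - f x) x0 = g (u + x0) - g x0"
          by (simp add: g_def right_avg_def add.assoc sum_list_subtractf diff_divide_distrib)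
        ultimately show ?thesis using \<open>\<not> M - e \<le> g x0\<close> by simp
      qed
      \<comment> \<open>Since \<open>x + (p + x0) = (x + p) + x0\<close> and \<open>x + p\<close>
        lies in \<open>U\<close> for some \<open>p\<close>, at every \<open>x\<close> one of the
        \<open>n\<close> summands obeys \<open>near\<close>, and the others are at most
        \<open>b\<close>.\<close>
      define qs where "qs = map (\<lambda>p. p + x0) ps"
      have qs: "K_list qs" using ps(1) x0 by (auto simp: qs_def K_list_def intro!: add_mem)
      define b' where "b' = ((n - 1) * b + (M - 3 * e / 4)) / n"
      have "right_avg qs g x \<le> b'" if x: "x \<in> K" for x
      proof -
        obtain p where p: "p \<in> set ps" "x + p \<in> U" using ps(2)[OF x] by blast
        then obtain ys zs where yz: "ps = ys @ p # zs" by (meson split_list)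
        have K': "set ps \<subseteq> K" using ps(1) by (simp add: K_list_def)
        have le: "g (x + (q + x0)) \<le> b" if "q \<in> set ps" for q
          unfolding g_def using that K' x x0 by (intro ks(2) add_mem) auto
        have "g (x + (p + x0)) \<le> M - 3 * e / 4"
          using near[of "x + p"] p x K' by (auto simp: add.assoc intro: add_mem)
        moreover have "(\<Sum>q\<leftarrow>ys. g (x + (q + x0))) \<le> real (length ys) * b"
          by (rule sum_list_le_length) (auto simp: yz intro!: le)
        moreover have "(\<Sum>q\<leftarrow>zs. g (x + (q + x0))) \<le> real (length zs) * b"
          by (rule sum_list_le_length) (auto simp: yz intro!: le)
        ultimately have "(\<Sum>q\<leftarrow>ps. g (x + (q + x0))) \<le> (n - 1) * b + (M - 3 * e / 4)"
          by (simp add: yz n_def algebra_simps)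
        then show ?thesis
          using n by (simp add: right_avg_def qs_def b'_def comp_def n_def[symmetric] divide_right_mono)
      qed
      then have "\<forall>x\<in>K. right_avg (map (\<lambda>(k, l). k + l) (List.product qs ks)) f x \<le> b'"
        by (simp add: g_def right_avg_right_avg)
      \<comment> \<open>This says \<open>3 * e / 4 \<le> (n - 1) * (b - M)\<close>, whereas the
        choice of \<open>b\<close> bounds the right side by \<open>e / 4\<close>.\<close>
      from M_le[OF K_list_product[OF qs ks(1)] this] have "n * M \<le> (n - 1) * b + (M - 3 * e / 4)"
        using n by (simp add: b'_def field_simps)
      moreover have "(n - 1) * (b - M) \<le> n * (e / (4 * n))"
        using b(2) n Mb by (intro mult_mono) auto
      moreover have "n * (e / (4 * n)) = e / 4" using n by simp
      ultimately show False using \<open>e > 0\<close> by (simp add: algebra_simps)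
    qed
    moreover have "g x \<le> M + e" if "x \<in> K" for x
      using ks(2)[OF that] b(2) en by (simp add: g_def)
    ultimately show ?thesis
      using ks(1) by (intro exI[of _ ks]) (force simp: g_def abs_le_iff)
  qed
  then show ?thesis by blast
qed

text \<open>Inversion exchanges the two sides, so left averages of \<open>f\<close> are governed by
  \<open>ex_right_avg\<close> for the reflected function.\<close>

lemma right_avg_uminus: "right_avg ks (\<lambda>x. f (- x)) x = left_avg (map uminus ks) f (- x)"
  by (simp add: right_avg_def left_avg_def comp_def minus_add)

lemma ex_left_avg:
  assumes f: "continuous_on K f"
  shows "\<exists>c. \<forall>e>0. \<exists>ks. K_list ks \<and> (\<forall>x\<in>K. \<bar>left_avg ks f x - c\<bar> \<le> e)"
proof -
  obtain c where c: "\<And>e. e > 0 \<Longrightarrow> \<exists>ks. K_list ks \<and> (\<forall>x\<in>K. \<bar>right_avg ks (\<lambda>x. f (- x)) x - c\<bar> \<le> e)"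
    using ex_right_avg[OF continuous_on_inverse[OF f]] by blast
  have "\<exists>ks. K_list ks \<and> (\<forall>x\<in>K. \<bar>left_avg ks f x - c\<bar> \<le> e)" if "e > 0" for e
  proof -
    obtain ks where ks: "K_list ks" "\<forall>x\<in>K. \<bar>right_avg ks (\<lambda>x. f (- x)) x - c\<bar> \<le> e"
      using c \<open>e > 0\<close> by blast
    have "\<bar>left_avg (map uminus ks) f x - c\<bar> \<le> e" if "x \<in> K" for x
      using ks(2) uminus_mem[OF that] right_avg_uminus[of ks f "- x"] by force
    moreover have "K_list (map uminus ks)" using ks(1) by (auto simp: K_list_def uminus_mem)
    ultimately show ?thesis by blast
  qed
  then show ?thesis by blast
qed

text \<open>The two-sided average at \<open>0\<close> is close to both constants. Comparing all
  right constants with one left constant also makes the right constant unique, which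
  \<open>mean\<close> relies on.\<close>

lemma left_right_avg_eq:
  assumes l: "\<And>e. e > 0 \<Longrightarrow> \<exists>ks. K_list ks \<and> (\<forall>x\<in>K. \<bar>left_avg ks f x - c\<bar> \<le> e)"
    and r: "\<And>e. e > 0 \<Longrightarrow> \<exists>ks. K_list ks \<and> (\<forall>x\<in>K. \<bar>right_avg ks f x - c'\<bar> \<le> e)"
  shows "c = c'"
proof -
  have "\<bar>c - c'\<bar> \<le> e" if "e > 0" for e
  proof -
    obtain ks where ks: "K_list ks" "\<forall>x\<in>K. \<bar>left_avg ks f x - c\<bar> \<le> e / 2"
      using l[of "e / 2"] \<open>e > 0\<close> by auto
    obtain ls where ls: "K_list ls" "\<forall>x\<in>K. \<bar>right_avg ls f x - c'\<bar> \<le> e / 2"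
      using r[of "e / 2"] \<open>e > 0\<close> by auto
    have "\<bar>left_avg ks (right_avg ls f) 0 - c'\<bar> \<le> e / 2"
      using ks(1) ls(2) by (intro left_avg_close) (auto simp: K_list_def subset_iff)
    moreover have "\<bar>right_avg ls (left_avg ks f) 0 - c\<bar> \<le> e / 2"
      using ls(1) ks(2) by (intro right_avg_close) (auto simp: K_list_def subset_iff)
    ultimately show ?thesis by (simp only: left_avg_right_avg abs_le_iff) linarith
  qed
  then show ?thesis using dense_ge[of 0 "\<bar>c - c'\<bar>"] by force
qed

text \<open>For \<open>f\<close> continuous on \<open>K\<close> this is the integral against the
  normalised Haar measure of \<open>K\<close>; the choice is justified in
  \<open>mean_right_avg\<close>.\<close>

definition mean :: "('g \<Rightarrow> real) \<Rightarrow> real" where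
  "mean f = (THE c. \<forall>e>0. \<exists>ks. K_list ks \<and> (\<forall>x\<in>K. \<bar>right_avg ks f x - c\<bar> \<le> e))"

lemma mean_right_avg:
  assumes "continuous_on K f" "e > 0"
  obtains ks where "K_list ks" "\<And>x. x \<in> K \<Longrightarrow> \<bar>right_avg ks f x - mean f\<bar> \<le> e"
proof -
  have "\<exists>!c. \<forall>e>0. \<exists>ks. K_list ks \<and> (\<forall>x\<in>K. \<bar>right_avg ks f x - c\<bar> \<le> e)"
    using ex_right_avg[OF assms(1)] ex_left_avg[OF assms(1)] left_right_avg_eq[of f] by metis
  from theI'[OF this] assms(2) that show thesis unfolding mean_def by blast
qed

text \<open>The mean may be recognised from averages on either side, so each later proof takes the
  side that commutes with the operation at hand.\<close>

lemma mean_eqI_left: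
  assumes "continuous_on K f"
    and "\<And>e. e > 0 \<Longrightarrow> \<exists>ks. K_list ks \<and> (\<forall>x\<in>K. \<bar>left_avg ks f x - c\<bar> \<le> e)"
  shows "mean f = c"
  using left_right_avg_eq[of f c "mean f"] assms mean_right_avg[OF assms(1)] by metis

lemma mean_left_avg:
  assumes "continuous_on K f" "e > 0"
  obtains ks where "K_list ks" "\<And>x. x \<in> K \<Longrightarrow> \<bar>left_avg ks f x - mean f\<bar> \<le> e"
  using ex_left_avg[OF assms(1)] mean_eqI_left[OF assms(1)] assms(2) by metis

lemma mean_eqI_right:
  assumes "continuous_on K f"
    and "\<And>e. e > 0 \<Longrightarrow> \<exists>ks. K_list ks \<and> (\<forall>x\<in>K. \<bar>right_avg ks f x - c\<bar> \<le> e)"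
  shows "mean f = c"
  using left_right_avg_eq[of f "mean f" c] assms mean_left_avg[OF assms(1)] by metis

lemma mean_cong: "(\<And>x. x \<in> K \<Longrightarrow> f x = g x) \<Longrightarrow> mean f = mean g"
proof -
  assume *: "\<And>x. x \<in> K \<Longrightarrow> f x = g x"
  have "right_avg ks f x = right_avg ks g x" if "K_list ks" "x \<in> K" for ks x
    using that * unfolding right_avg_def K_list_def
    by (intro arg_cong2[of _ _ _ _ "(/)"] arg_cong[of _ _ sum_list] map_cong refl) (auto intro!: * add_mem)
  then show ?thesis
    unfolding mean_def by (intro arg_cong[of _ _ The] ext) (auto cong: conj_cong)
qed

section \<open>Linearity, invariance and positivity of the mean\<close>

lemma mean_const: "mean (\<lambda>_. c) = c"
proof (rule mean_eqI_right)
  show "\<exists>ks. K_list ks \<and> (\<forall>x\<in>K. \<bar>right_avg ks (\<lambda>_. c) x - c\<bar> \<le> e)" if "e > 0" for e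
    using that zero_mem by (intro exI[of _ "[0]"]) (auto simp: K_list_def right_avg_def)
qed auto

lemma mean_close:
  assumes "continuous_on K f" "\<And>x. x \<in> K \<Longrightarrow> \<bar>f x - c\<bar> \<le> e"
  shows "\<bar>mean f - c\<bar> \<le> e"
proof (rule field_le_epsilon)
  fix d :: real assume "d > 0"
  then obtain ks where ks: "K_list ks" "\<And>x. x \<in> K \<Longrightarrow> \<bar>right_avg ks f x - mean f\<bar> \<le> d"
    using mean_right_avg[OF assms(1)] by metis
  have "\<bar>right_avg ks f 0 - c\<bar> \<le> e"
    using ks(1) assms(2) by (intro right_avg_close) (auto simp: K_list_def subset_iff)
  then show "\<bar>mean f - c\<bar> \<le> e + d" using ks(2)[OF zero_mem] by linarith
qed

text \<open>The left averages of \<open>right_avg ks f\<close> are right averages over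
  \<open>ks\<close> of nearly constant functions, hence nearly constant with the same value.\<close>

lemma mean_right_avg_eq:
  assumes "continuous_on K f" "K_list ks"
  shows "mean (right_avg ks f) = mean f"
proof (rule mean_eqI_left)
  show "continuous_on K (right_avg ks f)" by (rule continuous_on_right_avg[OF assms])
  fix e :: real assume "e > 0"
  then obtain ls where ls: "K_list ls" "\<And>x. x \<in> K \<Longrightarrow> \<bar>left_avg ls f x - mean f\<bar> \<le> e"
    using mean_left_avg[OF assms(1)] by metis
  have "\<bar>left_avg ls (right_avg ks f) x - mean f\<bar> \<le> e" if "x \<in> K" for x
    unfolding left_avg_right_avg using assms(2) ls(2) that
    by (intro right_avg_close) (auto simp: K_list_def subset_iff add_mem)
  with ls(1) show "\<exists>ls. K_list ls \<and> (\<forall>x\<in>K. \<bar>left_avg ls (right_avg ks f) x - mean f\<bar> \<le> e)"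
    by blast
qed

lemma mean_left_avg_eq:
  assumes "continuous_on K f" "K_list ks"
  shows "mean (left_avg ks f) = mean f"
proof (rule mean_eqI_right)
  show "continuous_on K (left_avg ks f)" by (rule continuous_on_left_avg[OF assms])
  fix e :: real assume "e > 0"
  then obtain ls where ls: "K_list ls" "\<And>x. x \<in> K \<Longrightarrow> \<bar>right_avg ls f x - mean f\<bar> \<le> e"
    using mean_right_avg[OF assms(1)] by metis
  have "\<bar>right_avg ls (left_avg ks f) x - mean f\<bar> \<le> e" if "x \<in> K" for x
    unfolding left_avg_right_avg[symmetric] using assms(2) ls(2) that
    by (intro left_avg_close) (auto simp: K_list_def subset_iff add_mem)
  with ls(1) show "\<exists>ls. K_list ls \<and> (\<forall>x\<in>K. \<bar>right_avg ls (left_avg ks f) x - mean f\<bar> \<le> e)"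
    by blast
qed

lemma mean_translate_right:
  assumes "continuous_on K f" "k \<in> K"
  shows "mean (\<lambda>x. f (x + k)) = mean f"
  using mean_right_avg_eq[of f "[k]"] assms by (simp add: K_list_def right_avg_def[abs_def])

lemma mean_translate_left:
  assumes "continuous_on K f" "k \<in> K"
  shows "mean (\<lambda>x. f (k + x)) = mean f"
  using mean_left_avg_eq[of f "[k]"] assms by (simp add: K_list_def left_avg_def[abs_def])

text \<open>The lists that flatten \<open>f\<close> and \<open>g\<close> differ, so the definition
  does not give additivity directly. Flattening \<open>f\<close> from the left and \<open>g\<close>
  from the right by commuting averages brings \<open>f + g\<close> close to the sum of the means,
  and neither averaging changes the mean.\<close>

lemma mean_add:
  assumes f: "continuous_on K f" and g: "continuous_on K g"
  shows "mean (\<lambda>x. f x + g x) = mean f + mean g"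
proof -
  have "\<bar>mean (\<lambda>x. f x + g x) - (mean f + mean g)\<bar> \<le> e" if "e > 0" for e
  proof -
    obtain ks where ks: "K_list ks" "\<And>x. x \<in> K \<Longrightarrow> \<bar>right_avg ks g x - mean g\<bar> \<le> e / 2"
      using mean_right_avg[OF g, of "e / 2"] \<open>e > 0\<close> by auto
    obtain ls where ls: "K_list ls" "\<And>x. x \<in> K \<Longrightarrow> \<bar>left_avg ls f x - mean f\<bar> \<le> e / 2"
      using mean_left_avg[OF f, of "e / 2"] \<open>e > 0\<close> by auto
    have fg: "continuous_on K (\<lambda>x. f x + g x)" by (intro continuous_intros f g)
    define H where "H = right_avg ks (left_avg ls (\<lambda>x. f x + g x))"
    have cH: "continuous_on K H"
      unfolding H_def by (intro continuous_on_right_avg continuous_on_left_avg fg ks ls)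
    have mH: "mean H = mean (\<lambda>x. f x + g x)"
      unfolding H_def using fg ks ls
      by (simp add: mean_right_avg_eq mean_left_avg_eq continuous_on_left_avg)
    have H: "H x = right_avg ks (left_avg ls f) x + left_avg ls (right_avg ks g) x" for x
      by (simp add: H_def left_avg_right_avg flip: right_avg_add left_avg_add)
    have "\<bar>H x - (mean f + mean g)\<bar> \<le> e" if x: "x \<in> K" for x
    proof -
      have "\<bar>right_avg ks (left_avg ls f) x - mean f\<bar> \<le> e / 2"
        using ks(1) ls(2) x by (intro right_avg_close) (auto simp: K_list_def subset_iff add_mem)
      moreover have "\<bar>left_avg ls (right_avg ks g) x - mean g\<bar> \<le> e / 2"
        using ls(1) ks(2) x by (intro left_avg_close) (auto simp: K_list_def subset_iff add_mem)
      ultimately show ?thesis unfolding H abs_le_iff by (auto simp: field_simps)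
    qed
    from mean_close[OF cH this] show ?thesis by (simp add: mH)
  qed
  then show ?thesis using dense_ge[of 0 "\<bar>mean (\<lambda>x. f x + g x) - (mean f + mean g)\<bar>"] by force
qed

lemma mean_cmult:
  assumes f: "continuous_on K f"
  shows "mean (\<lambda>x. c * f x) = c * mean f"
proof (rule mean_eqI_right)
  show "continuous_on K (\<lambda>x. c * f x)" by (intro continuous_intros f)
  fix e :: real assume "e > 0"
  define d where "d = e / (\<bar>c\<bar> + 1)"
  have "d > 0" using \<open>e > 0\<close> by (simp add: d_def add_nonneg_pos)
  then obtain ks where ks: "K_list ks" "\<And>x. x \<in> K \<Longrightarrow> \<bar>right_avg ks f x - mean f\<bar> \<le> d"
    using mean_right_avg[OF f] by metis
  have "\<bar>c\<bar> * d \<le> e"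
    using \<open>e > 0\<close> by (simp add: d_def divide_simps add_nonneg_pos)
  have "\<bar>right_avg ks (\<lambda>x. c * f x) x - c * mean f\<bar> \<le> e" if "x \<in> K" for x
  proof -
    have "right_avg ks (\<lambda>x. c * f x) x - c * mean f = c * (right_avg ks f x - mean f)"
      by (simp add: right_avg_def sum_list_const_mult algebra_simps)
    then have "\<bar>right_avg ks (\<lambda>x. c * f x) x - c * mean f\<bar> = \<bar>c\<bar> * \<bar>right_avg ks f x - mean f\<bar>"
      by (simp add: abs_mult)
    also have "\<dots> \<le> \<bar>c\<bar> * d" using ks(2)[OF that] by (intro mult_left_mono) auto
    finally show ?thesis using \<open>\<bar>c\<bar> * d \<le> e\<close> by linarith
  qed
  with ks(1) show "\<exists>ks. K_list ks \<and> (\<forall>x\<in>K. \<bar>right_avg ks (\<lambda>x. c * f x) x - c * mean f\<bar> \<le> e)"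
    by blast
qed

lemma mean_diff:
  assumes f: "continuous_on K f" and g: "continuous_on K g"
  shows "mean (\<lambda>x. f x - g x) = mean f - mean g"
proof -
  have "mean (\<lambda>x. f x - g x) = mean (\<lambda>x. f x + (- 1) * g x)" by simp
  also have "\<dots> = mean f + (- 1) * mean g"
    using mean_add[OF f, of "\<lambda>x. (- 1) * g x"] mean_cmult[OF g, of "- 1"] g
    by (auto intro!: continuous_intros)
  finally show ?thesis by simp
qed

lemma mean_sum:
  assumes "finite J" "\<And>j. j \<in> J \<Longrightarrow> continuous_on K (f j)"
  shows "mean (\<lambda>x. \<Sum>j\<in>J. f j x) = (\<Sum>j\<in>J. mean (f j))"
  using assms
  by (induction J) (auto simp: mean_const mean_add continuous_on_sum)

lemma mean_nonneg:
  assumes f: "continuous_on K f" and "\<And>x. x \<in> K \<Longrightarrow> 0 \<le> f x"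
  shows "0 \<le> mean f"
proof -
  have "bounded (f ` K)"
    using compact_continuous_image[OF f compact] compact_imp_bounded by blast
  then obtain C where C: "\<And>x. x \<in> K \<Longrightarrow> \<bar>f x\<bar> \<le> C"
    by (auto simp: bounded_iff)
  have "\<bar>mean f - C\<bar> \<le> C"
    using C assms(2) by (intro mean_close[OF f]) (force simp: abs_le_iff)
  then show ?thesis by linarith
qed

lemma mean_mono:
  assumes "continuous_on K f" "continuous_on K g" "\<And>x. x \<in> K \<Longrightarrow> f x \<le> g x"
  shows "mean f \<le> mean g"
  using mean_nonneg[of "\<lambda>x. g x - f x"] mean_diff[OF assms(2,1)] assms
  by (auto intro!: continuous_intros)

text \<open>Finitely many translates bring every point of \<open>K\<close> into the open set
  \<open>U\<close> where \<open>f\<close> exceeds half of \<open>f x0\<close>, so one right average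
  of \<open>f\<close> is bounded below by a positive constant on \<open>K\<close>.\<close>

lemma mean_pos:
  assumes f: "continuous_on UNIV f" and nn: "\<And>x. x \<in> K \<Longrightarrow> 0 \<le> f x" and x0: "x0 \<in> K" "f x0 > 0"
  shows "0 < mean f"
proof -
  have fK: "continuous_on K f" using f continuous_on_subset by blast
  define U where "U = {x. f x > f x0 / 2}"
  have "open U" unfolding U_def by (intro open_Collect_less continuous_intros f)
  moreover have "x0 \<in> U" using x0(2) by (simp add: U_def)
  ultimately obtain ps where ps: "K_list ps" "\<And>x. x \<in> K \<Longrightarrow> \<exists>p\<in>set ps. x + p \<in> U"
    using finite_translate_cover[OF _ _ x0(1)] by metis
  define n where "n = real (length ps)"
  have n: "n \<ge> 1" using ps(1) by (cases ps) (auto simp: n_def K_list_def)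
  have "f x0 / 2 / n \<le> right_avg ps f x" if x: "x \<in> K" for x
  proof -
    obtain p where p: "p \<in> set ps" "x + p \<in> U" using ps(2)[OF x] by blast
    then obtain ys zs where yz: "ps = ys @ p # zs" by (meson split_list)
    have K': "set ps \<subseteq> K" using ps(1) by (simp add: K_list_def)
    have "0 \<le> f (x + q)" if "q \<in> set ps" for q
      using that K' x by (intro nn add_mem) auto
    then have "0 \<le> (\<Sum>q\<leftarrow>ys. f (x + q))" "0 \<le> (\<Sum>q\<leftarrow>zs. f (x + q))"
      by (auto simp: yz intro!: sum_list_nonneg)
    moreover have "f (x + p) > f x0 / 2" using p(2) by (simp add: U_def)
    ultimately have "f x0 / 2 \<le> (\<Sum>q\<leftarrow>ps. f (x + q))" by (simp add: yz)
    from divide_right_mono[OF this, of n] n show ?thesis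
      unfolding right_avg_def n_def[symmetric] by linarith
  qed
  then have "mean (\<lambda>_. f x0 / 2 / n) \<le> mean (right_avg ps f)"
    by (intro mean_mono continuous_on_right_avg fK ps) auto
  then show ?thesis
    using mean_right_avg_eq[OF fK ps(1)] x0(2) n by (simp add: mean_const) (smt (verit) divide_pos_pos)
qed

text \<open>Uniqueness of Haar measure: at a nearly constant average of \<open>F\<close>,
  \<open>close\<close> determines \<open>\<mu>\<close> up to \<open>e\<close>, and
  \<open>inv\<close> carries this back to \<open>F\<close>.\<close>

lemma mean_unique:
  assumes F: "continuous_on K F"
    and inv: "\<And>ks. K_list ks \<Longrightarrow> \<mu> (right_avg ks F) = \<mu> F"
    and close: "\<And>f c e. continuous_on K f \<Longrightarrow> (\<And>x. x \<in> K \<Longrightarrow> \<bar>f x - c\<bar> \<le> e) \<Longrightarrow> \<bar>\<mu> f - c\<bar> \<le> e"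
  shows "\<mu> F = mean F"
proof -
  have "\<bar>\<mu> F - mean F\<bar> \<le> e" if "e > 0" for e
  proof -
    obtain ks where "K_list ks" "\<And>x. x \<in> K \<Longrightarrow> \<bar>right_avg ks F x - mean F\<bar> \<le> e"
      using mean_right_avg[OF F \<open>e > 0\<close>] by metis
    with close[OF continuous_on_right_avg[OF F]] inv show ?thesis by metis
  qed
  then show ?thesis using dense_ge[of 0 "\<bar>\<mu> F - mean F\<bar>"] by force
qed

lemma continuous_on_mean:
  fixes F :: "'a::topological_space \<times> 'g \<Rightarrow> real"
  assumes F: "continuous_on (S \<times> K) F"
  shows "continuous_on S (\<lambda>x. mean (\<lambda>y. F (x, y)))"
  unfolding continuous_on_topological
proof (intro ballI allI impI)
  fix x0 and B :: "real set" assume x0: "x0 \<in> S" and B: "open B" "mean (\<lambda>y. F (x0, y)) \<in> B"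
  have sec: "continuous_on K (\<lambda>y. F (x, y))" if "x \<in> S" for x
    by (rule continuous_on_compose2[OF F]) (use that in \<open>auto intro!: continuous_intros\<close>)
  from B obtain e where e: "e > 0" "\<And>z. \<bar>z - mean (\<lambda>y. F (x0, y))\<bar> \<le> e \<Longrightarrow> z \<in> B"
    unfolding open_contains_cball by (force simp: dist_real_def abs_minus_commute)
  obtain X where X: "x0 \<in> X" "open X" "\<forall>x\<in>X \<inter> S. \<forall>t\<in>K. dist (F (x, t)) (F (x0, t)) \<le> e"
    using continuous_on_prod_compactE[OF F compact x0 e(1)] by metis
  have "mean (\<lambda>y. F (x, y)) \<in> B" if "x \<in> S" "x \<in> X" for x
  proof (rule e(2))
    have "\<bar>mean (\<lambda>y. F (x, y) - F (x0, y)) - 0\<bar> \<le> e"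
      using X(3) that x0 by (intro mean_close continuous_intros sec) (auto simp: dist_real_def)
    then show "\<bar>mean (\<lambda>y. F (x, y)) - mean (\<lambda>y. F (x0, y))\<bar> \<le> e"
      using mean_diff[OF sec sec] that x0 by simp
  qed
  with X show "\<exists>A. open A \<and> x0 \<in> A \<and> (\<forall>y\<in>S. y \<in> A \<longrightarrow> mean (\<lambda>ya. F (y, ya)) \<in> B)" by blast
qed

end

text \<open>With this instance \<open>K \<times> K\<close> is itself a compact subgroup with a mean,
  the common value of the two iterated means in \<open>mean_swap\<close>.\<close>

instance prod :: (topological_group_add, topological_group_add) topological_group_add
proof
  fix a b :: "'a \<times> 'b"
  show "LIM x nhds a \<times>\<^sub>F nhds b. fst x + snd x :> nhds (a + b)"
    unfolding plus_prod_def nhds_prod[symmetric]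
    by (intro tendsto_Pair tendsto_add tendsto_fst tendsto_snd)
      (auto intro!: tendsto_fst[OF filterlim_ident[of "nhds (a, b)"], simplified]
        tendsto_snd[OF filterlim_ident[of "nhds (a, b)"], simplified])
next
  fix a :: "'a \<times> 'b"
  show "(uminus \<longlongrightarrow> - a) (nhds a)"
    unfolding uminus_prod_def
    by (intro tendsto_Pair tendsto_minus tendsto_fst tendsto_snd filterlim_ident)
qed

section \<open>Interchange of iterated means\<close>

context compact_subgroup
begin

lemma compact_subgroup_Times: "compact_subgroup (K \<times> K)"
  by unfold_locales
    (auto simp: is_subgroup_def zero_prod_def zero_mem add_mem uminus_mem compact compact_Times)

text \<open>Fubini: each iterated mean is a functional to which \<open>mean_unique\<close> over
  \<open>K \<times> K\<close> applies.\<close>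

lemma mean_swap:
  assumes F: "continuous_on (K \<times> K) F"
  shows "mean (\<lambda>x. mean (\<lambda>y. F (x, y))) = mean (\<lambda>y. mean (\<lambda>x. F (x, y)))"
proof -
  interpret KK: compact_subgroup "K \<times> K" by (rule compact_subgroup_Times)
  have sec1: "continuous_on K (\<lambda>y. f (x, y))" if "continuous_on (K \<times> K) f" "x \<in> K"
    for x and f :: "'g \<times> 'g \<Rightarrow> real"
    by (rule continuous_on_compose2[OF that(1)]) (use that in \<open>auto intro!: continuous_intros\<close>)
  have sec2: "continuous_on K (\<lambda>x. f (x, y))" if "continuous_on (K \<times> K) f" "y \<in> K"
    for y and f :: "'g \<times> 'g \<Rightarrow> real"
    by (rule continuous_on_compose2[OF that(1)]) (use that in \<open>auto intro!: continuous_intros\<close>)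
  have swap: "continuous_on (K \<times> K) (\<lambda>(x, y). f (y, x))" if "continuous_on (K \<times> K) f"
    for f :: "'g \<times> 'g \<Rightarrow> real"
    unfolding split_def
    by (rule continuous_on_compose2[OF that(1)]) (auto intro!: continuous_intros)
  have tr: "continuous_on (K \<times> K) (\<lambda>p. f (p + q))" if "continuous_on (K \<times> K) f" "q \<in> K \<times> K"
    for q and f :: "'g \<times> 'g \<Rightarrow> real"
    using KK.continuous_on_translate_right[OF that] .
  have *: "mean (\<lambda>x. mean (\<lambda>y. F (x, y))) = KK.mean F" if F: "continuous_on (K \<times> K) F" for F
  proof (rule KK.mean_unique[OF F, where \<mu> = "\<lambda>F. mean (\<lambda>x. mean (\<lambda>y. F (x, y)))"])
    show "\<bar>mean (\<lambda>x. mean (\<lambda>y. f (x, y))) - c\<bar> \<le> e"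
      if "continuous_on (K \<times> K) f" "\<And>x. x \<in> K \<times> K \<Longrightarrow> \<bar>f x - c\<bar> \<le> e" for f c e
      using that by (intro mean_close continuous_on_mean sec1) auto
    fix ks assume ks: "KK.K_list ks"
    have add: "mean (\<lambda>x. mean (\<lambda>y. f (x, y) + g (x, y))) =
        mean (\<lambda>x. mean (\<lambda>y. f (x, y))) + mean (\<lambda>x. mean (\<lambda>y. g (x, y)))"
      if "continuous_on (K \<times> K) f" "continuous_on (K \<times> K) g" for f g
    proof -
      have "mean (\<lambda>x. mean (\<lambda>y. f (x, y) + g (x, y))) =
          mean (\<lambda>x. mean (\<lambda>y. f (x, y)) + mean (\<lambda>y. g (x, y)))"
        by (intro mean_cong mean_add sec1 that)
      then show ?thesis using that by (simp add: mean_add continuous_on_mean)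
    qed
    have cm: "mean (\<lambda>x. mean (\<lambda>y. c * f (x, y))) = c * mean (\<lambda>x. mean (\<lambda>y. f (x, y)))"
      if "continuous_on (K \<times> K) f" for f c
    proof -
      have "mean (\<lambda>x. mean (\<lambda>y. c * f (x, y))) = mean (\<lambda>x. c * mean (\<lambda>y. f (x, y)))"
        by (intro mean_cong mean_cmult sec1 that)
      then show ?thesis using that by (simp add: mean_cmult continuous_on_mean)
    qed
    have inv: "mean (\<lambda>x. mean (\<lambda>y. F ((x, y) + q))) = mean (\<lambda>x. mean (\<lambda>y. F (x, y)))"
      if "q \<in> K \<times> K" for q
    proof -
      obtain a b where q: "q = (a, b)" "a \<in> K" "b \<in> K" using \<open>q \<in> K \<times> K\<close> by blast
      have "mean (\<lambda>x. mean (\<lambda>y. F ((x, y) + q))) = mean (\<lambda>x. mean (\<lambda>y. F (x + a, y)))"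
        using q by (intro mean_cong[of "\<lambda>x. mean (\<lambda>y. F ((x, y) + q))"])
          (simp add: mean_translate_right[OF sec1[OF F add_mem]])
      also have "\<dots> = mean (\<lambda>x. mean (\<lambda>y. F (x, y)))"
        using mean_translate_right[OF continuous_on_mean[OF F] q(2)] by simp
      finally show ?thesis .
    qed
    \<comment> \<open>Invariance under one translation \<open>q\<close> passes to averages by
      linearity; the induction on the list carries continuity of the partial sums along.\<close>
    have "set ks \<subseteq> K \<times> K" using ks by (simp add: KK.K_list_def)
    then have "continuous_on (K \<times> K) (\<lambda>p. \<Sum>q\<leftarrow>ks. F (p + q)) \<and>
       mean (\<lambda>x. mean (\<lambda>y. \<Sum>q\<leftarrow>ks. F ((x, y) + q))) =
        real (length ks) * mean (\<lambda>x. mean (\<lambda>y. F (x, y)))"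
    proof (induction ks)
      case (Cons q ks)
      then show ?case
        using add[OF tr[OF F, of q], of "\<lambda>p. \<Sum>q\<leftarrow>ks. F (p + q)"] inv[of q] tr[OF F, of q]
        by (simp add: continuous_on_add algebra_simps del: add_Pair)
    qed (simp add: mean_const)
    then show "mean (\<lambda>x. mean (\<lambda>y. right_avg ks F (x, y))) = mean (\<lambda>x. mean (\<lambda>y. F (x, y)))"
      using cm[of "\<lambda>p. \<Sum>q\<leftarrow>ks. F (p + q)" "inverse (real (length ks))"] ks
      by (simp add: right_avg_def divide_inverse mult.commute KK.K_list_def)
  qed
  have **: "mean (\<lambda>x. mean (\<lambda>y. F (y, x))) = KK.mean F"
  proof (rule KK.mean_unique[OF F, where \<mu> = "\<lambda>F. mean (\<lambda>x. mean (\<lambda>y. F (y, x)))"])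
    show "\<bar>mean (\<lambda>x. mean (\<lambda>y. f (y, x))) - c\<bar> \<le> e"
      if "continuous_on (K \<times> K) f" "\<And>x. x \<in> K \<times> K \<Longrightarrow> \<bar>f x - c\<bar> \<le> e" for f c e
      using that continuous_on_mean[OF swap[OF that(1)]] by (intro mean_close sec2) auto
    fix ks assume ks: "KK.K_list ks"
    \<comment> \<open>Exchanging the coordinates reduces invariance of the second iterated mean to
      the first, already identified with \<open>KK.mean\<close>.\<close>
    define sw :: "'g \<times> 'g \<Rightarrow> 'g \<times> 'g" where "sw = (\<lambda>(x, y). (y, x))"
    have ks': "KK.K_list (map sw ks)" using ks by (auto simp: KK.K_list_def sw_def)
    have r: "right_avg ks F (y, x) = right_avg (map sw ks) (\<lambda>(x, y). F (y, x)) (x, y)" for x y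
      by (simp add: right_avg_def comp_def sw_def split_def plus_prod_def)
    have "mean (\<lambda>x. mean (\<lambda>y. right_avg ks F (y, x))) = KK.mean (right_avg (map sw ks) (\<lambda>(x, y). F (y, x)))"
      unfolding r by (rule *[OF KK.continuous_on_right_avg[OF swap[OF F] ks']])
    also have "\<dots> = KK.mean (\<lambda>(x, y). F (y, x))"
      by (rule KK.mean_right_avg_eq[OF swap[OF F] ks'])
    also have "\<dots> = mean (\<lambda>x. mean (\<lambda>y. F (y, x)))"
      using *[OF swap[OF F]] by simp
    finally show "mean (\<lambda>x. mean (\<lambda>y. right_avg ks F (y, x))) = mean (\<lambda>x. mean (\<lambda>y. F (y, x)))" .
  qed
  show ?thesis using *[OF F] ** by simp
qed

end

section \<open>Representative functions\<close>

lemma sum_fun_apply: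
  fixes g :: "'i \<Rightarrow> 'x \<Rightarrow> 'b::comm_monoid_add"
  shows "(\<Sum>i\<in>I. g i) y = (\<Sum>i\<in>I. g i y)"
  by (induction I rule: infinite_finite_induct) auto

locale compact_group = compact_subgroup "UNIV :: 'g::{topological_group_add,t2_space} set"
begin

section \<open>The real inner product on continuous functions\<close>

definition ip :: "('g \<Rightarrow> real) \<Rightarrow> ('g \<Rightarrow> real) \<Rightarrow> real" where
  "ip f g = mean (\<lambda>x. f x * g x)"

abbreviation cont :: "('g \<Rightarrow> real) \<Rightarrow> bool" where
  "cont \<equiv> continuous_on UNIV"

lemma ip_commute: "ip f g = ip g f"
  by (simp add: ip_def mult.commute)

lemma ip_add_left: "cont f \<Longrightarrow> cont g \<Longrightarrow> cont h \<Longrightarrow> ip (\<lambda>x. f x + g x) h = ip f h + ip g h"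
  unfolding ip_def by (subst mean_add[symmetric]) (auto intro!: continuous_intros simp: algebra_simps)

lemma ip_diff_left: "cont f \<Longrightarrow> cont g \<Longrightarrow> cont h \<Longrightarrow> ip (\<lambda>x. f x - g x) h = ip f h - ip g h"
  unfolding ip_def by (subst mean_diff[symmetric]) (auto intro!: continuous_intros simp: algebra_simps)

lemma ip_cmult_left: "cont f \<Longrightarrow> cont h \<Longrightarrow> ip (\<lambda>x. c * f x) h = c * ip f h"
  unfolding ip_def by (subst mean_cmult[symmetric]) (auto intro!: continuous_intros simp: algebra_simps)

lemma ip_diff_right: "cont f \<Longrightarrow> cont g \<Longrightarrow> cont h \<Longrightarrow> ip h (\<lambda>x. f x - g x) = ip h f - ip h g"
  using ip_diff_left[of f g h] by (simp add: ip_commute)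

lemma ip_cmult_right: "cont f \<Longrightarrow> cont h \<Longrightarrow> ip h (\<lambda>x. c * f x) = c * ip h f"
  using ip_cmult_left[of f h c] by (simp add: ip_commute)

lemma ip_sum_left:
  "finite J \<Longrightarrow> (\<And>j. j \<in> J \<Longrightarrow> cont (f j)) \<Longrightarrow> cont h \<Longrightarrow>
    ip (\<lambda>x. \<Sum>j\<in>J. c j * f j x) h = (\<Sum>j\<in>J. c j * ip (f j) h)"
proof (induction J rule: finite_induct)
  case empty
  then show ?case by (simp add: ip_def mean_const)
next
  case (insert j J)
  then show ?case
    using ip_add_left[of "\<lambda>x. c j * f j x" "\<lambda>x. \<Sum>j\<in>J. c j * f j x" h]
    by (simp add: ip_cmult_left continuous_on_sum continuous_on_mult)
qed

lemma ip_self_nonneg: "cont f \<Longrightarrow> 0 \<le> ip f f"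
  unfolding ip_def by (intro mean_nonneg continuous_intros) auto

lemma ip_self_eq_0: "cont f \<Longrightarrow> ip f f = 0 \<Longrightarrow> f x = 0"
proof (rule ccontr)
  assume f: "cont f" and "ip f f = 0" "f x \<noteq> 0"
  have "0 < mean (\<lambda>x. f x * f x)"
    by (rule mean_pos[of _ x]) (use f \<open>f x \<noteq> 0\<close> in \<open>auto intro!: continuous_intros simp: zero_less_mult_iff\<close>)
  with \<open>ip f f = 0\<close> show False by (simp add: ip_def)
qed

lemma ip_diff_self:
  "cont f \<Longrightarrow> cont g \<Longrightarrow> ip (\<lambda>x. f x - c * g x) (\<lambda>x. f x - c * g x) = ip f f - 2 * c * ip f g + c\<^sup>2 * ip g g"
  by (simp add: ip_diff_left ip_diff_right ip_cmult_left ip_cmult_right continuous_on_diff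
      continuous_on_mult ip_commute[of g f] power2_eq_square algebra_simps)

lemma cauchy_schwarz: "cont f \<Longrightarrow> cont g \<Longrightarrow> (ip f g)\<^sup>2 \<le> ip f f * ip g g"
proof (cases "ip g g = 0")
  case True
  assume f: "cont f" "cont g"
  then have "ip f g = 0" using ip_self_eq_0[OF f(2) True] by (simp add: ip_def mean_const)
  with True show ?thesis by simp
next
  case False
  assume f: "cont f" "cont g"
  define t where "t = ip f g / ip g g"
  have pos: "ip g g > 0" using False ip_self_nonneg[OF f(2)] by simp
  have "0 \<le> ip (\<lambda>x. f x - t * g x) (\<lambda>x. f x - t * g x)"
    by (intro ip_self_nonneg continuous_intros f)
  also have "\<dots> = ip f f - (ip f g)\<^sup>2 / ip g g"
    unfolding ip_diff_self[OF f] using pos by (simp add: t_def field_simps power2_eq_square)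
  finally show ?thesis using pos by (simp add: field_simps)
qed

definition orthonormal :: "nat \<Rightarrow> (nat \<Rightarrow> 'g \<Rightarrow> real) \<Rightarrow> bool" where
  "orthonormal n e \<longleftrightarrow> (\<forall>i<n. cont (e i)) \<and> (\<forall>i<n. \<forall>j<n. ip (e i) (e j) = (if i = j then 1 else 0))"

lemma orthonormal_residual:
  assumes e: "orthonormal n e" and f: "cont f"
  defines "r \<equiv> \<lambda>x. f x - (\<Sum>i<n. ip f (e i) * e i x)"
  shows "cont r" "\<And>j. j < n \<Longrightarrow> ip r (e j) = 0" "ip r r = ip f f - (\<Sum>i<n. (ip f (e i))\<^sup>2)"
proof -
  have ce: "cont (e i)" if "i < n" for i using e that by (simp add: orthonormal_def)
  define p where "p = (\<lambda>x. \<Sum>i<n. ip f (e i) * e i x)"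
  have p: "cont p" unfolding p_def by (intro continuous_intros ce) auto
  show cr: "cont r" unfolding r_def by (intro continuous_intros f ce) auto
  have rp: "r = (\<lambda>x. f x - p x)" by (simp add: r_def p_def)
  have ip_p: "ip p h = (\<Sum>i<n. ip f (e i) * ip (e i) h)" if "cont h" for h
    unfolding p_def by (rule ip_sum_left) (auto intro: ce that)
  show re: "ip r (e j) = 0" if j: "j < n" for j
  proof -
    have "(\<Sum>i<n. ip f (e i) * ip (e i) (e j)) = (\<Sum>i<n. if i = j then ip f (e j) else 0)"
      using e j by (intro sum.cong) (auto simp: orthonormal_def)
    then show ?thesis
      unfolding rp using j by (simp add: ip_diff_left f p ce ip_p)
  qed
  have "ip p r = 0"
    using ip_p[OF cr] re by (simp add: ip_commute[of _ r])
  then have "ip r r = ip f r"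
    using ip_diff_left[OF f p cr] rp by simp
  also have "\<dots> = ip f f - ip p f"
    using ip_diff_right[OF f p f] rp by (simp add: ip_commute)
  also have "ip p f = (\<Sum>i<n. (ip f (e i))\<^sup>2)"
    by (simp add: ip_p[OF f] power2_eq_square ip_commute[of "e _" f])
  finally show "ip r r = ip f f - (\<Sum>i<n. (ip f (e i))\<^sup>2)" .
qed

lemma bessel: "orthonormal n e \<Longrightarrow> cont f \<Longrightarrow> (\<Sum>i<n. (ip f (e i))\<^sup>2) \<le> ip f f"
  using orthonormal_residual(1,3)[of n e f] ip_self_nonneg by fastforce

text \<open>An orthonormal system in \<open>W\<close> of greatest length is a basis: the normalised
  residual of a function outside its span would extend it. The single rule \<open>lin\<close> also
  yields multiples, since \<open>c * r = r - (1 - c) * r\<close>.\<close>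

lemma ex_orthonormal_basis:
  assumes W: "\<And>f. f \<in> W \<Longrightarrow> cont f"
    and lin: "\<And>f g c. f \<in> W \<Longrightarrow> g \<in> W \<Longrightarrow> (\<lambda>x. f x - c * g x) \<in> W"
    and bound: "\<And>n e. orthonormal n e \<Longrightarrow> (\<And>i. i < n \<Longrightarrow> e i \<in> W) \<Longrightarrow> n \<le> n0"
  obtains n e where "orthonormal n e" "\<And>i. i < n \<Longrightarrow> e i \<in> W"
    "\<And>f x. f \<in> W \<Longrightarrow> f x = (\<Sum>i<n. ip f (e i) * e i x)"
proof -
  define P where "P n \<longleftrightarrow> (\<exists>e. orthonormal n e \<and> (\<forall>i<n. e i \<in> W))" for n
  have "P 0" by (simp add: P_def orthonormal_def)
  then have "\<exists>n. P n \<and> (\<forall>m. P m \<longrightarrow> m \<le> n)"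
    using bound by (intro Nat.ex_has_greatest_nat[of P 0 n0]) (auto simp: P_def)
  then obtain n e where e: "orthonormal n e" "\<And>i. i < n \<Longrightarrow> e i \<in> W"
    and max: "\<And>m. P m \<Longrightarrow> m \<le> n"
    by (auto simp: P_def)
  have "f x = (\<Sum>i<n. ip f (e i) * e i x)" if f: "f \<in> W" for f x
  proof (rule ccontr)
    assume ne: "f x \<noteq> (\<Sum>i<n. ip f (e i) * e i x)"
    define r where "r = (\<lambda>x. f x - (\<Sum>i<n. ip f (e i) * e i x))"
    note res = orthonormal_residual[OF e(1) W[OF f], folded r_def]
    have part: "(\<lambda>x. f x - (\<Sum>i<m. ip f (e i) * e i x)) \<in> W" if "m \<le> n" for m
      using that
    proof (induction m)
      case (Suc m)
      then show ?case
        using lin[OF Suc.IH e(2)[of m], of "ip f (e m)"] by (simp add: algebra_simps)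
    qed (use f in simp)
    then have rW: "r \<in> W" by (simp add: r_def)
    have "ip r r > 0"
      using ip_self_eq_0[OF res(1), of x] ip_self_nonneg[OF res(1)] ne by (force simp: r_def)
    define c where "c = 1 / sqrt (ip r r)"
    have c: "c * c * ip r r = 1" using \<open>ip r r > 0\<close> by (simp add: c_def)
    define s where "s = (\<lambda>x. c * r x)"
    have "(\<lambda>x. r x - (1 - c) * r x) \<in> W" by (rule lin[OF rW rW])
    then have sW: "s \<in> W" by (simp add: s_def algebra_simps)
    have ss: "ip s s = 1"
      using c res(1) by (simp add: s_def ip_cmult_left ip_cmult_right continuous_on_mult mult.assoc)
    have se: "ip s (e i) = 0" if "i < n" for i
      using res(1,2) that W[OF e(2)[OF that]] by (simp add: s_def ip_cmult_left)
    have "orthonormal (Suc n) (e(n := s))"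
      using e(1) ss se se[unfolded ip_commute[of s]] W[OF sW]
      by (auto simp: orthonormal_def less_Suc_eq)
    then have "P (Suc n)"
      using e(2) sW unfolding P_def by (intro exI[of _ "e(n := s)"]) (auto simp: less_Suc_eq)
    from max[OF this] show False by simp
  qed
  with e that show thesis by blast
qed

text \<open>For finite \<open>J\<close> the right translates of \<open>f\<close> span a
  finite-dimensional space. Coordinates over an arbitrary family \<open>b\<close>, rather than a
  basis, let sums and products of functions take the index sets \<open>I <+> J\<close> and
  \<open>I \<times> J\<close>.\<close>

definition translates_in :: "'i set \<Rightarrow> ('i \<Rightarrow> 'g \<Rightarrow> real) \<Rightarrow> ('g \<Rightarrow> real) set" where
  "translates_in J b = {f. cont f \<and> (\<forall>s. \<exists>c. \<forall>x. f (x + s) = (\<Sum>j\<in>J. c j * b j x))}"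

definition representative :: "('g \<Rightarrow> real) \<Rightarrow> bool" where
  "representative f \<longleftrightarrow> (\<exists>(J::nat set) b. finite J \<and> f \<in> translates_in J b)"

lemma translates_in_translate:
  assumes "f \<in> translates_in J b"
  shows "(\<lambda>x. f (x + s)) \<in> translates_in J b"
proof -
  have "cont (\<lambda>x. f (x + s))"
    using assms by (auto simp: translates_in_def intro!: continuous_on_compose2[of UNIV f] continuous_intros)
  moreover have "\<exists>c. \<forall>x. f (x + t + s) = (\<Sum>j\<in>J. c j * b j x)" for t
    using assms unfolding translates_in_def add.assoc by blast
  ultimately show ?thesis by (simp add: translates_in_def)
qed

lemma translates_in_lin:
  assumes "f \<in> translates_in J b" "g \<in> translates_in J b"
  shows "(\<lambda>x. f x - c * g x) \<in> translates_in J b"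
proof -
  have "\<exists>d. \<forall>x. f (x + s) - c * g (x + s) = (\<Sum>j\<in>J. d j * b j x)" for s
  proof -
    obtain d1 d2 where "\<forall>x. f (x + s) = (\<Sum>j\<in>J. d1 j * b j x)" "\<forall>x. g (x + s) = (\<Sum>j\<in>J. d2 j * b j x)"
      using assms unfolding translates_in_def by blast
    then show ?thesis
      by (intro exI[of _ "\<lambda>j. d1 j - c * d2 j"]) (simp add: algebra_simps sum_subtractf sum_distrib_left)
  qed
  with assms show ?thesis by (auto simp: translates_in_def intro!: continuous_intros)
qed

text \<open>\<open>representative\<close> fixes natural numbers as indices because a definition
  cannot quantify over a type; here the index type is free.\<close>

lemma representativeI:
  fixes J :: "'i set"
  assumes "finite J" "f \<in> translates_in J b"
  shows "representative f"
proof -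
  obtain h where h: "bij_betw h {..<card J} J"
    using ex_bij_betw_nat_finite[OF assms(1)] by (auto simp: atLeast0LessThan)
  have "(\<Sum>j\<in>J. c j * b j x) = (\<Sum>j<card J. c (h j) * b (h j) x)" for c x
    using sum.reindex_bij_betw[OF h, of "\<lambda>j. c j * b j x"] by simp
  then have "f \<in> translates_in {..<card J} (b \<circ> h)"
    using assms(2) unfolding translates_in_def by (auto 0 3)
  then show ?thesis unfolding representative_def by blast
qed

lemma representative_cont: "representative f \<Longrightarrow> cont f"
  by (auto simp: representative_def translates_in_def)

lemma representative_translate: "representative f \<Longrightarrow> representative (\<lambda>x. f (x + s))"
proof -
  assume "representative f"
  then obtain J :: "nat set" and b where "finite J" "f \<in> translates_in J b"
    by (auto simp: representative_def)
  then show ?thesis by (intro representativeI[of J _ b] translates_in_translate)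
qed

lemma representative_const: "representative (\<lambda>_. c)"
proof (rule representativeI)
  have "\<exists>d. \<forall>x. c = (\<Sum>j\<in>{0}. d j * 1)" by (intro exI[of _ "\<lambda>_. c"]) auto
  then show "(\<lambda>_. c) \<in> translates_in {0::nat} (\<lambda>_ _. 1)"
    by (simp add: translates_in_def)
qed simp

lemma representative_add:
  assumes "representative f" "representative g"
  shows "representative (\<lambda>x. f x + g x)"
proof -
  obtain I :: "nat set" and a where I: "finite I" "f \<in> translates_in I a"
    using assms(1) by (auto simp: representative_def)
  obtain J :: "nat set" and b where J: "finite J" "g \<in> translates_in J b"
    using assms(2) by (auto simp: representative_def)
  have "\<exists>d. \<forall>x. f (x + s) + g (x + s) = (\<Sum>j\<in>I <+> J. d j * case_sum a b j x)" for s
  proof -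
    obtain d1 d2 where "\<forall>x. f (x + s) = (\<Sum>j\<in>I. d1 j * a j x)" "\<forall>x. g (x + s) = (\<Sum>j\<in>J. d2 j * b j x)"
      using I J unfolding translates_in_def by blast
    then show ?thesis
      by (intro exI[of _ "case_sum d1 d2"]) (simp add: sum.Plus I J)
  qed
  then have "(\<lambda>x. f x + g x) \<in> translates_in (I <+> J) (case_sum a b)"
    using I J by (auto simp: translates_in_def intro!: continuous_intros)
  then show ?thesis by (rule representativeI[rotated]) (simp add: I J)
qed

lemma representative_mult:
  assumes "representative f" "representative g"
  shows "representative (\<lambda>x. f x * g x)"
proof -
  obtain I :: "nat set" and a where I: "finite I" "f \<in> translates_in I a"
    using assms(1) by (auto simp: representative_def)
  obtain J :: "nat set" and b where J: "finite J" "g \<in> translates_in J b"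
    using assms(2) by (auto simp: representative_def)
  have "\<exists>d. \<forall>x. f (x + s) * g (x + s) = (\<Sum>j\<in>I \<times> J. d j * (a (fst j) x * b (snd j) x))" for s
  proof -
    obtain d1 d2 where "\<forall>x. f (x + s) = (\<Sum>j\<in>I. d1 j * a j x)" "\<forall>x. g (x + s) = (\<Sum>j\<in>J. d2 j * b j x)"
      using I J unfolding translates_in_def by blast
    then show ?thesis
      by (intro exI[of _ "\<lambda>j. d1 (fst j) * d2 (snd j)"])
        (simp add: sum_product sum.cartesian_product split_def algebra_simps)
  qed
  then have "(\<lambda>x. f x * g x) \<in> translates_in (I \<times> J) (\<lambda>j x. a (fst j) x * b (snd j) x)"
    using I J by (auto simp: translates_in_def intro!: continuous_intros)
  then show ?thesis by (rule representativeI[rotated]) (simp add: I J)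
qed

text \<open>Taking the translate by \<open>0\<close>, each \<open>e i\<close> lies in the span of
  the \<open>b j\<close>, and orthonormal functions are independent. Dimensions are counted over the
  complex numbers, where independence follows from the real case for the real and imaginary parts of
  the coefficients.\<close>

lemma orthonormal_card_le:
  assumes e: "orthonormal n e" and J: "finite J" "\<And>i. i < n \<Longrightarrow> e i \<in> translates_in J b"
  shows "n \<le> card J"
proof -
  define E where "E i = (\<lambda>x. complex_of_real (e i x))" for i
  define B where "B j = (\<lambda>x. complex_of_real (b j x))" for j
  have ce: "cont (e i)" if "i < n" for i using e that by (simp add: orthonormal_def)
  have ind0: "c j = 0" if "\<And>x. (\<Sum>i<n. c i * e i x) = 0" "j < n" for c :: "nat \<Rightarrow> real" and j
  proof -
    have "0 = ip (\<lambda>x. \<Sum>i<n. c i * e i x) (e j)"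
      using that by (simp add: ip_def mean_const)
    also have "\<dots> = (\<Sum>i<n. c i * ip (e i) (e j))" by (rule ip_sum_left) (auto intro: ce that)
    also have "\<dots> = (\<Sum>i<n. if i = j then c j else 0)"
      using e that by (intro sum.cong) (auto simp: orthonormal_def)
    finally show ?thesis using that by simp
  qed
  have inj: "inj_on E {..<n}"
  proof (rule inj_onI)
    fix i j assume ij: "i \<in> {..<n}" "j \<in> {..<n}" "E i = E j"
    then have "e i = e j" by (auto simp: E_def fun_eq_iff)
    then have "ip (e i) (e j) = ip (e i) (e i)" by simp
    then show "i = j" using e ij by (auto simp: orthonormal_def split: if_splits)
  qed
  have "cfun.independent (E ` {..<n})"
  proof (rule cfun.independent_if_scalars_zero)
    fix f x assume z: "(\<Sum>x\<in>E ` {..<n}. (\<lambda>y. f x * x y)) = 0" and "x \<in> E ` {..<n}"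
    then obtain j where j: "j < n" "x = E j" by auto
    have z': "(\<Sum>i<n. (\<lambda>y. f (E i) * E i y)) = 0"
      using z by (subst (asm) sum.reindex[OF inj]) (simp add: comp_def)
    have sum0: "(\<Sum>i<n. f (E i) * E i y) = 0" for y
      using fun_cong[OF z', of y] by (simp add: sum_fun_apply)
    have "Re (f (E j)) = 0"
    proof (rule ind0[OF _ j(1), of "\<lambda>i. Re (f (E i))"])
      fix y show "(\<Sum>i<n. Re (f (E i)) * e i y) = 0"
        using arg_cong[OF sum0[of y], of Re] by (simp add: E_def)
    qed
    moreover have "Im (f (E j)) = 0"
    proof (rule ind0[OF _ j(1), of "\<lambda>i. Im (f (E i))"])
      fix y show "(\<Sum>i<n. Im (f (E i)) * e i y) = 0"
        using arg_cong[OF sum0[of y], of Im] by (simp add: E_def)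
    qed
    ultimately show "f x = 0" using j by (simp add: complex_eq_iff)
  qed simp
  moreover have "E ` {..<n} \<subseteq> cfun.span (B ` J)"
  proof clarsimp
    fix i assume "i < n"
    from J(2)[OF this] have "\<exists>c. \<forall>x. e i (x + 0) = (\<Sum>j\<in>J. c j * b j x)"
      unfolding translates_in_def by blast
    then obtain c where c: "\<And>x. e i x = (\<Sum>j\<in>J. c j * b j x)" by auto
    have "E i = (\<Sum>j\<in>J. (\<lambda>x. complex_of_real (c j) * B j x))"
      by (simp add: E_def B_def c fun_eq_iff sum_fun_apply)
    then show "E i \<in> cfun.span (B ` J)"
      by (simp only:) (rule cfun.span_sum, rule cfun.span_scale, rule cfun.span_base, rule imageI)
  qed
  ultimately have "card (E ` {..<n}) \<le> card (B ` J)"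
    using cfun.independent_span_bound[of "B ` J" "E ` {..<n}"] J(1) by auto
  also have "\<dots> \<le> card J" by (rule card_image_le[OF J(1)])
  finally show ?thesis by (simp add: card_image[OF inj])
qed

text \<open>\<open>\<rho> i j s\<close> is the entry \<open>(i, j)\<close> at \<open>s\<close> of a unitary representation with real entries.\<close>

definition orthogonal_rep :: "nat \<Rightarrow> (nat \<Rightarrow> nat \<Rightarrow> 'g \<Rightarrow> real) \<Rightarrow> bool" where
  "orthogonal_rep n \<rho> \<longleftrightarrow>
     (\<forall>i<n. \<forall>j<n. cont (\<rho> i j) \<and> (\<forall>s. \<rho> i j (- s) = \<rho> j i s) \<and> \<rho> i j 0 = (if i = j then 1 else 0) \<and>
       (\<forall>s t. \<rho> i j (s + t) = (\<Sum>k<n. \<rho> i k s * \<rho> k j t)))"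

lemma orthogonal_rep_entry_shift:
  assumes "orthogonal_rep n \<rho>" "i < n" "j < n"
  shows "\<rho> i j t = (\<Sum>k<n. \<rho> k i s * \<rho> k j (s + t))"
proof -
  have "\<rho> i j t = \<rho> i j (- s + (s + t))" by (simp add: add.assoc[symmetric])
  also have "\<dots> = (\<Sum>k<n. \<rho> i k (- s) * \<rho> k j (s + t))"
    using assms unfolding orthogonal_rep_def by blast
  also have "\<dots> = (\<Sum>k<n. \<rho> k i s * \<rho> k j (s + t))"
    using assms by (intro sum.cong) (auto simp: orthogonal_rep_def)
  finally show ?thesis .
qed

lemma orthogonal_rep_trig_polys:
  assumes \<rho>: "orthogonal_rep n \<rho>" and ij: "i < n" "j < n"
  shows "(\<lambda>s. complex_of_real (\<rho> i j s)) \<in> trig_polys"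
proof -
  define \<pi> where "\<pi> s = mat n n (\<lambda>(i, j). complex_of_real (\<rho> i j s))" for s
  have car: "\<pi> s \<in> carrier_mat n n" for s by (simp add: \<pi>_def)
  have hom: "\<pi> (s + t) = \<pi> s * \<pi> t" for s t
    using \<rho> by (intro eq_matI) (auto simp: \<pi>_def scalar_prod_def orthogonal_rep_def atLeast0LessThan)
  have adj: "mat_adjoint (\<pi> s) = \<pi> (- s)" for s
    using \<rho> by (intro eq_matI)
      (auto simp: mat_adjoint_def \<pi>_def mat_of_rows_def orthogonal_rep_def)
  have "\<pi> 0 = 1\<^sub>m n"
    using \<rho> by (intro eq_matI) (auto simp: \<pi>_def orthogonal_rep_def)
  then have "unitary_rep n \<pi>"
    using \<rho> hom[of _ "- _"] unfolding unitary_rep_def adj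
    by (auto simp: car hom[symmetric]) (auto simp: \<pi>_def orthogonal_rep_def intro!: continuous_intros)
  moreover have "(\<lambda>s. complex_of_real (\<rho> i j s)) = (\<lambda>s. (\<pi> s *\<^sub>v unit_vec n j) \<bullet>c unit_vec n i)"
  proof
    fix s
    have cu: "conjugate (unit_vec n i) = (unit_vec n i :: complex vec)"
      by (intro eq_vecI) (auto simp: unit_vec_def)
    show "complex_of_real (\<rho> i j s) = (\<pi> s *\<^sub>v unit_vec n j) \<bullet>c unit_vec n i"
      unfolding cu using ij car[of s] by (simp add: \<pi>_def scalar_prod_right_unit)
  qed
  ultimately show ?thesis
    unfolding trig_polys_def
    by (intro cfun.span_base CollectI exI[of _ n] exI[of _ \<pi>] exI[of _ "unit_vec n j"]
        exI[of _ "unit_vec n i"] conjI unit_vec_carrier)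
qed

text \<open>The space \<open>?W\<close> is right invariant and finite-dimensional, and
  \<open>\<rho>\<close> is the matrix of right translation on it in an orthonormal basis; it is
  orthogonal because the mean is right invariant. Since \<open>f x\<close> is the translate of
  \<open>f\<close> by \<open>x\<close> evaluated at the identity, \<open>f\<close> is a combination
  of entries of \<open>\<rho>\<close>.\<close>

lemma representative_expansion:
  assumes "representative f"
  obtains n \<rho> c where "orthogonal_rep n \<rho>" "\<And>x. f x = (\<Sum>i<n. \<Sum>j<n. c i j * \<rho> i j x)"
proof -
  obtain J :: "nat set" and b where J: "finite J" and f: "f \<in> translates_in J b"
    using assms by (auto simp: representative_def)
  let ?W = "translates_in J b"
  have W: "cont g" if "g \<in> ?W" for g using that by (simp add: translates_in_def)
  obtain n e where e: "orthonormal n e" "\<And>i. i < n \<Longrightarrow> e i \<in> ?W"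
    and exp: "\<And>g x. g \<in> ?W \<Longrightarrow> g x = (\<Sum>i<n. ip g (e i) * e i x)"
    by (rule ex_orthonormal_basis[of ?W "card J"])
      (use W translates_in_lin orthonormal_card_le[OF _ J] in blast)+
  have ce: "cont (e i)" if "i < n" for i using e that by (simp add: orthonormal_def)
  have tc: "cont (\<lambda>x. g (x + s))" if "cont g" for g s
    using continuous_on_translate_right[OF that] by simp
  define \<rho> where "\<rho> i j s = ip (\<lambda>x. e j (x + s)) (e i)" for i j s
  have trans: "e j (x + s) = (\<Sum>i<n. \<rho> i j s * e i x)" if "j < n" for j x s
    using exp[OF translates_in_translate[OF e(2)[OF that]], of x s] by (simp add: \<rho>_def)
  have "orthogonal_rep n \<rho>"
    unfolding orthogonal_rep_def
  proof (intro allI impI conjI)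
    fix i j assume ij: "i < n" "j < n"
    have "continuous_on (UNIV \<times> UNIV) (\<lambda>p. e j (snd p + fst p) * e i (snd p))"
      by (intro continuous_on_mult continuous_on_compose2[OF ce[OF ij(2)]]
          continuous_on_compose2[OF ce[OF ij(1)]]) (auto intro!: continuous_intros)
    from continuous_on_mean[OF this] show "cont (\<rho> i j)" by (simp add: \<rho>_def[abs_def] ip_def)
    show "\<rho> i j (- s) = \<rho> j i s" for s
    proof -
      have "mean (\<lambda>x. e j (x + - s) * e i x) = mean (\<lambda>x. e j (x + s + - s) * e i (x + s))"
        using mean_translate_right[of "\<lambda>x. e j (x + - s) * e i x" s] ce[OF ij(1)] tc[OF ce[OF ij(2)], of "- s"]
        by (simp add: continuous_on_mult)
      then show ?thesis by (simp add: \<rho>_def ip_def add.assoc mult.commute)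
    qed
    show "\<rho> i j 0 = (if i = j then 1 else 0)"
      using e(1) ij by (auto simp: \<rho>_def orthonormal_def)
    show "\<rho> i j (s + t) = (\<Sum>k<n. \<rho> i k s * \<rho> k j t)" for s t
    proof -
      have "\<rho> i j (s + t) = ip (\<lambda>x. e j (x + s + t)) (e i)" by (simp add: \<rho>_def add.assoc)
      also have "\<dots> = ip (\<lambda>x. \<Sum>k<n. \<rho> k j t * e k (x + s)) (e i)" by (simp add: trans ij)
      also have "\<dots> = (\<Sum>k<n. \<rho> k j t * \<rho> i k s)"
        unfolding \<rho>_def[of i _ s] by (rule ip_sum_left) (auto intro: ce tc ij)
      finally show ?thesis by (simp add: mult.commute)
    qed
  qed
  moreover have "f x = (\<Sum>i<n. \<Sum>j<n. (ip f (e j) * e i 0) * \<rho> i j x)" for x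
  proof -
    have "f x = (\<Sum>j<n. ip f (e j) * e j x)" by (rule exp[OF f])
    also have "\<dots> = (\<Sum>j<n. ip f (e j) * (\<Sum>i<n. \<rho> i j x * e i 0))"
      using trans[of _ 0 x] by (intro sum.cong) auto
    also have "\<dots> = (\<Sum>j<n. \<Sum>i<n. ip f (e j) * e i 0 * \<rho> i j x)"
      by (simp add: sum_distrib_left algebra_simps)
    finally show ?thesis by (subst sum.swap)
  qed
  ultimately show thesis by (rule that)
qed

end

section \<open>Density of representative functions\<close>

context compact_subgroup
begin

text \<open>Urysohn's lemma on \<open>K\<close>. It serves for partitions of unity on
  \<open>K\<close> and, with the whole group as \<open>K\<close>, for functions peaked at the
  identity.\<close>

lemma continuous_bump:
  assumes "closed F" "x \<in> K - F"
  obtains u :: "'g \<Rightarrow> real" where "continuous_on K u" "u x = 1"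
    "\<And>y. y \<in> K \<Longrightarrow> y \<in> F \<Longrightarrow> u y = 0" "\<And>y. y \<in> K \<Longrightarrow> 0 \<le> u y"
proof -
  have "normal_space (top_of_set K)"
  proof (rule compact_Hausdorff_or_regular_imp_normal_space)
    show "compact_space (top_of_set K)" using compact by (simp add: compact_space_subtopology)
    have "Hausdorff_space (euclidean :: 'g topology)"
      unfolding Hausdorff_space_def disjnt_def by (metis hausdorff open_openin)
    then show "Hausdorff_space (top_of_set K) \<or> regular_space (top_of_set K)"
      by (simp add: Hausdorff_space_subtopology)
  qed
  moreover have "closedin (top_of_set K) (K \<inter> F)" "closedin (top_of_set K) {x}" "disjnt (K \<inter> F) {x}"
    using assms by (auto simp: disjnt_def closedin_closed_Int closedin_closed)
  moreover have "(0::real) \<le> 1" by simp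
  ultimately obtain u :: "'g \<Rightarrow> real" where u: "continuous_map (top_of_set K) (top_of_set {0..1}) u"
    "u ` (K \<inter> F) \<subseteq> {0}" "u ` {x} \<subseteq> {1}"
    by (rule Urysohn_lemma) (rule that)
  then show thesis
    by (intro that[of u]) (auto simp: continuous_map_in_subtopology)
qed

end

section \<open>Eigenvectors of convolution operators and the density theorem\<close>

context compact_group
begin

text \<open>A form of the Arzela-Ascoli theorem. The product of intervals is compact but need not be
  sequentially compact, so \<open>h\<close> is a cluster point and not the limit of a subsequence;
  equicontinuity then turns closeness on finite sets into uniform closeness.\<close>

lemma uniform_cluster_point:
  fixes a :: "nat \<Rightarrow> 'g \<Rightarrow> real"
  assumes bd: "\<And>n x. \<bar>a n x\<bar> \<le> C"
    and equi: "\<And>x e. e > 0 \<Longrightarrow> \<exists>U. open U \<and> x \<in> U \<and> (\<forall>y\<in>U. \<forall>n. \<bar>a n y - a n x\<bar> \<le> e)"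
  obtains h where "cont h" "\<And>e N. e > 0 \<Longrightarrow> \<exists>n\<ge>N. \<forall>x. \<bar>a n x - h x\<bar> \<le> e"
proof -
  define Q :: "('g \<Rightarrow> real) set" where "Q = PiE UNIV (\<lambda>_. {- C..C})"
  have "compactin (product_topology (\<lambda>_. euclidean) UNIV) Q"
    unfolding Q_def by (subst compactin_PiE) auto
  then have "compact Q" by (simp add: euclidean_product_topology)
  moreover have "eventually (\<lambda>g. g \<in> Q) (filtermap a sequentially)"
    using bd by (auto simp: eventually_filtermap Q_def abs_le_iff minus_le_iff intro!: always_eventually)
  moreover have "filtermap a sequentially \<noteq> bot" by (simp add: filtermap_bot_iff)
  ultimately obtain h where h: "inf (nhds h) (filtermap a sequentially) \<noteq> bot"
    unfolding compact_filter by blast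
  \<comment> \<open>Closeness on a finite set is a neighbourhood of \<open>h\<close> in the product
    topology, so it occurs for arbitrarily late \<open>n\<close>.\<close>
  have near: "\<exists>n\<ge>N. \<forall>x\<in>D. \<bar>a n x - h x\<bar> < e" if D: "finite D" "e > 0" for D e N
  proof (rule ccontr)
    assume neg: "\<not> ?thesis"
    define B where "B = (\<Inter>x\<in>D. {g :: 'g \<Rightarrow> real. \<bar>g x - h x\<bar> < e})"
    have "open B" unfolding B_def
      by (intro open_INT D ballI open_Collect_less continuous_intros continuous_on_product_coordinates)
    moreover have "h \<in> B" using D by (simp add: B_def)
    ultimately have "eventually (\<lambda>g. g \<in> B) (nhds h)" by (rule eventually_nhds_in_open)
    moreover have "eventually (\<lambda>g. g \<notin> B) (filtermap a sequentially)"
      using neg unfolding eventually_filtermap B_def eventually_sequentially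
      by (intro exI[of _ N]) auto
    ultimately have "eventually (\<lambda>_. False) (inf (nhds h) (filtermap a sequentially))"
      unfolding eventually_inf by blast
    with h show False by (simp add: eventually_False)
  qed
  have equi_h: "\<bar>h y - h x\<bar> \<le> e" if U: "\<forall>y\<in>U. \<forall>n. \<bar>a n y - a n x\<bar> \<le> e" "y \<in> U" for x y e U
  proof (rule field_le_epsilon)
    fix d :: real assume "d > 0"
    then obtain n where "\<bar>a n x - h x\<bar> < d / 2" "\<bar>a n y - h y\<bar> < d / 2"
      using near[of "{x, y}" "d / 2" 0] by auto
    moreover have "\<bar>a n y - a n x\<bar> \<le> e" using U by blast
    ultimately show "\<bar>h y - h x\<bar> \<le> e + d" by linarith
  qed
  have "cont h"
    unfolding continuous_on_eq_continuous_at[OF open_UNIV] continuous_at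
  proof (intro ballI tendstoI)
    fix x and e :: real assume "e > 0"
    then obtain U where "open U" "x \<in> U" "\<forall>y\<in>U. \<forall>n. \<bar>a n y - a n x\<bar> \<le> e / 2"
      using equi[of "e / 2" x] by auto
    with equi_h[of U x "e / 2"] \<open>e > 0\<close> show "\<forall>\<^sub>F y in at x. dist (h y) (h x) < e"
      unfolding eventually_at_topological by (intro exI[of _ U]) (force simp: dist_real_def)
  qed
  moreover have "\<exists>n\<ge>N. \<forall>x. \<bar>a n x - h x\<bar> \<le> e" if "e > 0" for e N
  proof -
    have e3: "e / 3 > 0" using \<open>e > 0\<close> by simp
    obtain U where U: "\<And>x. open (U x) \<and> x \<in> U x \<and> (\<forall>y\<in>U x. \<forall>n. \<bar>a n y - a n x\<bar> \<le> e / 3)"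
      using equi[OF e3] by metis
    have "UNIV \<subseteq> (\<Union>x\<in>UNIV. U x)" using U by blast
    then obtain D where D: "finite D" "UNIV \<subseteq> (\<Union>x\<in>D. U x)"
      using compactE_image[OF compact, of UNIV U] U by metis
    obtain n where n: "n \<ge> N" "\<forall>x\<in>D. \<bar>a n x - h x\<bar> < e / 3"
      using near[OF D(1) e3] by blast
    have "\<bar>a n x - h x\<bar> \<le> e" for x
    proof -
      obtain d where d: "d \<in> D" "x \<in> U d" using D(2) by blast
      have "\<bar>a n x - a n d\<bar> \<le> e / 3" using U d by blast
      moreover have "\<bar>h x - h d\<bar> \<le> e / 3" using equi_h[of "U d" d "e / 3" x] U d by blast
      moreover have "\<bar>a n d - h d\<bar> < e / 3" using n(2) d(1) by blast
      ultimately show ?thesis by linarith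
    qed
    with n show ?thesis by blast
  qed
  ultimately show thesis by (rule that)
qed

text \<open>In multiplicative notation the kernel is \<open>v(xy\<^sup>-\<^sup>1)\<close>. It is
  unchanged when \<open>x\<close> and \<open>y\<close> are multiplied on the right by the same
  element, so convolution operators, and hence their composites, commute with right
  translations.\<close>

definition conv :: "('g \<Rightarrow> real) \<Rightarrow> ('g \<Rightarrow> real) \<Rightarrow> 'g \<Rightarrow> real" where
  "conv v f x = mean (\<lambda>y. v (x - y) * f y)"

lemma cont_shift: "cont v \<Longrightarrow> cont (\<lambda>y. v (x - y))"
  by (rule continuous_on_compose2[of UNIV v]) (auto intro!: continuous_intros)

lemma conv_eq_ip: "conv v f x = ip (\<lambda>y. v (x - y)) f"
  by (simp add: conv_def ip_def)

lemma cont_reflect: "cont v \<Longrightarrow> cont (\<lambda>z. v (- z))"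
  by (rule continuous_on_compose2[of UNIV v]) (auto intro!: continuous_intros)

lemma cont_conv:
  assumes "cont v" "cont f"
  shows "cont (conv v f)"
proof -
  have "continuous_on (UNIV \<times> UNIV) (\<lambda>p. v (fst p - snd p) * f (snd p))"
    by (intro continuous_on_mult continuous_on_compose2[OF assms(1)] continuous_on_compose2[OF assms(2)])
      (auto intro!: continuous_intros)
  from continuous_on_mean[OF this] show ?thesis by (simp add: conv_def[abs_def])
qed

lemma conv_lin:
  assumes "cont v" "cont f" "cont g"
  shows "conv v (\<lambda>y. f y - c * g y) x = conv v f x - c * conv v g x"
  using assms by (simp add: conv_eq_ip ip_diff_right ip_cmult_right cont_shift continuous_on_mult)

lemma conv_translate:
  assumes "cont v" "cont f"
  shows "conv v (\<lambda>y. f (y + s)) x = conv v f (x + s)"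
proof -
  have "cont (\<lambda>y. v (x + s - y) * f y)"
    by (intro continuous_intros assms cont_shift)
  from mean_translate_right[OF this, of s]
  have "mean (\<lambda>y. v (x + s - y) * f y) = mean (\<lambda>y. v (x + s - (y + s)) * f (y + s))" by simp
  moreover have "x + s - (y + s) = x - y" for y :: 'g
    by (simp add: diff_conv_add_uminus minus_add add.assoc del: add_uminus_conv_diff)
  ultimately show ?thesis by (simp add: conv_def)
qed

text \<open>The adjoint has the transposed kernel, \<open>v (y - x)\<close> at
  \<open>(x, y)\<close>, by interchange of the two means.\<close>

lemma conv_adjoint:
  assumes v: "cont v" and f: "cont f" and g: "cont g"
  shows "ip (conv v f) g = ip f (conv (\<lambda>z. v (- z)) g)"
proof -
  have "ip (conv v f) g = mean (\<lambda>x. mean (\<lambda>y. v (x - y) * f y * g x))"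
  proof -
    have "conv v f x * g x = mean (\<lambda>y. v (x - y) * f y * g x)" for x
      using mean_cmult[of "\<lambda>y. v (x - y) * f y" "g x"] cont_shift[OF v] f
      by (simp add: conv_def continuous_on_mult mult.commute)
    then show ?thesis by (simp add: ip_def)
  qed
  also have "\<dots> = mean (\<lambda>y. mean (\<lambda>x. v (x - y) * f y * g x))"
  proof -
    have "continuous_on (UNIV \<times> UNIV) (\<lambda>p. v (fst p - snd p) * f (snd p) * g (fst p))"
      by (intro continuous_on_mult continuous_on_compose2[OF v] continuous_on_compose2[OF f]
          continuous_on_compose2[OF g]) (auto intro!: continuous_intros)
    from mean_swap[OF this] show ?thesis by simp
  qed
  also have "\<dots> = ip f (conv (\<lambda>z. v (- z)) g)"
  proof -
    have "mean (\<lambda>x. v (x - y) * f y * g x) = f y * conv (\<lambda>z. v (- z)) g y" for y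
      using mean_cmult[of "\<lambda>x. v (x - y) * g x" "f y"] g
        continuous_on_compose2[OF v, of UNIV "\<lambda>x. x - y"]
      by (simp add: conv_def continuous_on_mult continuous_on_diff mult_ac)
    then show ?thesis by (simp add: ip_def)
  qed
  finally show ?thesis .
qed

lemma ip_self_le:
  assumes "cont f" "\<And>x. \<bar>f x\<bar> \<le> e"
  shows "ip f f \<le> e\<^sup>2"
proof -
  have "f x * f x \<le> e\<^sup>2" for x
    using power_mono[OF assms(2)[of x], of 2] by (simp add: power2_eq_square)
  then have "mean (\<lambda>x. f x * f x) \<le> mean (\<lambda>_. e\<^sup>2)"
    by (intro mean_mono continuous_intros assms)
  then show ?thesis by (simp add: ip_def mean_const)
qed

text \<open>The supremum of \<open>conv v f\<close> is controlled by the inner product norm of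
  \<open>f\<close>. Together with \<open>conv_equicontinuous\<close> this stands in for compactness
  of the operator on a completed space: it supplies the hypotheses of
  \<open>uniform_cluster_point\<close>.\<close>

lemma conv_bound:
  assumes v: "cont v" "\<And>x. \<bar>v x\<bar> \<le> C" and f: "cont f"
  shows "(conv v f x)\<^sup>2 \<le> C\<^sup>2 * ip f f"
proof -
  have "(conv v f x)\<^sup>2 \<le> ip (\<lambda>y. v (x - y)) (\<lambda>y. v (x - y)) * ip f f"
    unfolding conv_eq_ip by (rule cauchy_schwarz[OF cont_shift[OF v(1)] f])
  also have "\<dots> \<le> C\<^sup>2 * ip f f"
    by (intro mult_right_mono ip_self_le cont_shift v ip_self_nonneg f)
  finally show ?thesis .
qed

lemma conv_equicontinuous:
  assumes v: "cont v" and "e > 0"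
  obtains U where "open U" "x \<in> U" "\<And>y f. y \<in> U \<Longrightarrow> cont f \<Longrightarrow> (conv v f y - conv v f x)\<^sup>2 \<le> e\<^sup>2 * ip f f"
proof -
  have cv: "continuous_on (UNIV \<times> UNIV) (\<lambda>p. v (fst p - snd p))"
    by (intro continuous_on_compose2[OF v]) (auto intro!: continuous_intros)
  obtain U where U: "x \<in> U" "open U"
    "\<forall>y\<in>U \<inter> UNIV. \<forall>t\<in>UNIV. dist (v (fst (y, t) - snd (y, t))) (v (fst (x, t) - snd (x, t))) \<le> e"
    by (rule continuous_on_prod_compactE[OF cv compact UNIV_I[of x] \<open>e > 0\<close>]) (rule that)
  have "(conv v f y - conv v f x)\<^sup>2 \<le> e\<^sup>2 * ip f f" if y: "y \<in> U" and f: "cont f" for y f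
  proof -
    define w where "w = (\<lambda>t. v (y - t) - v (x - t))"
    have w: "cont w" unfolding w_def by (intro continuous_intros cont_shift v)
    have "conv v f y - conv v f x = ip w f"
      by (simp add: conv_eq_ip w_def ip_diff_left cont_shift v f)
    moreover have "(ip w f)\<^sup>2 \<le> ip w w * ip f f" by (rule cauchy_schwarz[OF w f])
    moreover have "ip w w * ip f f \<le> e\<^sup>2 * ip f f"
      using U(3) y by (intro mult_right_mono ip_self_le w ip_self_nonneg f) (auto simp: w_def dist_real_def)
    ultimately show ?thesis by simp
  qed
  with U show thesis by (intro that[of U]) auto
qed

lemma cont_bounded:
  assumes "cont f"
  obtains C where "C > 0" "\<And>x. \<bar>f x\<bar> \<le> C"
proof -
  have "bounded (range f)"
    using compact_continuous_image[OF assms compact] compact_imp_bounded by blast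
  then obtain C where C: "\<And>x. \<bar>f x\<bar> \<le> C" by (auto simp: bounded_iff)
  have "\<bar>f x\<bar> \<le> \<bar>C\<bar> + 1" for x using C[of x] by linarith
  then show thesis by (intro that[of "\<bar>C\<bar> + 1"]) auto
qed

lemma ip_sum3:
  assumes "cont f" "cont g" "cont h" "cont k" "\<And>x. k x = f x + g x + h x"
  shows "ip k k \<le> 3 * (ip f f + ip g g + ip h h)"
proof -
  have "(a + b + c) * (a + b + c) \<le> 3 * (a * a + b * b + c * c)" for a b c :: real
    using sum_squares_bound[of a b] sum_squares_bound[of a c] sum_squares_bound[of b c]
    by (simp add: algebra_simps power2_eq_square)
  then have "mean (\<lambda>x. k x * k x) \<le> mean (\<lambda>x. 3 * (f x * f x + g x * g x + h x * h x))"
    using assms by (intro mean_mono continuous_intros) auto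
  also have "\<dots> = 3 * (ip f f + ip g g + ip h h)"
    using assms by (simp add: mean_cmult mean_add ip_def continuous_on_mult continuous_on_add)
  finally show ?thesis by (simp add: ip_def)
qed

text \<open>A maximising sequence of \<open>ip (T g) (T g)\<close> on the unit ball, \<open>T = conv v\<close>, becomes after
  application of \<open>T\<^sup>*T\<close> a uniformly bounded equicontinuous sequence of approximate eigenvectors.\<close>

lemma conv_eigenvector:
  assumes v: "cont v" and f0: "cont f0" "conv v f0 x0 \<noteq> 0"
  obtains L h where "L > 0" "cont h" "h \<noteq> (\<lambda>_. 0)" "\<And>x. conv (\<lambda>z. v (- z)) (conv v h) x = L * h x"
proof -
  define v' where "v' = (\<lambda>z. v (- z))"
  have v': "cont v'" unfolding v'_def by (rule cont_reflect[OF v])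
  define T where "T = conv v"
  define S where "S f = conv v' (T f)" for f
  have cT: "cont (T f)" if "cont f" for f using cont_conv[OF v that] by (simp add: T_def)
  have cS: "cont (S f)" if "cont f" for f unfolding S_def by (intro cont_conv v' cT that)
  have Slin: "S (\<lambda>y. f y - c * g y) x = S f x - c * S g x" if "cont f" "cont g" for f g c x
  proof -
    have "T (\<lambda>y. f y - c * g y) = (\<lambda>x. T f x - c * T g x)"
      using conv_lin[OF v that] by (auto simp: T_def)
    then show ?thesis using conv_lin[OF v' cT cT] that by (simp add: S_def)
  qed
  have adj: "ip (S f) g = ip (T f) (T g)" if "cont f" "cont g" for f g
    using conv_adjoint[OF v that(2) cT[OF that(1)]] by (simp add: S_def T_def v'_def ip_commute)
  obtain C where C: "C > 0" "\<And>x. \<bar>v x\<bar> \<le> C" using cont_bounded[OF v] by metis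
  have Tb: "ip (T f) (T f) \<le> C\<^sup>2 * ip f f" if "cont f" for f
  proof -
    have "T f x * T f x \<le> C\<^sup>2 * ip f f" for x
      using conv_bound[OF v C(2) that] by (simp add: T_def power2_eq_square)
    then have "mean (\<lambda>x. T f x * T f x) \<le> mean (\<lambda>_. C\<^sup>2 * ip f f)"
      by (intro mean_mono continuous_intros cT that)
    then show ?thesis by (simp add: ip_def mean_const)
  qed
  define Q where "Q = {ip (T f) (T f) | f. cont f \<and> ip f f \<le> 1}"
  \<comment> \<open>The square of the operator norm of \<open>T\<close>, and the future eigenvalue
    of \<open>S = T\<^sup>*T\<close>.\<close>
  define L where "L = Sup Q"
  have bdd: "bdd_above Q"
  proof (rule bdd_aboveI[of _ "C\<^sup>2"])
    fix q assume "q \<in> Q"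
    then obtain f where f: "cont f" "ip f f \<le> 1" "q = ip (T f) (T f)" by (auto simp: Q_def)
    have "C\<^sup>2 * ip f f \<le> C\<^sup>2" using f by (simp add: mult_left_le)
    with Tb[OF f(1)] f show "q \<le> C\<^sup>2" by simp
  qed
  have TL: "ip (T f) (T f) \<le> L * ip f f" if f: "cont f" for f
  proof (cases "ip f f = 0")
    case True
    with Tb[OF f] show ?thesis by simp
  next
    case False
    then have pos: "ip f f > 0" using ip_self_nonneg[OF f] by simp
    define c where "c = 1 / sqrt (ip f f)"
    have c: "c * c * ip f f = 1" using pos by (simp add: c_def)
    define g where "g = (\<lambda>x. c * f x)"
    have g: "cont g" unfolding g_def by (intro continuous_intros f)
    have "ip g g = 1"
      using c f by (simp add: g_def ip_cmult_left ip_cmult_right continuous_on_mult mult.assoc)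
    then have "ip (T g) (T g) \<le> L"
      unfolding L_def using g by (intro cSup_upper bdd) (auto simp: Q_def)
    moreover have "T g = (\<lambda>x. c * T f x)"
      using f by (auto simp: T_def g_def conv_eq_ip ip_cmult_right cont_shift v)
    then have "ip (T g) (T g) = c * c * ip (T f) (T f)"
      using cT[OF f] by (simp add: ip_cmult_left ip_cmult_right continuous_on_mult mult.assoc)
    ultimately have "c * c * ip (T f) (T f) * ip f f \<le> L * ip f f"
      using pos by (intro mult_right_mono) auto
    moreover have "c * c * ip (T f) (T f) * ip f f = ip (T f) (T f)"
      using c by (metis mult.assoc mult.commute mult_1)
    ultimately show ?thesis by simp
  qed
  have Lpos: "L > 0"
  proof (rule ccontr)
    assume "\<not> L > 0"
    then have "L * ip f0 f0 \<le> 0" using ip_self_nonneg[OF f0(1)] by (simp add: mult_nonpos_nonneg)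
    then have "ip (T f0) (T f0) = 0"
      using TL[OF f0(1)] ip_self_nonneg[OF cT[OF f0(1)]] by simp
    with ip_self_eq_0[OF cT[OF f0(1)]] f0(2) show False by (simp add: T_def)
  qed
  \<comment> \<open>Cauchy-Schwarz for \<open>ip (T f) (T (S f))\<close>, followed by
    \<open>TL\<close> for \<open>S f\<close>; one factor \<open>ip (S f) (S f)\<close> then
    cancels.\<close>
  have SL: "ip (S f) (S f) \<le> L * ip (T f) (T f)" if f: "cont f" for f
  proof -
    have q: "ip (S f) (S f) = ip (T f) (T (S f))" by (rule adj[OF f cS[OF f]])
    have "(ip (S f) (S f))\<^sup>2 \<le> ip (T f) (T f) * ip (T (S f)) (T (S f))"
      unfolding q by (rule cauchy_schwarz[OF cT[OF f] cT[OF cS[OF f]]])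
    also have "\<dots> \<le> ip (T f) (T f) * (L * ip (S f) (S f))"
      by (intro mult_left_mono TL cS f ip_self_nonneg cT)
    finally have *: "ip (S f) (S f) * ip (S f) (S f) \<le> (L * ip (T f) (T f)) * ip (S f) (S f)"
      by (simp add: power2_eq_square algebra_simps)
    show ?thesis
    proof (cases "ip (S f) (S f) = 0")
      case True
      then show ?thesis using Lpos ip_self_nonneg[OF cT[OF f]] by simp
    next
      case False
      then have "ip (S f) (S f) > 0" using ip_self_nonneg[OF cS[OF f]] by simp
      with * show ?thesis by simp
    qed
  qed
  have SLL: "ip (S f) (S f) \<le> L\<^sup>2 * ip f f" if f: "cont f" for f
    by (rule order_trans[OF SL[OF f]]) (use TL[OF f] Lpos in \<open>simp add: power2_eq_square mult.assoc\<close>)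
  \<comment> \<open>Expanding the square and using \<open>SL\<close> gives the upper bound
    \<open>L * ip (T g) (T g) - 2 * L * ip (T g) (T g) + L\<^sup>2\<close>; so near-maximisers are
    near-eigenvectors.\<close>
  have app: "ip (\<lambda>x. S g x - L * g x) (\<lambda>x. S g x - L * g x) \<le> L * (L - ip (T g) (T g))"
    if g: "cont g" "ip g g \<le> 1" for g
  proof -
    have "L\<^sup>2 * ip g g \<le> L\<^sup>2" using g(2) Lpos by (simp add: mult_left_le)
    then show ?thesis
      unfolding ip_diff_self[OF cS[OF g(1)] g(1)]
      using SL[OF g(1)] by (simp add: adj[OF g(1) g(1)] algebra_simps power2_eq_square)
  qed
  have "\<exists>g. cont g \<and> ip g g \<le> 1 \<and> L - 1 / real (Suc n) < ip (T g) (T g)" for n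
  proof -
    have "ip (\<lambda>_. 0) (\<lambda>_. 0) \<le> 1" by (simp add: ip_def mean_const)
    then have "ip (T (\<lambda>_. 0)) (T (\<lambda>_. 0)) \<in> Q"
      unfolding Q_def by (intro CollectI exI[of _ "\<lambda>_. 0"]) auto
    then have "Q \<noteq> {}" by blast
    moreover have "L - 1 / real (Suc n) < Sup Q" by (simp add: L_def)
    ultimately obtain q where "q \<in> Q" "L - 1 / real (Suc n) < q"
      using less_cSupD by metis
    then show ?thesis unfolding Q_def by blast
  qed
  then obtain g where g: "\<And>n. cont (g n)" "\<And>n. ip (g n) (g n) \<le> 1"
    and gL: "\<And>n. L - 1 / real (Suc n) < ip (T (g n)) (T (g n))" by metis
  have Tg: "ip (T (g n)) (T (g n)) \<le> L" for n
    by (rule order_trans[OF TL[OF g(1)]]) (use g(2) Lpos in \<open>simp add: mult_left_le\<close>)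
  have cTg: "cont (T (g n))" for n by (intro cT g)
  obtain h where h: "cont h" "\<And>e N. e > 0 \<Longrightarrow> \<exists>n\<ge>N. \<forall>x. \<bar>S (g n) x - h x\<bar> \<le> e"
  proof (rule uniform_cluster_point[of "\<lambda>n. S (g n)" "C * sqrt L"])
    fix n x
    have "(S (g n) x)\<^sup>2 \<le> C\<^sup>2 * ip (T (g n)) (T (g n))"
      unfolding S_def by (rule conv_bound[OF v' _ cTg]) (simp add: v'_def C)
    also have "\<dots> \<le> C\<^sup>2 * L" by (intro mult_left_mono Tg) auto
    also have "\<dots> = (C * sqrt L)\<^sup>2" using Lpos by (simp add: power_mult_distrib)
    finally have "(S (g n) x)\<^sup>2 \<le> (C * sqrt L)\<^sup>2" .
    moreover have "0 \<le> C * sqrt L" using C(1) Lpos by simp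
    ultimately show "\<bar>S (g n) x\<bar> \<le> C * sqrt L" using power2_le_iff_abs_le by blast
  next
    fix x and e :: real assume "e > 0"
    define d where "d = e / sqrt L"
    have "d > 0" using \<open>e > 0\<close> Lpos by (simp add: d_def)
    obtain U where U: "open U" "x \<in> U"
      "\<And>y f. y \<in> U \<Longrightarrow> cont f \<Longrightarrow> (conv v' f y - conv v' f x)\<^sup>2 \<le> d\<^sup>2 * ip f f"
      using conv_equicontinuous[OF v' \<open>d > 0\<close>, of x] by metis
    have "\<bar>S (g n) y - S (g n) x\<bar> \<le> e" if "y \<in> U" for y n
    proof -
      have "(S (g n) y - S (g n) x)\<^sup>2 \<le> d\<^sup>2 * ip (T (g n)) (T (g n))"
        unfolding S_def by (rule U(3)[OF that cTg])
      also have "\<dots> \<le> d\<^sup>2 * L" by (intro mult_left_mono Tg) auto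
      also have "\<dots> = e\<^sup>2" using Lpos by (simp add: d_def power_divide)
      finally have "(S (g n) y - S (g n) x)\<^sup>2 \<le> e\<^sup>2" .
      moreover have "0 \<le> e" using \<open>e > 0\<close> by simp
      ultimately show ?thesis using power2_le_iff_abs_le by blast
    qed
    with U show "\<exists>U. open U \<and> x \<in> U \<and> (\<forall>y\<in>U. \<forall>n. \<bar>S (g n) y - S (g n) x\<bar> \<le> e)" by blast
  qed blast
  have diff_small: "ip (\<lambda>x. h x - S (g n) x) (\<lambda>x. h x - S (g n) x) \<le> e\<^sup>2"
    if "\<forall>x. \<bar>S (g n) x - h x\<bar> \<le> e" for n e
    using that by (intro ip_self_le continuous_intros h cS g) (simp add: abs_minus_commute)
  define r where "r = (\<lambda>x. S h x - L * h x)"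
  have cr: "cont r" unfolding r_def by (intro continuous_intros cS h)
  \<comment> \<open>With \<open>a = S (g n)\<close>, \<open>w = h - a\<close> and
    \<open>u = S (g n) - L * g n\<close>, the residual is \<open>r = S w + S u - L * w\<close>, and
    all three terms are small: \<open>w\<close> by the choice of \<open>n\<close>, \<open>u\<close>
    by \<open>app\<close>.\<close>
  have r_le: "ip r r \<le> 3 * (2 * L\<^sup>2 * e\<^sup>2 + L\<^sup>2 * (L * e))" if "e > 0" for e
  proof -
    obtain N where N: "1 / real (Suc N) < e" using nat_approx_posE[OF \<open>e > 0\<close>] by metis
    obtain n where n: "n \<ge> N" "\<forall>x. \<bar>S (g n) x - h x\<bar> \<le> e" using h(2)[OF \<open>e > 0\<close>] by metis
    have "1 / real (Suc n) \<le> 1 / real (Suc N)" using n(1) by (intro divide_left_mono) auto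
    with N gL[of n] have small: "L - ip (T (g n)) (T (g n)) \<le> e" by linarith
    define a where "a = S (g n)"
    have a: "cont a" unfolding a_def by (intro cS g)
    define w where "w = (\<lambda>x. h x - a x)"
    have w: "cont w" unfolding w_def by (intro continuous_intros h a)
    define u where "u = (\<lambda>x. S (g n) x - L * g n x)"
    have u: "cont u" unfolding u_def by (intro continuous_intros cS g)
    have ww: "ip w w \<le> e\<^sup>2" using diff_small[OF n(2)] by (simp add: w_def a_def)
    have "ip u u \<le> L * e"
      unfolding u_def by (rule order_trans[OF app[OF g(1) g(2)]]) (use small Lpos in simp)
    have "ip r r \<le> 3 * (ip (S w) (S w) + ip (S u) (S u) + ip (\<lambda>x. - L * w x) (\<lambda>x. - L * w x))"
    proof (rule ip_sum3)
      fix x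
      have "S w x = S h x - S a x" using Slin[OF h(1) a, of 1] by (simp add: w_def)
      moreover have "S u x = S a x - L * a x" using Slin[OF a g(1), of L n] by (simp add: u_def a_def)
      ultimately show "r x = S w x + S u x + - L * w x" by (simp add: r_def w_def algebra_simps)
    qed (intro cr cS w u continuous_intros)+
    also have "\<dots> \<le> 3 * (L\<^sup>2 * e\<^sup>2 + L\<^sup>2 * (L * e) + L\<^sup>2 * e\<^sup>2)"
    proof -
      have "ip (S w) (S w) \<le> L\<^sup>2 * e\<^sup>2"
        by (rule order_trans[OF SLL[OF w]]) (intro mult_left_mono ww zero_le_power2)
      moreover have "ip (S u) (S u) \<le> L\<^sup>2 * (L * e)"
        by (rule order_trans[OF SLL[OF u]]) (intro mult_left_mono \<open>ip u u \<le> L * e\<close> zero_le_power2)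
      moreover have "ip (\<lambda>x. - L * w x) (\<lambda>x. - L * w x) = L\<^sup>2 * ip w w"
        using ip_cmult_left[OF w, of "\<lambda>x. - L * w x" "- L"] ip_cmult_right[OF w w, of "- L"] w
        by (simp add: continuous_on_mult continuous_on_minus power2_eq_square)
      moreover have "L\<^sup>2 * ip w w \<le> L\<^sup>2 * e\<^sup>2" by (intro mult_left_mono ww) auto
      ultimately show ?thesis by simp
    qed
    finally show ?thesis by (simp add: algebra_simps)
  qed
  have "ip r r \<le> 0"
  proof (rule tendsto_lowerbound)
    show "((\<lambda>e. 3 * (2 * L\<^sup>2 * e\<^sup>2 + L\<^sup>2 * (L * e))) \<longlongrightarrow> 0) (at_right 0)"
      by (auto intro!: tendsto_eq_intros)
    show "\<forall>\<^sub>F e in at_right 0. ip r r \<le> 3 * (2 * L\<^sup>2 * e\<^sup>2 + L\<^sup>2 * (L * e))"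
      using r_le by (simp add: eventually_at_filter)
  qed simp
  then have "ip r r = 0" using ip_self_nonneg[OF cr] by simp
  from ip_self_eq_0[OF cr this] have eig: "S h x = L * h x" for x by (simp add: r_def)
  \<comment> \<open>Were \<open>h = 0\<close>, some late \<open>S (g n)\<close> would be uniformly
    at most \<open>L / 4\<close> in absolute value, but
    \<open>ip (S (g n)) (g n) = ip (T (g n)) (T (g n))\<close> is at least
    \<open>L / 2\<close>.\<close>
  have "h \<noteq> (\<lambda>_. 0)"
  proof
    assume h0: "h = (\<lambda>_. 0)"
    have L4: "L / 4 > 0" using Lpos by simp
    obtain N where N: "1 / real (Suc N) < L / 4" using nat_approx_posE[OF L4] by metis
    obtain n where n: "n \<ge> N" "\<forall>x. \<bar>S (g n) x - h x\<bar> \<le> L / 4" using h(2)[OF L4] by metis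
    have "1 / real (Suc n) \<le> 1 / real (Suc N)" using n(1) by (intro divide_left_mono) auto
    with N gL[of n] have big: "L / 2 \<le> ip (T (g n)) (T (g n))" using Lpos by linarith
    have "(ip (T (g n)) (T (g n)))\<^sup>2 = (ip (S (g n)) (g n))\<^sup>2" by (simp add: adj g)
    also have "\<dots> \<le> ip (S (g n)) (S (g n)) * ip (g n) (g n)" by (intro cauchy_schwarz cS g)
    also have "\<dots> \<le> ip (S (g n)) (S (g n)) * 1" by (intro mult_left_mono g ip_self_nonneg cS)
    also have "\<dots> \<le> (L / 4)\<^sup>2" using n(2) h0 ip_self_le[OF cS[OF g(1)[of n]], of "L / 4"] by simp
    finally have "(ip (T (g n)) (T (g n)))\<^sup>2 \<le> (L / 4)\<^sup>2" .
    from power2_le_imp_le[OF this] big Lpos show False by simp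
  qed
  with Lpos h(1) eig show thesis by (intro that[of L h]) (auto simp: S_def T_def v'_def)
qed

text \<open>The eigenspace \<open>W\<close> is right invariant, and it is finite-dimensional:
  Bessel's inequality for the kernel section at \<open>x\<close> bounds the sum of the
  \<open>(conv v (e i) x)\<^sup>2\<close> by \<open>C\<^sup>2\<close>, and taking the mean over
  \<open>x\<close> gives \<open>n * L \<le> C\<^sup>2\<close>. An orthonormal basis of
  \<open>W\<close> then expresses all translates of \<open>h\<close>.\<close>

lemma eigenvector_representative:
  assumes v: "cont v" and L: "L > 0" and h: "cont h"
    and eig: "\<And>x. conv (\<lambda>z. v (- z)) (conv v h) x = L * h x"
  shows "representative h"
proof -
  define v' where "v' = (\<lambda>z. v (- z))"
  have v': "cont v'" unfolding v'_def by (rule cont_reflect[OF v])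
  obtain C where C: "C > 0" "\<And>x. \<bar>v x\<bar> \<le> C" using cont_bounded[OF v] by metis
  define W where "W = {f. cont f \<and> (\<forall>x. conv v' (conv v f) x = L * f x)}"
  have W: "cont f" if "f \<in> W" for f using that by (simp add: W_def)
  have lin: "(\<lambda>x. f x - c * g x) \<in> W" if "f \<in> W" "g \<in> W" for f g c
  proof -
    have "conv v (\<lambda>y. f y - c * g y) = (\<lambda>x. conv v f x - c * conv v g x)"
      using conv_lin[OF v] that by (auto simp: W_def)
    then have "conv v' (conv v (\<lambda>y. f y - c * g y)) x = conv v' (conv v f) x - c * conv v' (conv v g) x" for x
      using conv_lin[OF v' cont_conv[OF v] cont_conv[OF v]] that by (simp add: W_def)
    with that show ?thesis by (auto simp: W_def algebra_simps intro!: continuous_intros)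
  qed
  have bound: "n \<le> nat \<lceil>C\<^sup>2 / L\<rceil>" if e: "orthonormal n e" "\<And>i. i < n \<Longrightarrow> e i \<in> W" for n e
  proof -
    have ce: "cont (e i)" if "i < n" for i using e(1) that by (simp add: orthonormal_def)
    have "(\<Sum>i<n. conv v (e i) x * conv v (e i) x) \<le> C\<^sup>2" for x
    proof -
      have "(\<Sum>i<n. conv v (e i) x * conv v (e i) x) = (\<Sum>i<n. (ip (\<lambda>y. v (x - y)) (e i))\<^sup>2)"
        by (simp add: conv_eq_ip power2_eq_square)
      also have "\<dots> \<le> ip (\<lambda>y. v (x - y)) (\<lambda>y. v (x - y))" by (rule bessel[OF e(1) cont_shift[OF v]])
      also have "\<dots> \<le> C\<^sup>2" by (intro ip_self_le cont_shift v C)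
      finally show ?thesis .
    qed
    then have "mean (\<lambda>x. \<Sum>i<n. conv v (e i) x * conv v (e i) x) \<le> mean (\<lambda>_. C\<^sup>2)"
      by (intro mean_mono continuous_intros cont_conv v ce) auto
    also have "mean (\<lambda>x. \<Sum>i<n. conv v (e i) x * conv v (e i) x) = (\<Sum>i<n. ip (conv v (e i)) (conv v (e i)))"
      unfolding ip_def by (intro mean_sum continuous_intros cont_conv v ce) auto
    also have "\<dots> = (\<Sum>i<n. L)"
    proof (intro sum.cong refl)
      fix i assume "i \<in> {..<n}"
      then have i: "i < n" by simp
      have "ip (conv v (e i)) (conv v (e i)) = ip (e i) (conv v' (conv v (e i)))"
        unfolding v'_def by (intro conv_adjoint cont_conv v ce i)
      also have "conv v' (conv v (e i)) = (\<lambda>x. L * e i x)" using e(2)[OF i] by (auto simp: W_def)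
      also have "ip (e i) (\<lambda>x. L * e i x) = L"
        using e(1) i ce[OF i] by (simp add: ip_cmult_right orthonormal_def)
      finally show "ip (conv v (e i)) (conv v (e i)) = L" .
    qed
    finally have "real n \<le> C\<^sup>2 / L" using L by (simp add: mean_const field_simps)
    then show ?thesis by linarith
  qed
  obtain n e where e: "orthonormal n e" "\<And>f x. f \<in> W \<Longrightarrow> f x = (\<Sum>i<n. ip f (e i) * e i x)"
    by (rule ex_orthonormal_basis[of W "nat \<lceil>C\<^sup>2 / L\<rceil>"]) (use W lin bound in blast)+
  have "(\<lambda>x. h (x + s)) \<in> W" for s
  proof -
    have "conv v (\<lambda>x. h (x + s)) = (\<lambda>x. conv v h (x + s))" using conv_translate[OF v h] by auto
    then have "conv v' (conv v (\<lambda>x. h (x + s))) x = L * h (x + s)" for x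
      using conv_translate[OF v' cont_conv[OF v h]] eig by (simp add: v'_def)
    moreover have "cont (\<lambda>x. h (x + s))" using continuous_on_translate_right[OF h] by simp
    ultimately show ?thesis by (simp add: W_def)
  qed
  from e(2)[OF this] have "\<exists>c. \<forall>x. h (x + s) = (\<Sum>i<n. c i * e i x)" for s by metis
  then have "h \<in> translates_in {..<n} e"
    using h by (simp add: translates_in_def)
  then show ?thesis by (rule representativeI[rotated]) simp
qed

text \<open>If all representative functions agreed at \<open>a\<close> and \<open>b\<close>, they would be invariant under left
  translation by \<open>a - b\<close>, hence annihilated by convolution with \<open>v = u - u(\<cdot> + (a - b))\<close>; but that
  operator has a nonzero eigenvector.\<close>

lemma representative_separates:
  assumes "a \<noteq> b"
  obtains f where "representative f" "f a \<noteq> f b"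
proof -
  have "\<exists>f. representative f \<and> f a \<noteq> f b"
  proof (rule ccontr)
    assume neg: "\<not> ?thesis"
    define c where "c = a - b"
    have "0 \<noteq> c" using assms by (auto simp: c_def)
    have inv: "f (c + t) = f t" if "representative f" for f t
    proof -
      have "f (a + (- b + t)) = f (b + (- b + t))"
        using neg representative_translate[OF that, of "- b + t"] by blast
      then show ?thesis by (simp add: c_def add.assoc[symmetric])
    qed
    have "closed {c}" "0 \<in> UNIV - {c}" using \<open>0 \<noteq> c\<close> by auto
    then obtain u where u: "cont u" "u 0 = 1" "u c = 0"
      by (rule continuous_bump) (rule that, assumption+, blast)
    have uc: "cont (\<lambda>z. u (z + c))" using continuous_on_translate_right[OF u(1)] by simp
    define v where "v z = u z - u (z + c)" for z
    have v: "cont v" unfolding v_def by (intro continuous_intros u uc)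
    have zero: "conv v f x = 0" if f: "representative f" for f x
    proof -
      have cf: "cont f" by (rule representative_cont[OF f])
      have c1: "cont (\<lambda>y. u (x - y) * f y)" by (intro continuous_intros cont_shift u cf)
      have c2: "cont (\<lambda>y. u (x - y + c) * f y)"
        using cont_shift[OF uc, of x] by (intro continuous_on_mult cf)
      \<comment> \<open>Substituting \<open>c + y\<close> for \<open>y\<close> cancels the
        \<open>c\<close>. As \<open>x - (c + y) = x - y - c\<close>, this has to be a left
        translation, under which \<open>f\<close> is invariant by \<open>inv\<close>.\<close>
      have "x - (c + y) + c = x - y" for y
        by (simp add: diff_conv_add_uminus minus_add add.assoc del: add_uminus_conv_diff)
      then have "mean (\<lambda>y. u (x - y + c) * f y) = mean (\<lambda>y. u (x - y) * f y)"
        using mean_translate_left[OF c2, of c] inv[OF f] by simp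
      then show ?thesis
        using mean_diff[OF c1 c2] by (simp add: conv_def v_def algebra_simps)
    qed
    have v': "cont (\<lambda>z. v (- z))" by (rule cont_reflect[OF v])
    \<comment> \<open>The reflected kernel is a function that the operator does not annihilate: the
      value at \<open>0\<close> is the mean of \<open>(v (- y))\<^sup>2\<close>.\<close>
    have "conv v (\<lambda>z. v (- z)) 0 > 0"
      unfolding conv_def
    proof (rule mean_pos[of _ 0])
      have "v 0 = 1" using u by (simp add: v_def)
      then show "0 < v (0 - 0) * v (- 0)" by simp
    qed (use v' in \<open>auto intro!: continuous_intros\<close>)
    then have ne: "conv v (\<lambda>z. v (- z)) 0 \<noteq> 0" by simp
    obtain L h where Lh: "L > 0" "cont h" "h \<noteq> (\<lambda>_. 0)"
      and eig: "\<And>x. conv (\<lambda>z. v (- z)) (conv v h) x = L * h x"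
      using conv_eigenvector[OF v v' ne] by metis
    have "conv v h = (\<lambda>_. 0)"
      using zero[OF eigenvector_representative[OF v Lh(1,2) eig]] by auto
    then have "L * h x = 0" for x using eig[of x] by (simp add: conv_def mean_const)
    with Lh show False by (auto simp: fun_eq_iff)
  qed
  with that show thesis by blast
qed

text \<open>The Peter-Weyl theorem in real form. A single \<open>\<rho>\<close> is enough because
  the approximating function is itself representative.\<close>

theorem orthogonal_rep_dense:
  assumes "cont f" "e > 0"
  obtains n \<rho> c where "orthogonal_rep n \<rho>" "\<And>x. \<bar>f x - (\<Sum>i<n. \<Sum>j<n. c i j * \<rho> i j x)\<bar> < e"
proof -
  have "\<exists>g. representative g \<and> (\<forall>x\<in>UNIV. \<bar>f x - g x\<bar> < e)"
  proof (rule Stone_Weierstrass_HOL)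
    show "\<exists>f. representative f \<and> f x \<noteq> f y" if "x \<in> UNIV \<and> y \<in> UNIV \<and> x \<noteq> y" for x y
      using representative_separates[of x y] that by metis
  qed (use assms compact representative_const representative_cont representative_add
      representative_mult in auto)
  then obtain g where "representative g" and "\<And>x. \<bar>f x - g x\<bar> < e" by blast
  moreover obtain n \<rho> c where "orthogonal_rep n \<rho>" "\<And>x. g x = (\<Sum>i<n. \<Sum>j<n. c i j * \<rho> i j x)"
    by (rule representative_expansion[OF \<open>representative g\<close>]) (rule that)
  ultimately show thesis using that[of n \<rho> c] by simp
qed

end

section \<open>Function algebras and vector-valued means\<close>

text \<open>Elements of \<open>S\<close> outside \<open>A\<close> are ignored, as they are by the
  closure operator of the metric topology.\<close>

definition alg_closure ::
  "('x \<Rightarrow> complex) set \<Rightarrow> (('x \<Rightarrow> complex) \<Rightarrow> real) \<Rightarrow> ('x \<Rightarrow> complex) set \<Rightarrow> ('x \<Rightarrow> complex) set" where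
  "alg_closure A N S = {f \<in> A. \<forall>e>0. \<exists>g\<in>S \<inter> A. N (f - g) < e}"

lemma alg_topology_closure_of:
  assumes "Metric_space A (alg_dist A N)"
  shows "alg_topology A N closure_of S = alg_closure A N S"
proof -
  interpret Metric_space A "alg_dist A N" by (rule assms)
  show ?thesis
    unfolding alg_topology_def metric_closure_of alg_closure_def
    by (auto simp: alg_dist_def; metis (full_types) IntI)
qed

section \<open>Closures of subspaces and ideals in a normed function algebra\<close>

context normed_function_algebra
begin

abbreviation cl :: "('x \<Rightarrow> complex) set \<Rightarrow> ('x \<Rightarrow> complex) set" where
  "cl \<equiv> alg_closure A N"

lemma add_closed: "f \<in> A \<Longrightarrow> g \<in> A \<Longrightarrow> f + g \<in> A"
  using subspace by (rule cfun.subspace_add)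

lemma scale_closed: "f \<in> A \<Longrightarrow> (\<lambda>x. c * f x) \<in> A"
  using subspace by (rule cfun.subspace_scale)

lemma sum_closed: "(\<And>j. j \<in> J \<Longrightarrow> f j \<in> A) \<Longrightarrow> (\<Sum>j\<in>J. f j) \<in> A"
  using subspace by (rule cfun.subspace_sum)

lemma zero_closed: "0 \<in> A"
  using subspace by (rule cfun.subspace_0)

lemma norm_diff_triangle: "f \<in> A \<Longrightarrow> g \<in> A \<Longrightarrow> h \<in> A \<Longrightarrow> N (f - h) \<le> N (f - g) + N (g - h)"
  using norm_triangle[of "f - g" "g - h"] by (simp add: diff_closed)

lemma norm_sum_le:
  "(\<And>j. j \<in> J \<Longrightarrow> f j \<in> A) \<Longrightarrow> N (\<Sum>j\<in>J. f j) \<le> (\<Sum>j\<in>J. N (f j))"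
proof (induction J rule: infinite_finite_induct)
  case (insert j J)
  then have "N (f j + (\<Sum>j\<in>J. f j)) \<le> N (f j) + N (\<Sum>j\<in>J. f j)"
    by (intro norm_triangle sum_closed) auto
  moreover have "N (\<Sum>j\<in>J. f j) \<le> (\<Sum>j\<in>J. N (f j))" using insert by auto
  ultimately show ?case unfolding sum.insert[OF insert(1,2)] by linarith
next
  case empty
  show ?case unfolding sum.empty norm_0 by (rule order_refl)
next
  case (infinite J)
  show ?case unfolding sum.infinite[OF infinite(1)] norm_0 by (rule order_refl)
qed

lemma closureI: "f \<in> A \<Longrightarrow> (\<And>e. e > 0 \<Longrightarrow> \<exists>g\<in>S. g \<in> A \<and> N (f - g) < e) \<Longrightarrow> f \<in> cl S"
  by (auto simp: alg_closure_def Bex_def)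

lemma closureE:
  assumes "f \<in> cl S" "e > 0"
  obtains g where "g \<in> S" "g \<in> A" "N (f - g) < e"
  using assms by (auto simp: alg_closure_def)

lemma closure_subset: "cl S \<subseteq> A"
  by (auto simp: alg_closure_def)

lemma subset_closure: "S \<subseteq> A \<Longrightarrow> S \<subseteq> cl S"
proof
  fix f assume "S \<subseteq> A" "f \<in> S"
  then have "f \<in> A" by blast
  then show "f \<in> cl S" using \<open>f \<in> S\<close> norm_0 by (intro closureI bexI[of _ f]) auto
qed

lemma closure_mono: "S \<subseteq> T \<Longrightarrow> cl S \<subseteq> cl T"
  unfolding alg_closure_def by blast

lemma closure_closure: "cl (cl S) \<subseteq> cl S"
proof
  fix f assume f: "f \<in> cl (cl S)"
  then have fA: "f \<in> A" using closure_subset by blast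
  show "f \<in> cl S"
  proof (rule closureI[OF fA])
    fix e :: real assume "e > 0"
    then have e2: "e / 2 > 0" by simp
    obtain g where g: "g \<in> cl S" "g \<in> A" "N (f - g) < e / 2" by (rule closureE[OF f e2])
    obtain h where h: "h \<in> S" "h \<in> A" "N (g - h) < e / 2" by (rule closureE[OF g(1) e2])
    show "\<exists>g\<in>S. g \<in> A \<and> N (f - g) < e"
      using h norm_diff_triangle[OF fA g(2) h(2)] g(3) by (intro bexI[of _ h]) auto
  qed
qed

lemma closure_minimal: "S \<subseteq> T \<Longrightarrow> cl T \<subseteq> T \<Longrightarrow> cl S \<subseteq> T"
  using closure_mono by blast

text \<open>Scaling, multiplication, right translation and averaging all pass to closures by this
  one argument.\<close>

lemma closure_lipschitz:
  assumes "\<And>f. f \<in> A \<Longrightarrow> \<Phi> f \<in> A" "\<And>f g. f \<in> A \<Longrightarrow> g \<in> A \<Longrightarrow> N (\<Phi> f - \<Phi> g) \<le> C * N (f - g)"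
    and "\<And>f. f \<in> S \<Longrightarrow> f \<in> A \<Longrightarrow> \<Phi> f \<in> cl T" "f \<in> cl S"
  shows "\<Phi> f \<in> cl T"
proof -
  have fA: "f \<in> A" using assms(4) closure_subset by blast
  have "\<Phi> f \<in> cl (cl T)"
  proof (rule closureI[OF assms(1)[OF fA]])
    fix e :: real assume "e > 0"
    define d where "d = e / (\<bar>C\<bar> + 1)"
    have "d > 0" using \<open>e > 0\<close> by (simp add: d_def add_nonneg_pos)
    from closureE[OF assms(4) this] obtain g where g: "g \<in> S" "g \<in> A" "N (f - g) < d" by blast
    have "N (\<Phi> f - \<Phi> g) \<le> C * N (f - g)" by (rule assms(2)[OF fA g(2)])
    also have "\<dots> \<le> \<bar>C\<bar> * N (f - g)" by (intro mult_right_mono norm_nonneg diff_closed fA g) auto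
    also have "\<dots> \<le> \<bar>C\<bar> * d" using g(3) by (intro mult_left_mono) auto
    also have "\<dots> < (\<bar>C\<bar> + 1) * d" using \<open>d > 0\<close> by simp
    also have "\<dots> = e" by (simp add: d_def add_nonneg_pos)
    finally show "\<exists>g\<in>cl T. g \<in> A \<and> N (\<Phi> f - g) < e"
      using assms(3)[OF g(1,2)] g(2) by (intro bexI[of _ "\<Phi> g"]) (auto intro: assms(1))
  qed
  then show ?thesis using closure_closure by blast
qed

lemma subspace_closure:
  assumes "cfun.subspace S" "S \<subseteq> A"
  shows "cfun.subspace (cl S)"
proof (rule cfun.subspaceI)
  show "0 \<in> cl S" using subset_closure[OF assms(2)] cfun.subspace_0[OF assms(1)] by blast
next
  fix f g assume fg: "f \<in> cl S" "g \<in> cl S"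
  then have A: "f \<in> A" "g \<in> A" using closure_subset by blast+
  show "f + g \<in> cl S"
  proof (rule closureI)
    fix e :: real assume "e > 0"
    then have e2: "e / 2 > 0" by simp
    obtain f' where f': "f' \<in> S" "f' \<in> A" "N (f - f') < e / 2" by (rule closureE[OF fg(1) e2])
    obtain g' where g': "g' \<in> S" "g' \<in> A" "N (g - g') < e / 2" by (rule closureE[OF fg(2) e2])
    have eq: "f + g - (f' + g') = (f - f') + (g - g')" by simp
    have "N (f + g - (f' + g')) < e"
      unfolding eq using norm_triangle[of "f - f'" "g - g'"] A f' g' by (simp add: diff_closed)
    then show "\<exists>h\<in>S. h \<in> A \<and> N (f + g - h) < e"
      using f' g' cfun.subspace_add[OF assms(1)] by (intro bexI[of _ "f' + g'"]) (auto intro: add_closed)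
  qed (intro add_closed A)
next
  fix c f assume f: "f \<in> cl S"
  show "(\<lambda>x. c * f x) \<in> cl S"
  proof (rule closure_lipschitz[where \<Phi> = "\<lambda>f x. c * f x", OF _ _ _ f])
    show "N ((\<lambda>x. c * f x) - (\<lambda>x. c * g x)) \<le> norm c * N (f - g)" if "f \<in> A" "g \<in> A" for f g
      using norm_scale[OF diff_closed[OF that], of c] by (simp add: fun_diff_def algebra_simps)
    show "(\<lambda>x. c * f x) \<in> cl S" if "f \<in> S" for f
      using subset_closure[OF assms(2)] cfun.subspace_scale[OF assms(1) that] by blast
  qed (rule scale_closed)
qed

lemma norm_mult_diff_le:
  "a \<in> A \<Longrightarrow> f \<in> A \<Longrightarrow> g \<in> A \<Longrightarrow> N (a * f - a * g) \<le> N a * N (f - g)"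
  using norm_mult[of a "f - g"] by (simp add: diff_closed right_diff_distrib)

lemma closure_ideal:
  assumes "\<And>a f. a \<in> A \<Longrightarrow> f \<in> S \<Longrightarrow> a * f \<in> S" "S \<subseteq> A" "a \<in> A" "f \<in> cl S"
  shows "a * f \<in> cl S"
proof (rule closure_lipschitz[where \<Phi> = "\<lambda>f. a * f", OF _ _ _ assms(4)])
  show "a * f \<in> cl S" if "f \<in> S" for f
    using subset_closure[OF assms(2)] assms(1)[OF assms(3) that] by blast
  show "a * f \<in> A" if "f \<in> A" for f
    using assms(3) that by (rule mult_closed)
  show "N (a * f - a * g) \<le> N a * N (f - g)" if "f \<in> A" "g \<in> A" for f g
    using assms(3) that by (rule norm_mult_diff_le)
qed

text \<open>One factor at a time: both factors in the spans, then the right one in the closure, then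
  the left one. Each passage to the closure is Lipschitz because the other factor is fixed.\<close>

lemma closure_span_mult:
  assumes B: "B \<subseteq> A" and C: "C \<subseteq> A"
    and BC: "\<And>x y. x \<in> B \<Longrightarrow> y \<in> C \<Longrightarrow> x * y \<in> D" and D: "D \<subseteq> A"
    and f: "f \<in> cl (cfun.span B)" and g: "g \<in> cl (cfun.span C)"
  shows "f * g \<in> cl (cfun.span D)"
proof -

  have span_A: "cfun.span S \<subseteq> A" if "S \<subseteq> A" for S
    by (rule cfun.span_minimal[OF that subspace])
  have Dc: "cfun.span D \<subseteq> cl (cfun.span D)"
    by (rule subset_closure[OF span_A[OF D]])
  have step1: "x * h \<in> cfun.span D" if x: "x \<in> B" and h: "h \<in> cfun.span C" for x h
    using h
  proof (induction rule: cfun.span_induct_alt)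
    case base
    show ?case unfolding mult_zero_right by (rule cfun.span_zero)
  next
    case (step c y h)
    have eq: "x * ((\<lambda>z. c * y z) + h) = (\<lambda>z. c * (x * y) z) + x * h"
      by (auto simp: fun_eq_iff algebra_simps)
    show ?case
      unfolding eq by (intro cfun.span_add cfun.span_scale cfun.span_base BC[OF x step(1)] step(2))
  qed
  have step2: "h * k \<in> cfun.span D" if h: "h \<in> cfun.span B" and k: "k \<in> cfun.span C" for h k
    using h
  proof (induction rule: cfun.span_induct_alt)
    case base
    show ?case unfolding mult_zero_left by (rule cfun.span_zero)
  next
    case (step c x h)
    have eq: "((\<lambda>z. c * x z) + h) * k = (\<lambda>z. c * (x * k) z) + h * k"
      by (auto simp: fun_eq_iff algebra_simps)
    show ?case
      unfolding eq by (intro cfun.span_add cfun.span_scale step1[OF step(1) k] step(2))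
  qed
  have gA: "g \<in> A" using g closure_subset by blast
  have step3: "h * g \<in> cl (cfun.span D)" if h: "h \<in> cfun.span B" for h
  proof (rule closure_lipschitz[where \<Phi> = "\<lambda>g. h * g", OF _ _ _ g])
    have "h \<in> A" using h span_A[OF B] by blast
    then show "h * g \<in> A" "N (h * f - h * g) \<le> N h * N (f - g)" if "f \<in> A" "g \<in> A" for f g
      using that by (auto intro: mult_closed norm_mult_diff_le)
    show "h * k \<in> cl (cfun.span D)" if "k \<in> cfun.span C" for k
      using Dc step2[OF h that] by blast
  qed
  show ?thesis
  proof (rule closure_lipschitz[where \<Phi> = "\<lambda>f. f * g", OF _ _ _ f])
    show "N (f * g - h * g) \<le> N g * N (f - h)" if "f \<in> A" "h \<in> A" for f h
      unfolding mult.commute[of _ g] by (rule norm_mult_diff_le[OF gA that])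
    show "f * g \<in> A" if "f \<in> A" for f
      using that gA by (rule mult_closed)
  qed (rule step3)
qed

end

section \<open>Consequences of completeness\<close>

context banach_function_algebra
begin

lemma cauchy_limit:
  fixes f :: "nat \<Rightarrow> _ \<Rightarrow> complex"
  assumes f: "\<And>n. f n \<in> A" and cauchy: "\<And>e. e > 0 \<Longrightarrow> \<exists>n0. \<forall>m\<ge>n0. \<forall>n\<ge>n0. N (f m - f n) < e"
  obtains g where "g \<in> A" "\<And>e. e > 0 \<Longrightarrow> \<exists>n0. \<forall>n\<ge>n0. N (f n - g) < e"
proof -
  have "MCauchy f"
    unfolding MCauchy_def using f cauchy by (auto simp: alg_dist_def)
  with complete obtain g where g: "limitin mtopology f g sequentially"
    unfolding mcomplete_def by blast
  then have "g \<in> A" "\<And>e. e > 0 \<Longrightarrow> \<exists>n0. \<forall>n\<ge>n0. N (f n - g) < e"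
    using f by (auto simp: limitin_metric alg_dist_def eventually_sequentially)
  then show thesis by (rule that)
qed

text \<open>Characters are contractive: otherwise \<open>h = f / f x\<close> has norm less than one, and the limit
  \<open>g\<close> of its geometric series satisfies \<open>g = h + h * g\<close>, which fails at \<open>x\<close>.\<close>

lemma norm_apply_le:
  assumes f: "f \<in> A"
  shows "norm (f x) \<le> N f"
proof (rule ccontr)
  assume "\<not> norm (f x) \<le> N f"
  then have lt: "N f < norm (f x)" by simp
  then have fx: "f x \<noteq> 0" using norm_nonneg[OF f] by auto
  define h where "h = (\<lambda>y. inverse (f x) * f y)"
  define r where "r = N h"
  have h: "h \<in> A" unfolding h_def by (rule scale_closed[OF f])
  have hx: "h x = 1" using fx by (simp add: h_def)
  have "r = norm (inverse (f x)) * N f" unfolding r_def h_def by (rule norm_scale[OF f])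
  then have "r = N f / norm (f x)" by (simp add: norm_inverse divide_inverse mult.commute)
  moreover have "0 < norm (f x)" using fx by simp
  ultimately have r: "0 \<le> r" "r < 1"
    using lt norm_nonneg[OF f] by (simp_all add: divide_less_eq)
  \<comment> \<open>\<open>s n\<close> is the sum of the powers of \<open>h\<close> from the first
    to the \<open>n\<close>-th. The recursion avoids the zeroth power, as \<open>A\<close> may have
    no unit.\<close>
  define s where "s = rec_nat 0 (\<lambda>_ t. h + h * t)"
  have s0: "s 0 = 0" and sS: "s (Suc n) = h + h * s n" for n by (simp_all add: s_def)
  have sA: "s n \<in> A" for n
  proof (induction n)
    case 0
    show ?case unfolding s0 by (rule zero_closed)
  next
    case (Suc n)
    show ?case unfolding sS by (intro add_closed mult_closed h Suc)
  qed
  have sd: "N (s (Suc n) - s n) \<le> r ^ Suc n" for n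
  proof (induction n)
    case (Suc n)
    have "s (Suc (Suc n)) - s (Suc n) = h * (s (Suc n) - s n)"
      by (rule ext) (simp add: sS algebra_simps)
    then have "N (s (Suc (Suc n)) - s (Suc n)) \<le> r * N (s (Suc n) - s n)"
      using norm_mult[OF h diff_closed[OF sA sA]] by (simp add: r_def)
    also have "\<dots> \<le> r * r ^ Suc n" by (intro mult_left_mono Suc r)
    finally show ?case by (simp only: power_Suc)
  next
    case 0
    have "s (Suc 0) - s 0 = h" by (rule ext) (simp add: sS s0)
    then show ?case by (simp only: r_def power_Suc power_0 mult_1_right order_refl)
  qed
  have sk: "N (s (n + k) - s n) \<le> r ^ n * (r * (1 - r ^ k) / (1 - r))" for n k
  proof (induction k)
    case (Suc k)
    have "N (s (n + Suc k) - s n) \<le> N (s (Suc (n + k)) - s (n + k)) + N (s (n + k) - s n)"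
      using norm_diff_triangle[OF sA sA sA] by simp
    also have "\<dots> \<le> r ^ Suc (n + k) + r ^ n * (r * (1 - r ^ k) / (1 - r))"
      by (intro add_mono sd Suc)
    also have "\<dots> = r ^ n * (r * (1 - r ^ Suc k) / (1 - r))"
      using r by (simp add: field_simps power_add)
    finally show ?case .
  next
    case 0
    have "s (n + 0) - s n = 0" by simp
    then show ?case by (simp only: norm_0 power_0) simp
  qed
  have sk': "N (s (n + k) - s n) \<le> r ^ n * (1 / (1 - r))" for n k
  proof -
    have "r * (1 - r ^ k) \<le> 1 * 1" using r by (intro mult_mono) (auto simp: power_le_one)
    then have "r * (1 - r ^ k) / (1 - r) \<le> 1 / (1 - r)" using r by (intro divide_right_mono) auto
    then have "r ^ n * (r * (1 - r ^ k) / (1 - r)) \<le> r ^ n * (1 / (1 - r))"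
      using r by (intro mult_left_mono) auto
    with sk[of n k] show ?thesis by linarith
  qed
  have cauchy: "\<exists>n0. \<forall>m\<ge>n0. \<forall>n\<ge>n0. N (s m - s n) < e" if "e > 0" for e
  proof -
    have "(\<lambda>n. r ^ n * (1 / (1 - r))) \<longlonglongrightarrow> 0"
      by (rule tendsto_mult_left_zero[OF LIMSEQ_realpow_zero[OF r]])
    from order_tendstoD(2)[OF this, of "e / 2"] \<open>e > 0\<close>
    obtain n0 where n0: "r ^ n0 * (1 / (1 - r)) < e / 2"
      by (auto simp: eventually_sequentially)
    have near: "N (s m - s n0) < e / 2" if "m \<ge> n0" for m
    proof -
      have "N (s m - s n0) \<le> r ^ n0 * (1 / (1 - r))" using sk'[of n0 "m - n0"] that by simp
      with n0 show ?thesis by linarith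
    qed
    have "N (s m - s n) < e" if "m \<ge> n0" "n \<ge> n0" for m n
      using norm_diff_triangle[OF sA sA sA, of m n n0] near[OF that(1)] near[OF that(2)]
        norm_minus_commute[OF sA sA, of n n0] by linarith
    then show ?thesis by blast
  qed
  obtain g where g: "g \<in> A" "\<And>e. e > 0 \<Longrightarrow> \<exists>n0. \<forall>n\<ge>n0. N (s n - g) < e"
    using cauchy_limit[OF sA cauchy] by metis
  have "N (h + h * g - g) \<le> 0"
  proof (rule field_le_epsilon)
    fix e :: real assume "e > 0"
    then obtain n0 where n0: "\<forall>n\<ge>n0. N (s n - g) < e / 2" using g(2)[of "e / 2"] by auto
    have eq: "h + h * g - g = h * (g - s n0) + (s (Suc n0) - g)"
      by (rule ext) (simp add: sS algebra_simps)
    have "N (h + h * g - g) \<le> N (h * (g - s n0)) + N (s (Suc n0) - g)"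
      unfolding eq by (intro norm_triangle mult_closed h diff_closed g sA)
    also have "N (h * (g - s n0)) \<le> r * N (g - s n0)"
      unfolding r_def by (intro norm_mult h diff_closed g sA)
    also have "\<dots> \<le> 1 * N (g - s n0)"
      using r by (intro mult_right_mono norm_nonneg diff_closed g sA) auto
    also have "N (g - s n0) = N (s n0 - g)" by (rule norm_minus_commute[OF g(1) sA])
    finally have "N (h + h * g - g) \<le> N (s n0 - g) + N (s (Suc n0) - g)" by linarith
    moreover have "N (s n0 - g) < e / 2" using n0 by blast
    moreover have "N (s (Suc n0) - g) < e / 2" by (rule n0[rule_format]) simp
    ultimately show "N (h + h * g - g) \<le> 0 + e" by linarith
  qed
  then have "h + h * g - g = 0"
    using norm_eq_0[of "h + h * g - g"] norm_nonneg[of "h + h * g - g"] g(1) h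
    by (auto intro: diff_closed add_closed mult_closed)
  then have "(h + h * g - g) x = 0" by simp
  with hx show False by simp
qed

text \<open>By \<open>norm_apply_le\<close> evaluation at a point is continuous for the
  norm.\<close>

lemma closed_ideal_I: "cl (ideal_I A E) \<subseteq> ideal_I A E"
proof
  fix f assume f: "f \<in> cl (ideal_I A E)"
  then have fA: "f \<in> A" using closure_subset by blast
  have "norm (f x) \<le> 0" if "x \<in> E" for x
  proof (rule field_le_epsilon)
    fix e :: real assume "e > 0"
    from closureE[OF f this] obtain g where g: "g \<in> ideal_I A E" "g \<in> A" "N (f - g) < e" by blast
    then have "g x = 0" using that by (auto simp: ideal_I_def)
    with norm_apply_le[OF diff_closed[OF fA g(2)], of x] g(3) show "norm (f x) \<le> 0 + e" by simp
  qed
  with fA show "f \<in> ideal_I A E" by (auto simp: ideal_I_def)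
qed

end

section \<open>Integrals of algebra-valued functions over a compact subgroup\<close>

context compact_subgroup
begin

text \<open>Each function is indexed by a point \<open>j\<close> of \<open>K\<close> and vanishes on
  \<open>K\<close> outside \<open>U j\<close>, so that \<open>\<phi> j\<close> can serve as the
  sample value in a Riemann sum.\<close>

lemma partition_of_unity:
  assumes "\<And>k. k \<in> K \<Longrightarrow> open (U k)" "\<And>k. k \<in> K \<Longrightarrow> k \<in> U k"
  obtains J :: "'g set" and u :: "'g \<Rightarrow> 'g \<Rightarrow> real" where "finite J" "J \<subseteq> K"
    "\<And>j. j \<in> J \<Longrightarrow> continuous_on K (u j)" "\<And>j x. j \<in> J \<Longrightarrow> x \<in> K \<Longrightarrow> 0 \<le> u j x"
    "\<And>x. x \<in> K \<Longrightarrow> (\<Sum>j\<in>J. u j x) = 1" "\<And>j x. j \<in> J \<Longrightarrow> x \<in> K \<Longrightarrow> x \<notin> U j \<Longrightarrow> u j x = 0"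
proof -
  have "\<exists>w. continuous_on K w \<and> w k = (1::real) \<and> (\<forall>y\<in>K. y \<notin> U k \<longrightarrow> w y = 0) \<and> (\<forall>y\<in>K. 0 \<le> w y)"
    if k: "k \<in> K" for k
  proof -
    have "closed (- U k)" "k \<in> K - (- U k)" using assms k by (auto simp: closed_Compl)
    then obtain w where "continuous_on K w" "w k = (1::real)"
      "\<And>y. y \<in> K \<Longrightarrow> y \<in> - U k \<Longrightarrow> w y = 0" "\<And>y. y \<in> K \<Longrightarrow> 0 \<le> w y"
      by (rule continuous_bump) (rule that)
    then show ?thesis by (intro exI[of _ w]) auto
  qed
  then obtain w :: "'g \<Rightarrow> 'g \<Rightarrow> real" where w: "\<And>k. k \<in> K \<Longrightarrow> continuous_on K (w k)"
    "\<And>k. k \<in> K \<Longrightarrow> w k k = 1" "\<And>k y. k \<in> K \<Longrightarrow> y \<in> K \<Longrightarrow> y \<notin> U k \<Longrightarrow> w k y = 0"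
    "\<And>k y. k \<in> K \<Longrightarrow> y \<in> K \<Longrightarrow> 0 \<le> w k y"
    by metis
  have "\<exists>V. open V \<and> k \<in> V \<and> (\<forall>y\<in>V \<inter> K. 0 < w k y)" if k: "k \<in> K" for k
  proof -
    obtain V where "open V" "V \<inter> K = w k -` {0<..} \<inter> K"
      using w(1)[OF k] unfolding continuous_on_open_invariant by (metis open_greaterThan)
    then show ?thesis using w(2)[OF k] k by (intro exI[of _ V]) auto
  qed
  then obtain V where V: "\<And>k. k \<in> K \<Longrightarrow> open (V k)" "\<And>k. k \<in> K \<Longrightarrow> k \<in> V k"
    "\<And>k y. k \<in> K \<Longrightarrow> y \<in> V k \<inter> K \<Longrightarrow> 0 < w k y" by metis
  have "K \<subseteq> (\<Union>k\<in>K. V k)" using V(2) by blast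
  then obtain J where J: "J \<subseteq> K" "finite J" "K \<subseteq> (\<Union>k\<in>J. V k)"
    using compactE_image[OF compact, of K V] V(1) by metis
  define W where "W x = (\<Sum>j\<in>J. w j x)" for x
  have Wpos: "W x > 0" if x: "x \<in> K" for x
  proof -
    obtain j where "j \<in> J" "x \<in> V j" using J x by blast
    then have "0 < w j x" using V(3) J x by blast
    then show ?thesis
      unfolding W_def using J w(4) x \<open>j \<in> J\<close> by (intro sum_pos2[of _ j]) auto
  qed
  have "continuous_on K W" unfolding W_def using J w(1) by (intro continuous_on_sum) auto
  show thesis
  proof (rule that[of J "\<lambda>j x. w j x / W x"])
    show "continuous_on K (\<lambda>x. w j x / W x)" if "j \<in> J" for j
      using \<open>continuous_on K W\<close> Wpos w(1) J that by (intro continuous_on_divide) force+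
    show "0 \<le> w j x / W x" if "j \<in> J" "x \<in> K" for j x
      using w(4) Wpos[OF that(2)] J that by (intro divide_nonneg_nonneg) (auto intro: less_imp_le)
    show "(\<Sum>j\<in>J. w j x / W x) = 1" if "x \<in> K" for x
      using Wpos[OF that] by (simp add: sum_divide_distrib[symmetric] W_def)
    show "w j x / W x = 0" if "j \<in> J" "x \<in> K" "x \<notin> U j" for j x
      using w(3) J that by auto
  qed (use J in auto)
qed

definition cmean :: "('g \<Rightarrow> complex) \<Rightarrow> complex" where
  "cmean f = Complex (mean (\<lambda>k. Re (f k))) (mean (\<lambda>k. Im (f k)))"

lemma continuous_on_Re_Im:
  "continuous_on S f \<Longrightarrow> continuous_on S (\<lambda>k. Re (f k))"
  "continuous_on S f \<Longrightarrow> continuous_on S (\<lambda>k. Im (f k))"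
  by (auto intro!: continuous_intros)

lemma cmean_cong: "(\<And>k. k \<in> K \<Longrightarrow> f k = g k) \<Longrightarrow> cmean f = cmean g"
  unfolding cmean_def by (intro arg_cong2[of _ _ _ _ Complex] mean_cong) auto

lemma cmean_const: "cmean (\<lambda>_. c) = c"
  by (simp add: cmean_def mean_const)

lemma cmean_add: "continuous_on K f \<Longrightarrow> continuous_on K g \<Longrightarrow> cmean (\<lambda>k. f k + g k) = cmean f + cmean g"
  by (simp add: cmean_def complex_eq_iff mean_add continuous_on_Re_Im)

lemma cmean_diff: "continuous_on K f \<Longrightarrow> continuous_on K g \<Longrightarrow> cmean (\<lambda>k. f k - g k) = cmean f - cmean g"
  by (simp add: cmean_def complex_eq_iff mean_diff continuous_on_Re_Im)

lemma cmean_cmult: "continuous_on K f \<Longrightarrow> cmean (\<lambda>k. c * f k) = c * cmean f"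
  by (simp add: cmean_def complex_eq_iff mean_add mean_diff mean_cmult continuous_on_Re_Im continuous_on_mult)

lemma cmean_of_real: "cmean (\<lambda>k. complex_of_real (f k)) = complex_of_real (mean f)"
  by (simp add: cmean_def complex_eq_iff mean_const)

lemma cmean_sum:
  "finite J \<Longrightarrow> (\<And>j. j \<in> J \<Longrightarrow> continuous_on K (f j)) \<Longrightarrow> cmean (\<lambda>k. \<Sum>j\<in>J. f j k) = (\<Sum>j\<in>J. cmean (f j))"
  by (induction J rule: finite_induct) (auto simp: cmean_const cmean_add continuous_on_sum)

lemma cmean_translate_left:
  "continuous_on K f \<Longrightarrow> k \<in> K \<Longrightarrow> cmean (\<lambda>l. f (k + l)) = cmean f"
  by (simp add: cmean_def mean_translate_left[of "\<lambda>l. Re (f l)"] mean_translate_left[of "\<lambda>l. Im (f l)"]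
      continuous_on_Re_Im)

text \<open>The factor 2 arises from estimating real and imaginary parts separately. It enters only
  an error that tends to zero; the norm bound of \<open>vector_integral\<close> is obtained from the
  Riemann sums themselves.\<close>

lemma norm_cmean_le:
  assumes "continuous_on K f" "\<And>k. k \<in> K \<Longrightarrow> norm (f k) \<le> e"
  shows "norm (cmean f) \<le> 2 * e"
proof -
  have "\<bar>mean (\<lambda>k. Re (f k)) - 0\<bar> \<le> e"
    using assms order_trans[OF abs_Re_le_cmod assms(2)] by (intro mean_close continuous_on_Re_Im) auto
  moreover have "\<bar>mean (\<lambda>k. Im (f k)) - 0\<bar> \<le> e"
    using assms order_trans[OF abs_Im_le_cmod assms(2)] by (intro mean_close continuous_on_Re_Im) auto
  ultimately show ?thesis using cmod_le[of "cmean f"] by (simp add: cmean_def)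
qed

text \<open>Continuity of \<open>\<phi>\<close> into the algebra, stated through \<open>N\<close>
  because the algebra is a set of functions and not a type.\<close>

definition norm_continuous :: "(('x \<Rightarrow> complex) \<Rightarrow> real) \<Rightarrow> ('g \<Rightarrow> 'x \<Rightarrow> complex) \<Rightarrow> bool" where
  "norm_continuous N \<phi> \<longleftrightarrow> (\<forall>k\<in>K. ((\<lambda>l. N (\<phi> l - \<phi> k)) \<longlongrightarrow> 0) (at k within K))"

lemma norm_continuous_apply:
  assumes "banach_function_algebra X A N" "norm_continuous N \<phi>" "\<And>k. k \<in> K \<Longrightarrow> \<phi> k \<in> A"
  shows "continuous_on K (\<lambda>k. \<phi> k x)"
  unfolding continuous_on_def
proof
  interpret banach_function_algebra X A N by (rule assms)
  fix k assume k: "k \<in> K"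
  have "((\<lambda>l. \<phi> l x - \<phi> k x) \<longlongrightarrow> 0) (at k within K)"
  proof (rule Lim_null_comparison)
    show "((\<lambda>l. N (\<phi> l - \<phi> k)) \<longlongrightarrow> 0) (at k within K)"
      using assms(2) k by (auto simp: norm_continuous_def)
    show "\<forall>\<^sub>F l in at k within K. norm (\<phi> l x - \<phi> k x) \<le> N (\<phi> l - \<phi> k)"
      using norm_apply_le[of "\<phi> _ - \<phi> k" x] k assms(3)
      by (auto simp: eventually_at_topological diff_closed intro!: exI[of _ UNIV])
  qed
  then show "((\<lambda>k. \<phi> k x) \<longlongrightarrow> \<phi> k x) (at k within K)" by (simp add: LIM_zero_iff)
qed

text \<open>The integral is the limit of Riemann sums along partitions of unity.\<close>

lemma vector_integral:
  assumes A: "banach_function_algebra X A N" and \<phi>: "norm_continuous N \<phi>"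
    and S: "cfun.subspace S" "S \<subseteq> A" "alg_closure A N S \<subseteq> S" "\<And>k. k \<in> K \<Longrightarrow> \<phi> k \<in> S"
    and \<beta>: "continuous_on K \<beta>" "\<And>k. k \<in> K \<Longrightarrow> N (\<phi> k) \<le> \<beta> k"
  shows "(\<lambda>x. cmean (\<lambda>k. \<phi> k x)) \<in> S" "N (\<lambda>x. cmean (\<lambda>k. \<phi> k x)) \<le> mean \<beta>"
proof -
  interpret banach_function_algebra X A N by (rule A)
  define v where "v = (\<lambda>x. cmean (\<lambda>k. \<phi> k x))"
  have \<phi>A: "\<phi> k \<in> A" if "k \<in> K" for k using S that by blast
  have c\<phi>: "continuous_on K (\<lambda>k. \<phi> k x)" for x by (rule norm_continuous_apply[OF A \<phi> \<phi>A])
  have ex: "\<exists>J u. finite J \<and> J \<subseteq> K \<and> (\<forall>j\<in>J. continuous_on K (u j)) \<and>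
      (\<forall>j\<in>J. \<forall>x\<in>K. 0 \<le> u j x \<and> (u j x \<noteq> 0 \<longrightarrow> N (\<phi> x - \<phi> j) \<le> e)) \<and> (\<forall>x\<in>K. (\<Sum>j\<in>J. u j x) = (1::real))"
    if "e > 0" for e
  proof -
    have "\<exists>U. open U \<and> k \<in> U \<and> (\<forall>l\<in>U \<inter> K. N (\<phi> l - \<phi> k) \<le> e)" if k: "k \<in> K" for k
    proof -
      have "\<forall>\<^sub>F l in at k within K. N (\<phi> l - \<phi> k) < e"
        using \<phi> k \<open>e > 0\<close> by (auto simp: norm_continuous_def intro: order_tendstoD)
      then obtain U where U: "open U" "k \<in> U" "\<forall>l\<in>U. l \<noteq> k \<longrightarrow> l \<in> K \<longrightarrow> N (\<phi> l - \<phi> k) < e"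
        by (auto simp: eventually_at_topological)
      have "N (\<phi> l - \<phi> k) \<le> e" if "l \<in> U \<inter> K" for l
        using U(3) that norm_0 \<open>e > 0\<close> by (cases "l = k") force+
      with U show ?thesis by blast
    qed
    then obtain U where U: "\<And>k. k \<in> K \<Longrightarrow> open (U k)" "\<And>k. k \<in> K \<Longrightarrow> k \<in> U k"
      "\<And>k l. k \<in> K \<Longrightarrow> l \<in> U k \<inter> K \<Longrightarrow> N (\<phi> l - \<phi> k) \<le> e"
      by metis
    obtain J u where "finite J" "J \<subseteq> K" "\<And>j. j \<in> J \<Longrightarrow> continuous_on K (u j)"
      "\<And>j x. j \<in> J \<Longrightarrow> x \<in> K \<Longrightarrow> 0 \<le> u j x" "\<And>x. x \<in> K \<Longrightarrow> (\<Sum>j\<in>J. u j x) = (1::real)"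
      "\<And>j x. j \<in> J \<Longrightarrow> x \<in> K \<Longrightarrow> x \<notin> U j \<Longrightarrow> u j x = 0"
      by (rule partition_of_unity[of U, OF U(1,2)]) (assumption | rule that)+
    with U(3) show ?thesis by (intro exI[of _ J] exI[of _ u]) blast
  qed
  define e where "e n = 1 / real (Suc n)" for n
  have e: "e n > 0" for n by (simp add: e_def)
  define P where "P J u d \<longleftrightarrow> finite J \<and> J \<subseteq> K \<and> (\<forall>j\<in>J. continuous_on K (u j)) \<and>
      (\<forall>j\<in>J. \<forall>x\<in>K. 0 \<le> u j x \<and> (u j x \<noteq> 0 \<longrightarrow> N (\<phi> x - \<phi> j) \<le> d)) \<and> (\<forall>x\<in>K. (\<Sum>j\<in>J. u j x) = (1::real))"
    for J u d
  have "\<exists>J u. P J u (e n)" for n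
    unfolding P_def by (rule ex[OF e])
  then obtain J u where "\<And>n. P (J n) (u n) (e n)" by metis
  then have J: "\<And>n. finite (J n)" "\<And>n. J n \<subseteq> K"
    and u: "\<And>n j. j \<in> J n \<Longrightarrow> continuous_on K (u n j)" "\<And>n j x. j \<in> J n \<Longrightarrow> x \<in> K \<Longrightarrow> 0 \<le> u n j x"
      "\<And>n j x. j \<in> J n \<Longrightarrow> x \<in> K \<Longrightarrow> u n j x \<noteq> 0 \<Longrightarrow> N (\<phi> x - \<phi> j) \<le> e n"
      "\<And>n x. x \<in> K \<Longrightarrow> (\<Sum>j\<in>J n. u n j x) = (1::real)"
    unfolding P_def by blast+
  define R where "R n = (\<Sum>j\<in>J n. (\<lambda>x. complex_of_real (mean (u n j)) * \<phi> j x))" for n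
  have RS: "R n \<in> S" for n
    unfolding R_def using J(2) by (intro cfun.subspace_sum[OF S(1)] cfun.subspace_scale[OF S(1)] S(4)) auto
  then have RA: "R n \<in> A" for n using S(2) by blast
  have Rx: "norm (v x - R n x) \<le> 2 * e n" for n x
  proof -
    have cu: "continuous_on K (\<lambda>k. complex_of_real (u n j k) * \<phi> j x)" if "j \<in> J n" for j
      using u(1)[OF that] by (intro continuous_intros)
    have "R n x = (\<Sum>j\<in>J n. cmean (\<lambda>k. complex_of_real (u n j k) * \<phi> j x))"
      unfolding R_def sum_fun_apply
    proof (intro sum.cong refl)
      fix j assume "j \<in> J n"
      then show "complex_of_real (mean (u n j)) * \<phi> j x = cmean (\<lambda>k. complex_of_real (u n j k) * \<phi> j x)"
        using cmean_cmult[of "\<lambda>k. complex_of_real (u n j k)" "\<phi> j x"] u(1)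
        by (simp add: cmean_of_real mult.commute continuous_on_of_real)
    qed
    also have "\<dots> = cmean (\<lambda>k. \<Sum>j\<in>J n. complex_of_real (u n j k) * \<phi> j x)"
      using cmean_sum[OF J(1), of n "\<lambda>j k. complex_of_real (u n j k) * \<phi> j x"] cu by simp
    finally have eq: "v x - R n x = cmean (\<lambda>k. \<phi> k x - (\<Sum>j\<in>J n. complex_of_real (u n j k) * \<phi> j x))"
      unfolding v_def using cu by (subst cmean_diff) (auto intro!: c\<phi> continuous_on_sum)
    have bnd: "norm (\<phi> k x - (\<Sum>j\<in>J n. complex_of_real (u n j k) * \<phi> j x)) \<le> e n" if k: "k \<in> K" for k
    proof -
      have "\<phi> k x = (\<Sum>j\<in>J n. complex_of_real (u n j k)) * \<phi> k x"
        using u(4)[OF k, of n] by (simp flip: of_real_sum)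
      then have "\<phi> k x - (\<Sum>j\<in>J n. complex_of_real (u n j k) * \<phi> j x)
          = (\<Sum>j\<in>J n. complex_of_real (u n j k) * (\<phi> k x - \<phi> j x))"
        by (simp add: sum_distrib_right sum_subtractf right_diff_distrib)
      also have "norm \<dots> \<le> (\<Sum>j\<in>J n. u n j k * e n)"
      proof (rule sum_norm_le)
        fix j assume j: "j \<in> J n"
        have "norm (\<phi> k x - \<phi> j x) \<le> e n" if "u n j k \<noteq> 0"
        proof -
          have "norm ((\<phi> k - \<phi> j) x) \<le> N (\<phi> k - \<phi> j)"
            using j k J(2) by (intro norm_apply_le diff_closed \<phi>A) auto
          with u(3)[OF j k that] show ?thesis by simp
        qed
        then show "norm (complex_of_real (u n j k) * (\<phi> k x - \<phi> j x)) \<le> u n j k * e n"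
          using u(2)[OF j k]
          by (cases "u n j k = 0") (auto simp: Real_Vector_Spaces.norm_mult intro: mult_left_mono)
      qed
      also have "\<dots> = e n" using u(4)[OF k, of n] by (simp flip: sum_distrib_right)
      finally show ?thesis .
    qed
    have "continuous_on K (\<lambda>k. \<phi> k x - (\<Sum>j\<in>J n. complex_of_real (u n j k) * \<phi> j x))"
      using cu by (intro continuous_on_diff c\<phi> continuous_on_sum) auto
    then show ?thesis unfolding eq by (rule norm_cmean_le) (rule bnd)
  qed
  have mean_u: "(\<Sum>j\<in>J n. mean (u n j)) = 1" for n
  proof -
    have "(\<Sum>j\<in>J n. mean (u n j)) = mean (\<lambda>x. \<Sum>j\<in>J n. u n j x)"
      using J(1) u(1) by (intro mean_sum[symmetric]) auto
    also have "\<dots> = mean (\<lambda>_. 1)" by (intro mean_cong u(4))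
    finally show ?thesis by (simp add: mean_const)
  qed
  have mean_uu: "(\<Sum>l\<in>J m. mean (\<lambda>x. u n j x * u m l x)) = mean (u n j)" if "j \<in> J n" for n m j
  proof -
    have "(\<Sum>l\<in>J m. mean (\<lambda>x. u n j x * u m l x)) = mean (\<lambda>x. \<Sum>l\<in>J m. u n j x * u m l x)"
      using J(1) u(1) that by (intro mean_sum[symmetric] continuous_on_mult) auto
    also have "\<dots> = mean (u n j)"
      by (intro mean_cong) (simp add: u(4) flip: sum_distrib_left)
    finally show ?thesis .
  qed
  \<comment> \<open>The two sums are compared on the common refinement by the functions
    \<open>u n j * u m l\<close>. The weight \<open>q j l\<close> vanishes unless both factors are
    nonzero at some \<open>x\<close> of \<open>K\<close>, and then \<open>\<phi> j\<close> and
    \<open>\<phi> l\<close> are both close to \<open>\<phi> x\<close>.\<close>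
  have Rd: "N (R n - R m) \<le> e n + e m" for n m
  proof -
    define q where "q j l = mean (\<lambda>x. u n j x * u m l x)" for j l
    have q_sum1: "(\<Sum>l\<in>J m. q j l) = mean (u n j)" if "j \<in> J n" for j
      using mean_uu[OF that] by (simp add: q_def)
    have q_sum2: "(\<Sum>j\<in>J n. q j l) = mean (u m l)" if "l \<in> J m" for l
      using mean_uu[OF that, of n] by (simp add: q_def mult.commute)
    have "R n = (\<Sum>j\<in>J n. \<Sum>l\<in>J m. (\<lambda>x. complex_of_real (q j l) * \<phi> j x))"
      unfolding R_def
      by (intro sum.cong refl ext) (simp add: sum_fun_apply q_sum1[symmetric] sum_distrib_right)
    moreover have "R m = (\<Sum>j\<in>J n. \<Sum>l\<in>J m. (\<lambda>x. complex_of_real (q j l) * \<phi> l x))"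
      unfolding R_def
      by (subst sum.swap, intro sum.cong refl ext)
        (simp add: sum_fun_apply q_sum2[symmetric] sum_distrib_right)
    ultimately have eq: "R n - R m = (\<Sum>j\<in>J n. \<Sum>l\<in>J m. (\<lambda>x. complex_of_real (q j l) * (\<phi> j - \<phi> l) x))"
      by (auto simp: fun_eq_iff sum_fun_apply sum_subtractf[symmetric] right_diff_distrib)
    have "N (R n - R m) \<le> (\<Sum>j\<in>J n. \<Sum>l\<in>J m. q j l * (e n + e m))"
    proof -
      have A1: "(\<lambda>x. complex_of_real (q j l) * (\<phi> j - \<phi> l) x) \<in> A" if "j \<in> J n" "l \<in> J m" for j l
        using that J(2) by (intro scale_closed diff_closed \<phi>A) auto
      have "N (\<lambda>x. complex_of_real (q j l) * (\<phi> j - \<phi> l) x) \<le> q j l * (e n + e m)"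
        if j: "j \<in> J n" and l: "l \<in> J m" for j l
      proof -
        have jA: "\<phi> j \<in> A" "\<phi> l \<in> A" using j l J(2) \<phi>A by auto
        have cq: "continuous_on K (\<lambda>x. u n j x * u m l x)" using u(1) j l by (intro continuous_on_mult)
        have q0: "0 \<le> q j l" unfolding q_def using u(2) j l by (intro mean_nonneg cq) auto
        have "q j l = 0 \<or> N (\<phi> j - \<phi> l) \<le> e n + e m"
        proof (cases "\<exists>x\<in>K. u n j x * u m l x \<noteq> 0")
          case True
          then obtain x where x: "x \<in> K" "u n j x \<noteq> 0" "u m l x \<noteq> 0" by auto
          have "N (\<phi> j - \<phi> l) \<le> N (\<phi> j - \<phi> x) + N (\<phi> x - \<phi> l)"
            by (intro norm_diff_triangle jA \<phi>A x)
          then show ?thesis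
            using u(3)[OF j x(1,2)] u(3)[OF l x(1,3)] norm_minus_commute[OF jA(1) \<phi>A[OF x(1)]] by simp
        next
          case False
          then have "q j l = mean (\<lambda>_. 0)" unfolding q_def by (intro mean_cong) auto
          then show ?thesis by (simp add: mean_const)
        qed
        then show ?thesis
          using q0 norm_scale[OF diff_closed[OF jA], of "complex_of_real (q j l)"]
          by (auto intro: mult_left_mono)
      qed
      then show ?thesis
        unfolding eq using A1
        by (intro order_trans[OF norm_sum_le] sum_mono sum_closed order_trans[OF norm_sum_le]) auto
    qed
    also have "\<dots> = e n + e m"
      using mean_u[of n] q_sum1 by (simp flip: sum_distrib_right)
    finally show ?thesis .
  qed
  have small: "\<exists>n0. \<forall>n\<ge>n0. e n < d" if d: "d > 0" for d
  proof -
    obtain n0 where n0: "1 / real (Suc n0) < d" using nat_approx_posE[OF d] by metis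
    have "1 / real (Suc n) \<le> 1 / real (Suc n0)" if "n \<ge> n0" for n
      using that by (intro divide_left_mono) auto
    with n0 show ?thesis unfolding e_def by (intro exI[of _ n0]) (auto intro: le_less_trans)
  qed
  have "\<exists>n0. \<forall>m\<ge>n0. \<forall>n\<ge>n0. N (R m - R n) < d" if "d > 0" for d
  proof -
    have "d / 2 > 0" using \<open>d > 0\<close> by simp
    from small[OF this] obtain n0 where n0: "\<And>n. n \<ge> n0 \<Longrightarrow> e n < d / 2" by blast
    have "N (R m - R n) < d" if "m \<ge> n0" "n \<ge> n0" for m n
      using Rd[of m n] n0[OF that(1)] n0[OF that(2)] by simp
    then show ?thesis by blast
  qed
  from cauchy_limit[OF RA this] obtain w where w: "w \<in> A" "\<And>d. d > 0 \<Longrightarrow> \<exists>n0. \<forall>n\<ge>n0. N (R n - w) < d"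
    by blast
  \<comment> \<open>The norm limit \<open>w\<close> agrees with the pointwise integral, because
    evaluation is bounded by the norm.\<close>
  have "v x = w x" for x
  proof -
    have "norm (v x - w x) \<le> 0"
    proof (rule field_le_epsilon)
      fix d :: real assume "d > 0"
      obtain n1 where n1: "\<And>n. n \<ge> n1 \<Longrightarrow> e n < d / 4" using small[of "d / 4"] \<open>d > 0\<close> by auto
      obtain n2 where n2: "\<And>n. n \<ge> n2 \<Longrightarrow> N (R n - w) < d / 2" using w(2)[of "d / 2"] \<open>d > 0\<close> by auto
      define n where "n = max n1 n2"
      have "norm ((R n - w) x) \<le> N (R n - w)" by (intro norm_apply_le diff_closed RA w)
      moreover have "e n < d / 4" "N (R n - w) < d / 2" using n1 n2 by (simp_all add: n_def)
      moreover have "norm (v x - w x) \<le> norm (v x - R n x) + norm (R n x - w x)"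
        using norm_triangle_ineq[of "v x - R n x" "R n x - w x"] by simp
      ultimately show "norm (v x - w x) \<le> 0 + d" using Rx[of x n] by simp
    qed
    then show ?thesis by simp
  qed
  then have vw: "v = w" by auto
  have "w \<in> alg_closure A N S"
  proof (rule closureI[OF w(1)])
    fix d :: real assume "d > 0"
    from w(2)[OF this] obtain n where "N (R n - w) < d" by blast
    then show "\<exists>g\<in>S. g \<in> A \<and> N (w - g) < d"
      using RS RA norm_minus_commute[OF RA w(1)] by (intro bexI[of _ "R n"]) auto
  qed
  then show "(\<lambda>x. cmean (\<lambda>k. \<phi> k x)) \<in> S" using S(3) vw by (auto simp: v_def)
  \<comment> \<open>Where \<open>u n j x\<close> is nonzero,
    \<open>N (\<phi> j) \<le> \<beta> x + e n\<close>. Integrating this against the partition of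
    unity keeps the variable majorant \<open>\<beta>\<close>, which a bound by the supremum would
    lose.\<close>
  have Rn: "N (R n) \<le> mean \<beta> + e n" for n
  proof -
    have "N (R n) \<le> (\<Sum>j\<in>J n. N (\<lambda>x. complex_of_real (mean (u n j)) * \<phi> j x))"
      unfolding R_def using J(2) by (intro norm_sum_le scale_closed \<phi>A) auto
    also have "\<dots> \<le> (\<Sum>j\<in>J n. mean (\<lambda>x. u n j x * (\<beta> x + e n)))"
    proof (rule sum_mono)
      fix j assume j: "j \<in> J n"
      have jA: "\<phi> j \<in> A" using j J(2) \<phi>A by auto
      have "0 \<le> mean (u n j)" using u(1,2) j by (intro mean_nonneg) auto
      then have "N (\<lambda>x. complex_of_real (mean (u n j)) * \<phi> j x) = mean (\<lambda>x. u n j x * N (\<phi> j))"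
        using norm_scale[OF jA, of "complex_of_real (mean (u n j))"] mean_cmult[OF u(1)[OF j], of "N (\<phi> j)"]
        by (simp add: mult.commute)
      also have "\<dots> \<le> mean (\<lambda>x. u n j x * (\<beta> x + e n))"
      proof (intro mean_mono continuous_intros u(1)[OF j] \<beta>(1))
        fix x assume x: "x \<in> K"
        have "N (\<phi> j) \<le> \<beta> x + e n" if "u n j x \<noteq> 0"
        proof -
          have "N (\<phi> j - 0) \<le> N (\<phi> j - \<phi> x) + N (\<phi> x - 0)"
            by (intro norm_diff_triangle jA \<phi>A x zero_closed)
          then show ?thesis
            using u(3)[OF j x that] \<beta>(2)[OF x] norm_minus_commute[OF jA \<phi>A[OF x]] by simp
        qed
        then show "u n j x * N (\<phi> j) \<le> u n j x * (\<beta> x + e n)"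
          using u(2)[OF j x] by (cases "u n j x = 0") (auto intro: mult_left_mono)
      qed
      finally show "N (\<lambda>x. complex_of_real (mean (u n j)) * \<phi> j x) \<le> mean (\<lambda>x. u n j x * (\<beta> x + e n))" .
    qed
    also have "\<dots> = mean (\<lambda>x. \<Sum>j\<in>J n. u n j x * (\<beta> x + e n))"
      using J(1) u(1) \<beta>(1) by (intro mean_sum[symmetric] continuous_intros) auto
    also have "\<dots> = mean (\<lambda>x. \<beta> x + e n)"
      by (intro mean_cong) (simp add: u(4) flip: sum_distrib_right)
    also have "\<dots> = mean \<beta> + e n" by (simp add: mean_add \<beta>(1) mean_const)
    finally show ?thesis .
  qed
  show "N (\<lambda>x. cmean (\<lambda>k. \<phi> k x)) \<le> mean \<beta>"
    unfolding v_def[symmetric] vw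
  proof (rule field_le_epsilon)
    fix d :: real assume "d > 0"
    obtain n1 where n1: "\<And>n. n \<ge> n1 \<Longrightarrow> e n < d / 2" using small[of "d / 2"] \<open>d > 0\<close> by auto
    obtain n2 where n2: "\<And>n. n \<ge> n2 \<Longrightarrow> N (R n - w) < d / 2" using w(2)[of "d / 2"] \<open>d > 0\<close> by auto
    define n where "n = max n1 n2"
    have "N (w - 0) \<le> N (w - R n) + N (R n - 0)" by (intro norm_diff_triangle w RA zero_closed)
    moreover have "e n < d / 2" "N (R n - w) < d / 2" using n1 n2 by (simp_all add: n_def)
    ultimately show "N w \<le> mean \<beta> + d"
      using Rn[of n] norm_minus_commute[OF w(1) RA[of n]] by simp
  qed
qed

end

section \<open>Averaging over a subgroup\<close>

context compact_subgroup
begin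

lemma norm_continuous_scale:
  assumes A: "normed_function_algebra X A N" and \<psi>: "norm_continuous N \<psi>" "\<And>k. k \<in> K \<Longrightarrow> \<psi> k \<in> A"
    and w: "continuous_on K w"
  shows "norm_continuous N (\<lambda>k x. w k * \<psi> k x)"
  unfolding norm_continuous_def
proof
  interpret normed_function_algebra X A N by (rule A)
  fix k assume k: "k \<in> K"
  have nc: "((\<lambda>l. N (\<psi> l - \<psi> k)) \<longlongrightarrow> 0) (at k within K)"
    using \<psi>(1) k by (auto simp: norm_continuous_def)
  have wk: "(w \<longlongrightarrow> w k) (at k within K)" using w k by (auto simp: continuous_on_def)
  have "((\<lambda>l. norm (w l) * N (\<psi> l - \<psi> k) + norm (w l - w k) * N (\<psi> k)) \<longlongrightarrow> norm (w k) * 0 + norm (w k - w k) * N (\<psi> k)) (at k within K)"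
    by (intro tendsto_intros wk nc)
  then have lim: "((\<lambda>l. norm (w l) * N (\<psi> l - \<psi> k) + norm (w l - w k) * N (\<psi> k)) \<longlongrightarrow> 0) (at k within K)"
    by simp
  have bound: "norm (N ((\<lambda>x. w l * \<psi> l x) - (\<lambda>x. w k * \<psi> k x)))
      \<le> norm (w l) * N (\<psi> l - \<psi> k) + norm (w l - w k) * N (\<psi> k)" if l: "l \<in> K" for l
  proof -
    have lk: "\<psi> l \<in> A" "\<psi> k \<in> A" using \<psi>(2) l k by auto
    have eq: "(\<lambda>x. w l * \<psi> l x) - (\<lambda>x. w k * \<psi> k x)
        = (\<lambda>x. w l * (\<psi> l - \<psi> k) x) + (\<lambda>x. (w l - w k) * \<psi> k x)"
      by (rule ext) (simp add: algebra_simps)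
    have "N ((\<lambda>x. w l * \<psi> l x) - (\<lambda>x. w k * \<psi> k x))
        \<le> N (\<lambda>x. w l * (\<psi> l - \<psi> k) x) + N (\<lambda>x. (w l - w k) * \<psi> k x)"
      unfolding eq by (intro norm_triangle scale_closed diff_closed lk)
    also have "N (\<lambda>x. w l * (\<psi> l - \<psi> k) x) = norm (w l) * N (\<psi> l - \<psi> k)"
      by (intro norm_scale diff_closed lk)
    also have "N (\<lambda>x. (w l - w k) * \<psi> k x) = norm (w l - w k) * N (\<psi> k)"
      by (intro norm_scale lk)
    finally have "N ((\<lambda>x. w l * \<psi> l x) - (\<lambda>x. w k * \<psi> k x))
        \<le> norm (w l) * N (\<psi> l - \<psi> k) + norm (w l - w k) * N (\<psi> k)" .
    moreover have "0 \<le> N ((\<lambda>x. w l * \<psi> l x) - (\<lambda>x. w k * \<psi> k x))"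
      by (intro norm_nonneg diff_closed scale_closed lk)
    ultimately show ?thesis by (simp only: real_norm_def abs_of_nonneg)
  qed
  show "((\<lambda>l. N ((\<lambda>x. w l * \<psi> l x) - (\<lambda>x. w k * \<psi> k x))) \<longlongrightarrow> 0) (at k within K)"
    by (rule Lim_null_comparison[OF _ lim], unfold eventually_at_topological, rule exI[of _ UNIV])
      (intro conjI ballI impI open_UNIV UNIV_I bound)
qed

lemma norm_continuous_diff:
  assumes A: "normed_function_algebra X A N"
    and \<phi>: "norm_continuous N \<phi>" "\<And>k. k \<in> K \<Longrightarrow> \<phi> k \<in> A"
    and \<psi>: "norm_continuous N \<psi>" "\<And>k. k \<in> K \<Longrightarrow> \<psi> k \<in> A"
  shows "norm_continuous N (\<lambda>k. \<phi> k - \<psi> k)"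
  unfolding norm_continuous_def
proof
  interpret normed_function_algebra X A N by (rule A)
  fix k assume k: "k \<in> K"
  have "((\<lambda>l. N (\<phi> l - \<phi> k) + N (\<psi> l - \<psi> k)) \<longlongrightarrow> 0 + 0) (at k within K)"
    using \<phi>(1) \<psi>(1) k by (intro tendsto_add) (auto simp: norm_continuous_def)
  then have lim: "((\<lambda>l. N (\<phi> l - \<phi> k) + N (\<psi> l - \<psi> k)) \<longlongrightarrow> 0) (at k within K)" by simp
  have bound: "norm (N (\<phi> l - \<psi> l - (\<phi> k - \<psi> k))) \<le> N (\<phi> l - \<phi> k) + N (\<psi> l - \<psi> k)"
    if l: "l \<in> K" for l
  proof -
    have lk: "\<phi> l \<in> A" "\<phi> k \<in> A" "\<psi> l \<in> A" "\<psi> k \<in> A" using \<phi>(2) \<psi>(2) l k by auto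
    have eq: "\<phi> l - \<psi> l - (\<phi> k - \<psi> k) = (\<phi> l - \<phi> k) + (\<psi> k - \<psi> l)"
      by (rule ext) simp
    have "N (\<phi> l - \<psi> l - (\<phi> k - \<psi> k)) \<le> N (\<phi> l - \<phi> k) + N (\<psi> k - \<psi> l)"
      unfolding eq by (intro norm_triangle diff_closed lk)
    also have "N (\<psi> k - \<psi> l) = N (\<psi> l - \<psi> k)" by (intro norm_minus_commute lk)
    finally have "N (\<phi> l - \<psi> l - (\<phi> k - \<psi> k)) \<le> N (\<phi> l - \<phi> k) + N (\<psi> l - \<psi> k)" .
    moreover have "0 \<le> N (\<phi> l - \<psi> l - (\<phi> k - \<psi> k))"
      by (intro norm_nonneg diff_closed lk)
    ultimately show ?thesis by (simp only: real_norm_def abs_of_nonneg)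
  qed
  show "((\<lambda>l. N (\<phi> l - \<psi> l - (\<phi> k - \<psi> k))) \<longlongrightarrow> 0) (at k within K)"
    by (rule Lim_null_comparison[OF _ lim], unfold eventually_at_topological, rule exI[of _ UNIV])
      (intro conjI ballI impI open_UNIV UNIV_I bound)
qed

end

definition products :: "('x \<Rightarrow> complex) set \<Rightarrow> nat \<Rightarrow> ('x \<Rightarrow> complex) set" where
  "products I d = {(\<Prod>i<d. f i) | f. \<forall>i<d. f i \<in> I}"

section \<open>Algebras with isometric right translations, and their unit\<close>

locale translation_algebra =
  regular_banach_function_algebra "euclidean :: 'g::{topological_group_add,t2_space} topology" A N
  for A N +
  fixes K :: "'g set"
  assumes compact_UNIV: "compact (UNIV :: 'g set)"
    and K_subgroup: "is_subgroup K" and K_closed: "closed K"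
    and transl: "f \<in> A \<Longrightarrow> right_transl s f \<in> A"
    and norm_transl: "f \<in> A \<Longrightarrow> N (right_transl s f) = N f"
    and continuous_transl: "f \<in> A \<Longrightarrow> continuous_map euclidean (alg_topology A N) (\<lambda>s. right_transl s f)"
    and trig_polys_mult: "h \<in> trig_polys \<Longrightarrow> f \<in> A \<Longrightarrow> h * f \<in> A"
begin

lemma compact_group: "compact_group TYPE('g)"
  by unfold_locales (auto simp: is_subgroup_def compact_UNIV)

sublocale G: compact_subgroup "UNIV :: 'g set"
  by unfold_locales (auto simp: is_subgroup_def compact_UNIV)

sublocale H: compact_subgroup K
  using compact_Int_closed[OF compact_UNIV K_closed] by unfold_locales (auto simp: K_subgroup)

abbreviation B :: "('g \<Rightarrow> complex) set" where
  "B \<equiv> inv_alg K A"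

lemma banach: "banach_function_algebra euclidean A N"
  by unfold_locales

lemma normed: "normed_function_algebra euclidean A N"
  by unfold_locales

lemma mem_continuous: "f \<in> A \<Longrightarrow> continuous_on UNIV f"
  using subset_C0 by (auto simp: C0_def)

lemma tendsto_transl:
  assumes f: "f \<in> A"
  shows "((\<lambda>t. N (right_transl t f - right_transl s f)) \<longlongrightarrow> 0) (at s within S)"
proof (rule tendstoI)
  fix e :: real assume e: "e > 0"
  have "openin mtopology (mball (right_transl s f) e)" by (rule openin_mball)
  then have "openin euclidean {t \<in> topspace euclidean. right_transl t f \<in> mball (right_transl s f) e}"
    using continuous_transl[OF f] unfolding alg_topology_def by (rule openin_continuous_map_preimage[rotated])
  then have op: "open {t. right_transl t f \<in> mball (right_transl s f) e}" by simp
  have mem: "s \<in> {t. right_transl t f \<in> mball (right_transl s f) e}"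
    using e by (simp add: transl f)
  have "dist (N (right_transl t f - right_transl s f)) 0 < e"
    if "right_transl t f \<in> mball (right_transl s f) e" for t
  proof -
    have A2: "right_transl t f \<in> A" "right_transl s f \<in> A" by (intro transl f)+
    have "N (right_transl s f - right_transl t f) < e"
      using that A2 by (auto simp: alg_dist_def)
    then show ?thesis
      using norm_minus_commute[OF A2] norm_nonneg[OF diff_closed[OF A2]]
      by (simp only: dist_real_def)
  qed
  with op mem show "\<forall>\<^sub>F t in at s within S. dist (N (right_transl t f - right_transl s f)) 0 < e"
    unfolding eventually_at_topological by blast
qed

lemma norm_continuous_transl:
  "f \<in> A \<Longrightarrow> G.norm_continuous N (\<lambda>k. right_transl k f)"
  "f \<in> A \<Longrightarrow> H.norm_continuous N (\<lambda>k. right_transl k f)"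
  by (auto simp: G.norm_continuous_def H.norm_continuous_def tendsto_transl)

text \<open>Averaging \<open>h * f\<close> over the group, with \<open>h\<close> a trigonometric polynomial close to \<open>Re f\<close>, gives
  a nonzero constant in the algebra.\<close>

lemma one_mem: "1 \<in> A"
proof -
  obtain f where f: "f \<in> A" "f 0 = 1" using regular[of "{}" 0] by auto
  have cf: "continuous_on UNIV f" by (rule mem_continuous[OF f(1)])
  have cr: "continuous_on UNIV (\<lambda>x. Re (f x))" using cf by (intro continuous_intros)
  have crr: "continuous_on UNIV (\<lambda>x. Re (f x) * Re (f x))" by (rule continuous_on_mult[OF cr cr])
  define m where "m = G.mean (\<lambda>x. Re (f x) * Re (f x))"
  have m: "m > 0"
    unfolding m_def by (rule G.mean_pos[of _ 0]) (use f crr in auto)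
  have C: "\<bar>Re (f x)\<bar> \<le> N f" for x
    using order_trans[OF abs_Re_le_cmod norm_apply_le[OF f(1)]] .
  have Nf: "N f \<ge> 1" using C[of 0] f by simp
  \<comment> \<open>Replacing one factor \<open>Re f\<close> by \<open>h'\<close> in the mean
    \<open>m\<close> of \<open>(Re f)\<^sup>2\<close> then costs at most
    \<open>e * N f = m / 2\<close>, so the constant obtained has positive real part.\<close>
  define e where "e = m / (2 * N f)"
  have e: "e > 0" using m Nf by (simp add: e_def)
  obtain n \<rho> c where \<rho>: "compact_group.orthogonal_rep n \<rho>"
    and h: "\<And>x. \<bar>Re (f x) - (\<Sum>i<n. \<Sum>j<n. c i j * \<rho> i j x)\<bar> < e"
    by (rule compact_group.orthogonal_rep_dense[OF compact_group cr e]) (rule that)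
  define h' where "h' x = (\<Sum>i<n. \<Sum>j<n. c i j * \<rho> i j x)" for x
  have ch: "continuous_on UNIV h'"
    using \<rho> unfolding h'_def compact_group.orthogonal_rep_def[OF compact_group]
    by (intro continuous_intros) auto
  define H where "H = (\<lambda>x. complex_of_real (h' x))"
  have "H = (\<Sum>i<n. \<Sum>j<n. (\<lambda>x. complex_of_real (c i j) * complex_of_real (\<rho> i j x)))"
    by (rule ext) (simp add: H_def h'_def sum_fun_apply)
  moreover have "\<dots> \<in> trig_polys"
    unfolding trig_polys_def
    using compact_group.orthogonal_rep_trig_polys[OF compact_group \<rho>, unfolded trig_polys_def]
    by (intro cfun.span_sum cfun.span_scale) auto
  ultimately have "H \<in> trig_polys" by simp
  then have Hf: "H * f \<in> A" using f(1) by (rule trig_polys_mult)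
  have "(\<lambda>x. G.cmean (\<lambda>k. right_transl k (H * f) x)) \<in> A"
  proof (rule G.vector_integral(1)[OF banach norm_continuous_transl(1)[OF Hf] subspace])
    show "cl A \<subseteq> A" by (rule closure_subset)
    show "N (right_transl k (H * f)) \<le> N (H * f)" for k
      using norm_transl[OF Hf] by (rule eq_refl)
  qed (auto intro: transl Hf)
  moreover define z where "z = G.cmean (H * f)"
  \<comment> \<open>As a function of \<open>x\<close> the average over all right translates is the
    mean of a left translate, hence constant.\<close>
  have "G.cmean (\<lambda>k. right_transl k (H * f) x) = z" for x
    using G.cmean_translate_left[of "H * f" x] mem_continuous[OF Hf]
    by (simp add: right_transl_def z_def)
  ultimately have zA: "(\<lambda>_. z) \<in> A" by simp
  have "Re z = G.mean (\<lambda>x. h' x * Re (f x))"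
    by (simp add: z_def G.cmean_def H_def)
  have ch': "continuous_on UNIV (\<lambda>x. h' x * Re (f x))" by (intro continuous_intros ch cr)
  have "\<bar>G.mean (\<lambda>x. h' x * Re (f x) - Re (f x) * Re (f x)) - 0\<bar> \<le> m / 2"
  proof (rule G.mean_close)
    show "continuous_on UNIV (\<lambda>x. h' x * Re (f x) - Re (f x) * Re (f x))"
      by (intro continuous_on_diff ch' crr)
    fix x
    have "\<bar>(h' x - Re (f x)) * Re (f x)\<bar> \<le> e * N f"
      unfolding abs_mult using h[of x] C[of x] e
      by (intro mult_mono) (auto simp: h'_def abs_minus_commute)
    also have "e * N f = m / 2" using Nf by (simp add: e_def)
    finally show "\<bar>h' x * Re (f x) - Re (f x) * Re (f x) - 0\<bar> \<le> m / 2"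
      by (simp add: left_diff_distrib)
  qed
  then have "\<bar>Re z - m\<bar> \<le> m / 2"
    using G.mean_diff[OF ch' crr] \<open>Re z = _\<close> by (simp add: m_def)
  then have "Re z > 0" using m unfolding abs_le_iff by linarith
  then have "z \<noteq> 0" by auto
  then show "1 \<in> A" using scale_closed[OF zA, of "inverse z"] by (simp add: one_fun_def)
qed

lemma trig_polys_subset: "trig_polys \<subseteq> A"
  using trig_polys_mult[OF _ one_mem] by auto

section \<open>Averaging as a projection onto the invariant functions\<close>

definition average :: "('g \<Rightarrow> complex) \<Rightarrow> 'g \<Rightarrow> complex" where
  "average f = (\<lambda>s. H.cmean (\<lambda>k. f (s + k)))"

lemma continuous_on_section: "f \<in> A \<Longrightarrow> continuous_on S (\<lambda>k. f (s + k))"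
  by (rule continuous_on_compose2[OF mem_continuous]) (auto intro!: continuous_intros)

definition invariant_ideal :: "('g \<Rightarrow> complex) set \<Rightarrow> bool" where
  "invariant_ideal S \<longleftrightarrow> cfun.subspace S \<and> S \<subseteq> A \<and> (\<forall>a\<in>A. \<forall>f\<in>S. a * f \<in> S) \<and>
     (\<forall>k\<in>K. \<forall>f\<in>S. right_transl k f \<in> S)"

text \<open>The average is the integral of \<open>right_transl k f\<close> over \<open>K\<close>.
  Invariance of \<open>S\<close> keeps the integrand in \<open>S\<close>, and closedness keeps the
  integral there.\<close>

lemma
  assumes "f \<in> A"
  shows average_mem: "average f \<in> A" and norm_average_le: "N (average f) \<le> N f"
    and average_mem_closed: "\<And>S. invariant_ideal S \<Longrightarrow> cl S \<subseteq> S \<Longrightarrow> f \<in> S \<Longrightarrow> average f \<in> S"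
proof -
  have eq: "average f = (\<lambda>x. H.cmean (\<lambda>k. right_transl k f x))"
    by (simp add: average_def right_transl_def)
  have bound: "N (right_transl k f) \<le> N f" for k using norm_transl[OF assms] by (rule eq_refl)
  note vi = H.vector_integral[OF banach norm_continuous_transl(2)[OF assms], of _ "\<lambda>_. N f"]
  show "average f \<in> A"
    unfolding eq by (rule vi(1)[OF subspace]) (auto intro: transl assms bound closure_subset[THEN subsetD])
  have "N (average f) \<le> H.mean (\<lambda>_. N f)"
    unfolding eq by (rule vi(2)[OF subspace]) (auto intro: transl assms bound closure_subset[THEN subsetD])
  then show "N (average f) \<le> N f" by (simp add: H.mean_const)
  show "average f \<in> S" if "invariant_ideal S" "cl S \<subseteq> S" "f \<in> S" for S
    unfolding eq by (rule vi(1)[of S]) (use that bound in \<open>auto simp: invariant_ideal_def\<close>)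
qed

lemma average_inv_alg:
  assumes f: "f \<in> A"
  shows "average f \<in> B"
proof -
  have "H.cmean (\<lambda>l. f (s + k + l)) = H.cmean (\<lambda>l. f (s + l))" if "k \<in> K" for k s
    using H.cmean_translate_left[OF continuous_on_section[OF f] that, of s] by (simp add: add.assoc)
  with average_mem[OF f] show ?thesis
    by (auto simp: inv_alg_def right_transl_def average_def)
qed

lemma inv_algD: "f \<in> B \<Longrightarrow> k \<in> K \<Longrightarrow> f (s + k) = f s"
  by (auto simp: inv_alg_def right_transl_def fun_eq_iff)

lemma inv_alg_subset: "B \<subseteq> A"
  by (auto simp: inv_alg_def)

lemma average_fixed: "f \<in> B \<Longrightarrow> average f = f"
proof
  fix s assume f: "f \<in> B"
  have "average f s = H.cmean (\<lambda>_. f s)"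
    unfolding average_def by (intro H.cmean_cong inv_algD f)
  then show "average f s = f s" by (simp add: H.cmean_const)
qed

text \<open>Invariant factors are constant on each coset and come out of the mean: averaging is
  linear over \<open>B\<close>, like a conditional expectation.\<close>

lemma average_mult:
  assumes "a \<in> A" "b \<in> B"
  shows "average (a * b) = average a * b"
proof
  fix s
  have "average (a * b) s = H.cmean (\<lambda>k. b s * a (s + k))"
    unfolding average_def using assms by (intro H.cmean_cong) (simp add: inv_algD)
  also have "\<dots> = b s * average a s"
    unfolding average_def by (intro H.cmean_cmult continuous_on_section assms)
  finally show "average (a * b) s = (average a * b) s" by simp
qed

lemma average_add: "f \<in> A \<Longrightarrow> g \<in> A \<Longrightarrow> average (f + g) = average f + average g"
  by (rule ext) (simp add: average_def H.cmean_add continuous_on_section)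

lemma average_diff: "f \<in> A \<Longrightarrow> g \<in> A \<Longrightarrow> average (f - g) = average f - average g"
  by (rule ext) (simp add: average_def H.cmean_diff continuous_on_section)

lemma average_scale: "f \<in> A \<Longrightarrow> average (\<lambda>x. c * f x) = (\<lambda>x. c * average f x)"
  by (rule ext) (simp add: average_def H.cmean_cmult continuous_on_section)

lemma average_lipschitz: "f \<in> A \<Longrightarrow> g \<in> A \<Longrightarrow> N (average f - average g) \<le> 1 * N (f - g)"
  using norm_average_le[OF diff_closed[of f g]] by (simp only: average_diff mult_1)

text \<open>\<open>f\<close> is close to the average of \<open>h k * f (s + k)\<close>, where \<open>h\<close> is a trigonometric polynomial
  close to an approximate identity on \<open>K\<close>. Writing \<open>h k\<close> in terms of matrix entries at \<open>s\<close> and at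
  \<open>s + k\<close> turns that average into a combination of right \<open>K\<close>-invariant functions.\<close>

lemma invariant_ideal_generated:
  assumes S: "invariant_ideal S" "cl S \<subseteq> S" and f: "f \<in> S"
  shows "f \<in> cl (cfun.span {a * b | a b. a \<in> A \<and> b \<in> S \<inter> B})"
proof (rule closureI)
  have SA: "S \<subseteq> A" and Sideal: "\<And>a g. a \<in> A \<Longrightarrow> g \<in> S \<Longrightarrow> a * g \<in> S"
    using S(1) by (auto simp: invariant_ideal_def)
  show fA: "f \<in> A" using f SA by blast
  fix e :: real assume e: "e > 0"
  \<comment> \<open>The final error is the mean of \<open>\<beta>\<close>, namely
    \<open>d * (1 + N f) = e / 2\<close>.\<close>
  define d where "d = e / (2 * (1 + N f))"
  have Nf: "1 + N f > 0" using norm_nonneg[OF fA] by simp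
  have d: "d > 0" using e Nf by (simp add: d_def)
  have t0: "right_transl 0 f = f" by (simp add: right_transl_def)
  have "\<forall>\<^sub>F t in at 0. N (right_transl t f - right_transl 0 f) < d"
    using tendsto_transl[OF fA, of 0 UNIV] d by (rule order_tendstoD)
  then obtain V where V: "open V" "0 \<in> V" "\<And>t. t \<in> V \<Longrightarrow> t \<noteq> 0 \<Longrightarrow> N (right_transl t f - f) < d"
    unfolding eventually_at_topological t0 by blast
  have Vd: "N (f - right_transl t f) \<le> d" if "t \<in> V" for t
  proof (cases "t = 0")
    case True
    have "f - f = 0" by simp
    then show ?thesis using d by (simp only: True t0 norm_0)
  next
    case False
    with V(3)[OF that] norm_minus_commute[OF fA transl[OF fA], of t] show ?thesis by linarith
  qed
  have "closed (- V)" "0 \<in> UNIV - (- V)" using V by (auto simp: closed_Compl)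
  then obtain u :: "'g \<Rightarrow> real" where u: "continuous_on UNIV u" "u 0 = 1"
    "\<And>y. y \<in> UNIV \<Longrightarrow> y \<in> - V \<Longrightarrow> u y = 0" "\<And>y. y \<in> UNIV \<Longrightarrow> 0 \<le> u y"
    by (rule G.continuous_bump) (rule that)
  \<comment> \<open>The normalisation is over \<open>K\<close>, where the average is taken, although
    \<open>u\<close> lives on the whole group, where the approximation by matrix entries takes
    place.\<close>
  define c where "c = H.mean u"
  have c: "c > 0"
    unfolding c_def by (rule H.mean_pos[of _ 0]) (use u H.zero_mem in auto)
  define w where "w x = u x / c" for x
  have w: "continuous_on UNIV w" "\<And>y. y \<notin> V \<Longrightarrow> w y = 0" "\<And>y. 0 \<le> w y"
    using u c by (auto simp: w_def intro!: continuous_intros)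
  have wK: "continuous_on K w" using w(1) continuous_on_subset by blast
  have weq: "w = (\<lambda>x. 1 / c * u x)" by (rule ext) (simp add: w_def)
  have "H.mean w = 1 / c * H.mean u"
    unfolding weq by (rule H.mean_cmult) (rule continuous_on_subset[OF u(1)], simp)
  then have mw: "H.mean w = 1" using c by (simp add: c_def)
  obtain n \<rho> q where \<rho>: "compact_group.orthogonal_rep n \<rho>"
    and h: "\<And>x. \<bar>w x - (\<Sum>i<n. \<Sum>j<n. q i j * \<rho> i j x)\<bar> < d"
    by (rule compact_group.orthogonal_rep_dense[OF compact_group w(1) d]) (rule that)
  define r where "r i j x = complex_of_real (\<rho> i j x)" for i j x
  have rA: "r i j \<in> A" if "i < n" "j < n" for i j
    using compact_group.orthogonal_rep_trig_polys[OF compact_group \<rho> that] trig_polys_subset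
    by (auto simp: r_def[abs_def])
  define h' where "h' x = (\<Sum>i<n. \<Sum>j<n. q i j * \<rho> i j x)" for x
  have ch: "continuous_on UNIV h'"
    using \<rho> unfolding h'_def compact_group.orthogonal_rep_def[OF compact_group]
    by (intro continuous_intros) auto
  have chK: "continuous_on K h'" using ch continuous_on_subset by blast
  define g where "g = (\<Sum>i<n. \<Sum>j<n. \<Sum>l<n. (\<lambda>x. complex_of_real (q i j) * (r l i * average (r l j * f)) x))"
  have "g \<in> cfun.span {a * b | a b. a \<in> A \<and> b \<in> S \<inter> B}"
    unfolding g_def
  proof (intro cfun.span_sum)
    fix i j l assume "i \<in> {..<n}" "j \<in> {..<n}" "l \<in> {..<n}"
    then have rr: "r l i \<in> A" "r l j \<in> A" by (auto intro: rA)
    have rf: "r l j * f \<in> S" by (intro Sideal rr f)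
    then have "average (r l j * f) \<in> S \<inter> B"
      using SA S by (auto intro: average_mem_closed average_inv_alg)
    with rr show "(\<lambda>x. complex_of_real (q i j) * (r l i * average (r l j * f)) x)
        \<in> cfun.span {a * b | a b. a \<in> A \<and> b \<in> S \<inter> B}"
      by (intro cfun.span_scale cfun.span_base) blast
  qed
  \<comment> \<open>Since \<open>w\<close> has mean 1 over \<open>K\<close>, the integral of
    \<open>\<phi>\<close> is \<open>f - g\<close>, whose norm can thus be bounded through the
    integrand.\<close>
  define \<phi> where "\<phi> k = (\<lambda>x. complex_of_real (w k) * f x) - (\<lambda>x. complex_of_real (h' k) * right_transl k f x)" for k
  have nc0: "H.norm_continuous N (\<lambda>_. f)"
  proof -
    have "f - f = 0" by simp
    then show ?thesis unfolding H.norm_continuous_def by (simp only: norm_0 tendsto_const) simp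
  qed
  have nc: "H.norm_continuous N \<phi>"
    unfolding \<phi>_def using wK chK
    by (intro H.norm_continuous_diff[OF normed] H.norm_continuous_scale[OF normed] nc0
        norm_continuous_transl(2) fA transl scale_closed continuous_on_of_real)
  have \<phi>A: "\<phi> k \<in> A" for k
    unfolding \<phi>_def by (intro diff_closed scale_closed transl fA)
  \<comment> \<open>The first term bounds the norm of \<open>w k\<close> times
    \<open>f - right_transl k f\<close>, as \<open>w\<close> vanishes outside \<open>V\<close>; its
    mean is \<open>d\<close> however peaked \<open>w\<close> is. The second comes from replacing
    \<open>w\<close> by \<open>h'\<close>, which differs from it by less than
    \<open>d\<close>.\<close>
  define \<beta> where "\<beta> k = d * w k + d * N f" for k
  have c\<beta>: "continuous_on K \<beta>" unfolding \<beta>_def by (intro continuous_intros wK)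
  have N\<phi>: "N (\<phi> k) \<le> \<beta> k" for k
  proof -
    have Rk: "right_transl k f \<in> A" by (intro transl fA)
    have eq: "\<phi> k = (\<lambda>x. complex_of_real (w k) * (f - right_transl k f) x)
        + (\<lambda>x. complex_of_real (w k - h' k) * right_transl k f x)"
      by (rule ext) (simp add: \<phi>_def algebra_simps)
    have "N (\<phi> k) \<le> N (\<lambda>x. complex_of_real (w k) * (f - right_transl k f) x)
        + N (\<lambda>x. complex_of_real (w k - h' k) * right_transl k f x)"
      unfolding eq by (intro norm_triangle scale_closed diff_closed fA Rk)
    also have "N (\<lambda>x. complex_of_real (w k) * (f - right_transl k f) x) = w k * N (f - right_transl k f)"
      using norm_scale[OF diff_closed[OF fA Rk], of "complex_of_real (w k)"] w(3)[of k] by simp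
    also have "\<dots> \<le> d * w k"
    proof (cases "k \<in> V")
      case True
      then show ?thesis using mult_left_mono[OF Vd w(3), of k k] by (simp add: mult.commute)
    qed (simp add: w(2))
    also have "N (\<lambda>x. complex_of_real (w k - h' k) * right_transl k f x) = \<bar>w k - h' k\<bar> * N f"
      using norm_scale[OF Rk, of "complex_of_real (w k - h' k)"] norm_transl[OF fA, of k]
      by (simp only: norm_of_real)
    also have "\<dots> \<le> d * N f"
      using h[of k] by (intro mult_right_mono norm_nonneg fA) (simp add: h'_def)
    finally show ?thesis by (simp add: \<beta>_def)
  qed
  have "N (\<lambda>x. H.cmean (\<lambda>k. \<phi> k x)) \<le> H.mean \<beta>"
    by (rule H.vector_integral(2)[OF banach nc subspace]) (auto intro: \<phi>A N\<phi> c\<beta> closure_subset[THEN subsetD])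
  also have "H.mean \<beta> = d * (1 + N f)"
    unfolding \<beta>_def using wK
    by (simp add: H.mean_add H.mean_cmult H.mean_const mw algebra_simps continuous_on_mult)
  also have "\<dots> = e / 2"
  proof -
    have "e / (2 * M) * M = e / 2" if "M > 0" for M :: real using that by simp
    from this[OF Nf] show ?thesis unfolding d_def .
  qed
  also have "\<dots> < e" using e by simp
  also have "(\<lambda>x. H.cmean (\<lambda>k. \<phi> k x)) = f - g"
  proof
    fix s
    have crf: "continuous_on K (\<lambda>k. r l j (s + k) * f (s + k))" if "l < n" "j < n" for l j
      using continuous_on_section[OF rA[OF that]] continuous_on_section[OF fA]
      by (rule continuous_on_mult)
    have "complex_of_real (h' k) * f (s + k)
        = (\<Sum>i<n. \<Sum>j<n. \<Sum>l<n. complex_of_real (q i j) * r l i s * (r l j (s + k) * f (s + k)))" for k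
    proof -
      \<comment> \<open>\<open>orthogonal_rep_entry_shift\<close> expresses \<open>h' k\<close> by
        entries at \<open>s\<close> and at \<open>s + k\<close>. The former leave the mean over
        \<open>k\<close>, and the latter join \<open>f (s + k)\<close> to form an average at
        \<open>s\<close>.\<close>
      have "h' k = (\<Sum>i<n. \<Sum>j<n. \<Sum>l<n. q i j * \<rho> l i s * \<rho> l j (s + k))"
        unfolding h'_def
      proof (intro sum.cong refl)
        fix i j assume "i \<in> {..<n}" "j \<in> {..<n}"
        then have "\<rho> i j k = (\<Sum>l<n. \<rho> l i s * \<rho> l j (s + k))"
          by (intro compact_group.orthogonal_rep_entry_shift[OF compact_group \<rho>]) auto
        then show "q i j * \<rho> i j k = (\<Sum>l<n. q i j * \<rho> l i s * \<rho> l j (s + k))"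
          by (simp add: sum_distrib_left mult.assoc)
      qed
      then show ?thesis by (simp add: r_def sum_distrib_right mult.assoc)
    qed
    then have "H.cmean (\<lambda>k. complex_of_real (h' k) * f (s + k))
        = H.cmean (\<lambda>k. \<Sum>i<n. \<Sum>j<n. \<Sum>l<n. complex_of_real (q i j) * r l i s * (r l j (s + k) * f (s + k)))"
      by simp
    also have "\<dots> = (\<Sum>i<n. \<Sum>j<n. \<Sum>l<n. H.cmean (\<lambda>k. complex_of_real (q i j) * r l i s * (r l j (s + k) * f (s + k))))"
    proof -
      define F where "F i j l k = complex_of_real (q i j) * r l i s * (r l j (s + k) * f (s + k))" for i j l k
      have ct: "continuous_on K (F i j l)" if "l < n" "j < n" for i j l
        unfolding F_def by (intro continuous_on_mult_left crf that)
      have ct1: "continuous_on K (\<lambda>k. \<Sum>l<n. F i j l k)" if "j < n" for i j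
        using ct that by (rule_tac continuous_on_sum) auto
      have ct2: "continuous_on K (\<lambda>k. \<Sum>j<n. \<Sum>l<n. F i j l k)" for i
        using ct1 by (rule_tac continuous_on_sum) auto
      have "H.cmean (\<lambda>k. \<Sum>i<n. \<Sum>j<n. \<Sum>l<n. F i j l k) = (\<Sum>i<n. H.cmean (\<lambda>k. \<Sum>j<n. \<Sum>l<n. F i j l k))"
        by (rule H.cmean_sum) (simp_all add: ct2)
      also have "\<dots> = (\<Sum>i<n. \<Sum>j<n. H.cmean (\<lambda>k. \<Sum>l<n. F i j l k))"
        by (intro sum.cong refl H.cmean_sum) (simp_all add: ct1)
      also have "\<dots> = (\<Sum>i<n. \<Sum>j<n. \<Sum>l<n. H.cmean (F i j l))"
        by (intro sum.cong refl H.cmean_sum) (simp_all add: ct)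
      finally show ?thesis unfolding F_def .
    qed
    also have "\<dots> = (\<Sum>i<n. \<Sum>j<n. \<Sum>l<n. complex_of_real (q i j) * r l i s * average (r l j * f) s)"
      unfolding average_def using crf by (intro sum.cong refl) (simp add: H.cmean_cmult)
    also have "\<dots> = g s" by (simp add: g_def sum_fun_apply mult.assoc)
    finally have g: "H.cmean (\<lambda>k. complex_of_real (h' k) * f (s + k)) = g s" .
    have "H.cmean (\<lambda>k. complex_of_real (w k) * f s) = f s"
      using H.cmean_cmult[of "\<lambda>k. complex_of_real (w k)" "f s"] wK mw
      by (simp add: H.cmean_of_real continuous_on_of_real mult.commute)
    moreover have "H.cmean (\<lambda>k. \<phi> k s) = H.cmean (\<lambda>k. complex_of_real (w k) * f s)
        - H.cmean (\<lambda>k. complex_of_real (h' k) * f (s + k))"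
      unfolding \<phi>_def right_transl_def fun_diff_def
      by (intro H.cmean_diff continuous_on_mult continuous_on_of_real wK chK
          continuous_on_section[OF fA] continuous_on_const)
    ultimately show "H.cmean (\<lambda>k. \<phi> k s) = (f - g) s" by (simp add: g)
  qed
  finally have Nfg: "N (f - g) < e" .
  have "cfun.span {a * b | a b. a \<in> A \<and> b \<in> S \<inter> B} \<subseteq> A"
    using inv_alg_subset by (intro cfun.span_minimal subspace) (auto intro: mult_closed)
  with \<open>g \<in> _\<close> Nfg show "\<exists>g\<in>cfun.span {a * b | a b. a \<in> A \<and> b \<in> S \<inter> B}. g \<in> A \<and> N (f - g) < e"
    by blast
qed

lemma invariant_ideal_eq:
  assumes "invariant_ideal S" "cl S \<subseteq> S" "invariant_ideal T" "cl T \<subseteq> T" "S \<inter> B = T \<inter> B"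
  shows "S = T"
proof -
  have *: "S \<subseteq> T"
    if S: "invariant_ideal S" "cl S \<subseteq> S" and T: "invariant_ideal T" "cl T \<subseteq> T" and "S \<inter> B \<subseteq> T" for S T
  proof
    fix f assume "f \<in> S"
    have "cfun.span {a * b | a b. a \<in> A \<and> b \<in> S \<inter> B} \<subseteq> T"
      using T(1) that(5) by (intro cfun.span_minimal) (auto simp: invariant_ideal_def)
    from closure_minimal[OF this T(2)] invariant_ideal_generated[OF S \<open>f \<in> S\<close>]
    show "f \<in> T" by (rule subsetD)
  qed
  show ?thesis using *[of S T] *[of T S] assms by blast
qed

lemma invariant_ideal_closure:
  assumes S: "invariant_ideal S"
  shows "invariant_ideal (cl S)"
proof -
  have SA: "cfun.subspace S" "S \<subseteq> A" "\<And>a f. a \<in> A \<Longrightarrow> f \<in> S \<Longrightarrow> a * f \<in> S"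
    "\<And>k f. k \<in> K \<Longrightarrow> f \<in> S \<Longrightarrow> right_transl k f \<in> S"
    using S by (auto simp: invariant_ideal_def)
  have "right_transl k f \<in> cl S" if "k \<in> K" "f \<in> cl S" for k f
  proof (rule closure_lipschitz[where \<Phi> = "right_transl k" and C = 1, OF _ _ _ that(2)])
    show "N (right_transl k f - right_transl k g) \<le> 1 * N (f - g)" if "f \<in> A" "g \<in> A" for f g
    proof -
      have "right_transl k f - right_transl k g = right_transl k (f - g)"
        by (rule ext) (simp add: right_transl_def)
      then show ?thesis by (simp only: norm_transl[OF diff_closed[OF that]] mult_1 order_refl)
    qed
    show "right_transl k f \<in> cl S" if "f \<in> S" for f
      using subset_closure[OF SA(2)] SA(4)[OF \<open>k \<in> K\<close> that] by blast
  qed (rule transl)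
  then show ?thesis
    using subspace_closure[OF SA(1,2)] closure_subset closure_ideal[OF SA(3) SA(2)]
    unfolding invariant_ideal_def by blast
qed

section \<open>Powers of invariant ideals and their invariant parts\<close>

lemma products_subset: "I \<subseteq> A \<Longrightarrow> products I d \<subseteq> A"
proof
  fix p assume "I \<subseteq> A" "p \<in> products I d"
  then obtain f where f: "p = (\<Prod>i<d. f i)" "\<forall>i<d. f i \<in> A" by (auto simp: products_def)
  have "(\<Prod>i<m. f i) \<in> A" if "m \<le> d" for m
    using that
  proof (induction m)
    case 0
    show ?case unfolding lessThan_0 prod.empty by (rule one_mem)
  next
    case (Suc m)
    then show ?case unfolding prod.lessThan_Suc using f by (intro mult_closed) auto
  qed
  with f show "p \<in> A" by simp
qed

lemma products_inv_alg: "products (I \<inter> B) d \<subseteq> B" if "I \<subseteq> A"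
proof
  fix p assume p: "p \<in> products (I \<inter> B) d"
  then obtain f where f: "p = (\<Prod>i<d. f i)" "\<forall>i<d. f i \<in> B" by (auto simp: products_def)
  have "(\<Prod>i<m. f i) (s + k) = (\<Prod>i<m. f i) s" if "m \<le> d" "k \<in> K" for m s k
    using that
  proof (induction m)
    case (Suc m)
    then show ?case unfolding prod.lessThan_Suc using f inv_algD by simp
  qed simp
  moreover have "p \<in> A" using products_subset[of "I \<inter> B" d] inv_alg_subset p by blast
  ultimately show "p \<in> B" using f(1) by (auto simp: inv_alg_def right_transl_def)
qed

text \<open>The factor \<open>a\<close> is absorbed by the last of the \<open>d\<close> factors,
  which must therefore exist.\<close>

lemma mult_products:
  assumes I: "\<And>f. f \<in> I \<Longrightarrow> a * f \<in> I" and d: "d \<ge> 1" and p: "p \<in> products I d"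
  shows "a * p \<in> products I d"
proof -
  obtain f where f: "p = (\<Prod>i<d. f i)" "\<forall>i<d. f i \<in> I" using p by (auto simp: products_def)
  obtain m where m: "d = Suc m" using d by (cases d) auto
  define f' where "f' = f(m := a * f m)"
  have "a * p = (\<Prod>i<d. f' i)"
    unfolding f m prod.lessThan_Suc by (simp add: f'_def mult.left_commute)
  moreover have "\<forall>i<d. f' i \<in> I" using f(2) I m by (auto simp: f'_def)
  ultimately show ?thesis unfolding products_def by blast
qed

lemma span_products_ideal:
  assumes I: "invariant_ideal I" and d: "d \<ge> 1"
  shows "invariant_ideal (cfun.span (products I d))"
proof -
  have IA: "I \<subseteq> A" and Iid: "\<And>a f. a \<in> A \<Longrightarrow> f \<in> I \<Longrightarrow> a * f \<in> I"
    and It: "\<And>k f. k \<in> K \<Longrightarrow> f \<in> I \<Longrightarrow> right_transl k f \<in> I"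
    using I by (auto simp: invariant_ideal_def)
  have sub: "cfun.span (products I d) \<subseteq> A"
    by (rule cfun.span_minimal[OF products_subset[OF IA] subspace])
  have "a * f \<in> cfun.span (products I d)" if a: "a \<in> A" and f: "f \<in> cfun.span (products I d)" for a f
    using f
  proof (induction rule: cfun.span_induct_alt)
    case base
    show ?case unfolding mult_zero_right by (rule cfun.span_zero)
  next
    case (step c x y)
    have eq: "a * ((\<lambda>z. c * x z) + y) = (\<lambda>z. c * (a * x) z) + a * y"
      by (rule ext) (simp add: algebra_simps)
    show ?case
      unfolding eq by (intro cfun.span_add cfun.span_scale step(2))
        (rule cfun.span_base[OF mult_products[OF Iid[OF a] d step(1)]])
  qed
  moreover have "right_transl k f \<in> cfun.span (products I d)"
    if k: "k \<in> K" and f: "f \<in> cfun.span (products I d)" for k f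
    using f
  proof (induction rule: cfun.span_induct_alt)
    case base
    have "right_transl k 0 = (0 :: 'g \<Rightarrow> complex)" by (rule ext) (simp add: right_transl_def)
    then show ?case by (simp only: cfun.span_zero)
  next
    case (step c x y)
    have eq: "right_transl k ((\<lambda>z. c * x z) + y) = (\<lambda>z. c * right_transl k x z) + right_transl k y"
      by (rule ext) (simp add: right_transl_def)
    obtain g where g: "x = (\<Prod>i<d. g i)" "\<forall>i<d. g i \<in> I" using step(1) by (auto simp: products_def)
    have "right_transl k (\<Prod>i<m. g i) = (\<Prod>i<m. right_transl k (g i))" for m
    proof (induction m)
      case 0
      show ?case by (rule ext) (simp add: right_transl_def)
    next
      case (Suc m)
      show ?case
        unfolding prod.lessThan_Suc Suc[symmetric] by (rule ext) (simp add: right_transl_def)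
    qed
    then have "right_transl k x = (\<Prod>i<d. right_transl k (g i))" unfolding g(1) .
    moreover have "\<forall>i<d. right_transl k (g i) \<in> I" using g(2) It[OF k] by blast
    ultimately have "right_transl k x \<in> products I d" unfolding products_def by blast
    then show ?case
      unfolding eq by (intro cfun.span_add cfun.span_scale step(2)) (rule cfun.span_base)
  qed
  ultimately show ?thesis
    using sub cfun.subspace_span by (auto simp: invariant_ideal_def)
qed

text \<open>Each factor is approximated by sums of \<open>a * b\<close> with invariant
  \<open>b\<close>; on multiplying out, the coefficients \<open>a\<close> are collected in front by
  commutativity. Averaging will then act on one coefficient only.\<close>

lemma products_generated:
  assumes I: "invariant_ideal I" "cl I \<subseteq> I" and f: "\<forall>i<n. f i \<in> I"
  shows "(\<Prod>i<n. f i) \<in> cl (cfun.span {a * b | a b. a \<in> A \<and> b \<in> products (I \<inter> B) n})"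
  using f
proof (induction n)
  case 0
  have "(1 :: 'g \<Rightarrow> complex) \<in> products (I \<inter> B) 0" by (auto simp: products_def)
  moreover have "(1 :: 'g \<Rightarrow> complex) = 1 * 1" by simp
  ultimately have "1 \<in> cfun.span {a * b | a b. a \<in> A \<and> b \<in> products (I \<inter> B) 0}"
    using one_mem by (intro cfun.span_base CollectI exI conjI)
  moreover have "cfun.span {a * b | a b. a \<in> A \<and> b \<in> products (I \<inter> B) 0} \<subseteq> A"
    using products_subset[of "I \<inter> B" 0] inv_alg_subset
    by (intro cfun.span_minimal subspace) (auto intro!: mult_closed)
  ultimately show ?case
    unfolding lessThan_0 prod.empty using subset_closure by blast
next
  case (Suc n)
  have IA: "I \<inter> B \<subseteq> A" using inv_alg_subset by blast
  have 1: "(\<Prod>i<n. f i) \<in> cl (cfun.span {a * b | a b. a \<in> A \<and> b \<in> products (I \<inter> B) n})"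
    by (rule Suc(1)) (use Suc(2) in simp)
  have 2: "f n \<in> cl (cfun.span {a * b | a b. a \<in> A \<and> b \<in> I \<inter> B})"
    by (rule invariant_ideal_generated[OF I]) (use Suc(2) in simp)
  show ?case
    unfolding prod.lessThan_Suc
  proof (rule closure_span_mult[OF _ _ _ _ 1 2])
    show "{a * b | a b. a \<in> A \<and> b \<in> products (I \<inter> B) n} \<subseteq> A"
      "{a * b | a b. a \<in> A \<and> b \<in> products (I \<inter> B) (Suc n)} \<subseteq> A"
      using products_subset[OF IA] by (auto intro!: mult_closed)
    show "{a * b | a b. a \<in> A \<and> b \<in> I \<inter> B} \<subseteq> A"
      using IA by (auto intro!: mult_closed)
    fix x y
    assume "x \<in> {a * b | a b. a \<in> A \<and> b \<in> products (I \<inter> B) n}" "y \<in> {a * b | a b. a \<in> A \<and> b \<in> I \<inter> B}"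
    then obtain a b a' b' where x: "x = a * b" "a \<in> A" "b \<in> products (I \<inter> B) n"
      and y: "y = a' * b'" "a' \<in> A" "b' \<in> I \<inter> B" by blast
    obtain g where g: "b = (\<Prod>i<n. g i)" "\<forall>i<n. g i \<in> I \<inter> B" using x(3) by (auto simp: products_def)
    have "b * b' = (\<Prod>i<Suc n. (g(n := b')) i)" unfolding g(1) prod.lessThan_Suc by simp
    moreover have "\<forall>i<Suc n. (g(n := b')) i \<in> I \<inter> B" using g(2) y(3) by (auto simp: less_Suc_eq)
    ultimately have "b * b' \<in> products (I \<inter> B) (Suc n)" unfolding products_def by blast
    moreover have "x * y = (a * a') * (b * b')" unfolding x(1) y(1) by (simp only: mult_ac)
    moreover have "a * a' \<in> A" using x y by (intro mult_closed)
    ultimately show "x * y \<in> {a * b | a b. a \<in> A \<and> b \<in> products (I \<inter> B) (Suc n)}" by blast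
  qed
qed

text \<open>The nontrivial inclusion averages an element of the power. By
  \<open>products_generated\<close> it is enough to average \<open>a * b\<close> with
  \<open>b\<close> a product of invariant elements of \<open>I\<close>; the result
  \<open>average a * b\<close> is again such a product, \<open>average a\<close> being absorbed by
  the last factor.\<close>

lemma power_inter_inv_alg:
  assumes I: "invariant_ideal I" "cl I \<subseteq> I" and d: "d \<ge> 1"
  shows "cl (cfun.span (products I d)) \<inter> B = cl (cfun.span (products (I \<inter> B) d)) \<inter> B"
proof
  let ?T = "cfun.span (products (I \<inter> B) d)"
  have IA: "I \<subseteq> A" and Iid: "\<And>a f. a \<in> A \<Longrightarrow> f \<in> I \<Longrightarrow> a * f \<in> I"
    using I by (auto simp: invariant_ideal_def)
  have TA: "?T \<subseteq> A"
    using products_subset[of "I \<inter> B" d] IA by (intro cfun.span_minimal subspace) auto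
  have cT: "cfun.subspace (cl ?T)"
    by (rule subspace_closure[OF cfun.subspace_span TA])
  have avg_span: "average g \<in> cl ?T"
    if M: "M \<subseteq> A" "\<And>m. m \<in> M \<Longrightarrow> average m \<in> cl ?T" and g: "g \<in> cfun.span M" for M g
  proof -
    have "cfun.subspace {g \<in> A. average g \<in> cl ?T}"
    proof (rule cfun.subspaceI; clarify)
      have "average 0 = 0" by (rule ext) (simp add: average_def H.cmean_const)
      then show "0 \<in> A \<and> average 0 \<in> cl ?T" by (simp only: cfun.subspace_0[OF cT] zero_closed)
    next
      fix x y assume *: "x \<in> A" "average x \<in> cl ?T" "y \<in> A" "average y \<in> cl ?T"
      show "x + y \<in> A \<and> average (x + y) \<in> cl ?T"
        unfolding average_add[OF *(1,3)] by (intro conjI add_closed cfun.subspace_add[OF cT] *)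
    next
      fix c x assume *: "x \<in> A" "average x \<in> cl ?T"
      show "(\<lambda>z. c * x z) \<in> A \<and> average (\<lambda>z. c * x z) \<in> cl ?T"
        unfolding average_scale[OF *(1)] by (intro conjI scale_closed cfun.subspace_scale[OF cT] *)
    qed
    then have "cfun.span M \<subseteq> {g \<in> A. average g \<in> cl ?T}"
      using M by (intro cfun.span_minimal) auto
    with g show ?thesis by blast
  qed
  have gen: "average (a * b) \<in> cl ?T" if a: "a \<in> A" and b: "b \<in> products (I \<inter> B) d" for a b
  proof -
    have bB: "b \<in> B" using products_inv_alg[OF IA] b by blast
    have "average a * h \<in> I \<inter> B" if h: "h \<in> I \<inter> B" for h
    proof -
      have "average a * h = average (a * h)" using average_mult[OF a] h by simp
      moreover have "average (a * h) \<in> B" using a h inv_alg_subset by (intro average_inv_alg mult_closed) auto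
      moreover have "average a * h \<in> I" using h by (intro Iid average_mem a) auto
      ultimately show ?thesis by simp
    qed
    from mult_products[OF this d b] have "average a * b \<in> ?T" by (rule cfun.span_base)
    then show ?thesis
      unfolding average_mult[OF a bB] using subset_closure[OF TA] by blast
  qed
  have prod: "average p \<in> cl ?T" if p: "p \<in> products I d" for p
  proof -
    obtain f where f: "p = (\<Prod>i<d. f i)" "\<forall>i<d. f i \<in> I" using p by (auto simp: products_def)
    have mem: "p \<in> cl (cfun.span {a * b | a b. a \<in> A \<and> b \<in> products (I \<inter> B) d})"
      unfolding f(1) by (rule products_generated[OF I f(2)])
    show ?thesis
    proof (rule closure_lipschitz[where \<Phi> = average, OF average_mem average_lipschitz _ mem])
      have "{a * b | a b. a \<in> A \<and> b \<in> products (I \<inter> B) d} \<subseteq> A"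
        using products_subset[of "I \<inter> B" d] IA by (auto intro!: mult_closed)
      then show "average g \<in> cl ?T"
        if "g \<in> cfun.span {a * b | a b. a \<in> A \<and> b \<in> products (I \<inter> B) d}" for g
        using that gen by (rule_tac avg_span) auto
    qed
  qed
  show "cl (cfun.span (products I d)) \<inter> B \<subseteq> cl ?T \<inter> B"
  proof
    fix f assume f: "f \<in> cl (cfun.span (products I d)) \<inter> B"
    have "average f \<in> cl ?T"
    proof (rule closure_lipschitz[where \<Phi> = average, OF average_mem average_lipschitz])
      show "average g \<in> cl ?T" if "g \<in> cfun.span (products I d)" for g
        by (rule avg_span[OF products_subset[OF IA] prod that])
    qed (use f in auto)
    with f show "f \<in> cl ?T \<inter> B" by (simp add: average_fixed)
  qed
  have "products (I \<inter> B) d \<subseteq> products I d" unfolding products_def by blast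
  then show "cl ?T \<inter> B \<subseteq> cl (cfun.span (products I d)) \<inter> B"
    using closure_mono[OF cfun.span_mono] by blast
qed

text \<open>An invariant limit of elements of \<open>S\<close> is also the limit of their averages,
  which lie in \<open>S\<close> again.\<close>

lemma closure_inter_inv_alg:
  assumes "S \<subseteq> A" "\<And>f. f \<in> S \<Longrightarrow> average f \<in> S"
  shows "cl S \<inter> B = cl (S \<inter> B) \<inter> B"
proof
  show "cl S \<inter> B \<subseteq> cl (S \<inter> B) \<inter> B"
  proof
    fix f assume f: "f \<in> cl S \<inter> B"
    have "average f \<in> cl (S \<inter> B)"
    proof (rule closure_lipschitz[where \<Phi> = average, OF average_mem average_lipschitz])
      show "average g \<in> cl (S \<inter> B)" if "g \<in> S" "g \<in> A" for g
        using assms(2)[OF that(1)] average_inv_alg[OF that(2)] subset_closure[of "S \<inter> B"] assms(1) by blast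
    qed (use f in auto)
    with f show "f \<in> cl (S \<inter> B) \<inter> B" by (simp add: average_fixed)
  qed
  show "cl (S \<inter> B) \<inter> B \<subseteq> cl S \<inter> B"
    using closure_mono[of "S \<inter> B" S] by blast
qed

end

section \<open>Passage to the coset space\<close>

context translation_algebra
begin

abbreviation C :: "('g set \<Rightarrow> complex) set" where
  "C \<equiv> coset_alg K A"

abbreviation coset_preimage :: "'g set set \<Rightarrow> 'g set" where
  "coset_preimage E \<equiv> {s. left_coset K s \<in> E}"

text \<open>On \<open>C\<close> this is the inverse of \<open>coset_map K\<close>. Being a plain
  composition, it respects sums and products of all functions, inside \<open>C\<close> or
  not.\<close>

definition pull :: "('g set \<Rightarrow> complex) \<Rightarrow> 'g \<Rightarrow> complex" where
  "pull F = (\<lambda>s. F (left_coset K s))"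

lemma left_coset_add: "k \<in> K \<Longrightarrow> left_coset K (s + k) = left_coset K s"
proof
  assume k: "k \<in> K"
  show "left_coset K (s + k) \<subseteq> left_coset K s"
    using k H.add_mem by (auto simp: left_coset_def add.assoc)
  show "left_coset K s \<subseteq> left_coset K (s + k)"
  proof
    fix x assume "x \<in> left_coset K s"
    then obtain l where l: "l \<in> K" "x = s + l" by (auto simp: left_coset_def)
    then have "x = (s + k) + (- k + l)" by (simp add: add.assoc)
    moreover have "- k + l \<in> K" using k l by (intro H.add_mem H.uminus_mem)
    ultimately show "x \<in> left_coset K (s + k)" unfolding left_coset_def by blast
  qed
qed

lemma left_coset_eqD:
  assumes "left_coset K s = left_coset K t"
  shows "\<exists>k\<in>K. s + k = t"
proof -
  have "t + 0 \<in> left_coset K t" unfolding left_coset_def using H.zero_mem by blast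
  then have "t \<in> left_coset K s" unfolding assms by simp
  then show ?thesis unfolding left_coset_def by blast
qed

lemma invariant_ideal_I: "invariant_ideal (ideal_I A (coset_preimage E))"
  unfolding invariant_ideal_def
proof (intro conjI ballI)
  show "cfun.subspace (ideal_I A (coset_preimage E))"
    by (rule cfun.subspaceI) (auto simp: ideal_I_def intro: add_closed scale_closed cfun.subspace_0[OF subspace])
  show "a * f \<in> ideal_I A (coset_preimage E)" if "a \<in> A" "f \<in> ideal_I A (coset_preimage E)" for a f
    using that mult_closed[of a f] by (simp add: ideal_I_def)
  show "right_transl k f \<in> ideal_I A (coset_preimage E)"
    if "k \<in> K" "f \<in> ideal_I A (coset_preimage E)" for k f
    using that transl[of f k] by (simp add: ideal_I_def right_transl_def left_coset_add)
qed (auto simp: ideal_I_def)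

lemma compactin_supp_euclidean: "compactin euclidean (supp euclidean (f :: 'g \<Rightarrow> complex))"
  using compact_Int_closed[OF compact_UNIV, of "supp euclidean f"] by (simp add: supp_def)

text \<open>The group being compact, every support is compact, and any closed \<open>D\<close>
  containing the nonzero set may stand for the support. Sums, translates and averages then require
  no computation of closures.\<close>

lemma ideal_I0_iff:
  "f \<in> ideal_I0 euclidean A S \<longleftrightarrow> f \<in> A \<and> (\<exists>D. closed D \<and> (\<forall>x. f x \<noteq> 0 \<longrightarrow> x \<in> D) \<and> D \<inter> S = {})"
proof -
  have "supp euclidean f \<inter> S = {}" if "closed D" "\<forall>x. f x \<noteq> 0 \<longrightarrow> x \<in> D" "D \<inter> S = {}" for D
  proof -
    have "closure {x. f x \<noteq> 0} \<subseteq> D" using that by (intro Elementary_Topology.closure_minimal) auto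
    then have "supp euclidean f \<subseteq> D" by (simp add: supp_def)
    with that show ?thesis by blast
  qed
  moreover have "closed (supp euclidean f)" "\<forall>x. f x \<noteq> 0 \<longrightarrow> x \<in> supp euclidean f"
    using Elementary_Topology.closure_subset[of "{x. f x \<noteq> 0}"] by (auto simp: supp_def)
  moreover have "compactin euclidean (supp euclidean f)" by (rule compactin_supp_euclidean)
  ultimately show ?thesis unfolding ideal_I0_def by blast
qed

text \<open>The set is the product \<open>DK\<^sup>-\<^sup>1\<close>, the image of the compact set
  \<open>D \<times> K\<close> under subtraction.\<close>

lemma closed_saturation:
  assumes "closed D"
  shows "closed {x. \<exists>k\<in>K. x + k \<in> D}"
proof -
  have "compact D" using compact_Int_closed[OF compact_UNIV assms] by simp
  then have "compact (D \<times> K)" by (intro compact_Times H.compact)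
  then have "compact ((\<lambda>p. fst p - snd p) ` (D \<times> K))"
    by (rule compact_continuous_image[rotated]) (intro continuous_intros)
  moreover have "(\<lambda>p. fst p - snd p) ` (D \<times> K) = {x. \<exists>k\<in>K. x + k \<in> D}"
  proof (intro equalityI subsetI)
    fix x assume "x \<in> {x. \<exists>k\<in>K. x + k \<in> D}"
    then obtain k where k: "k \<in> K" "x + k \<in> D" by blast
    have "x = (x + k) - k" by simp
    with k show "x \<in> (\<lambda>p. fst p - snd p) ` (D \<times> K)" by force
  next
    fix x assume "x \<in> (\<lambda>p. fst p - snd p) ` (D \<times> K)"
    then obtain y k where "y \<in> D" "k \<in> K" "x = y - k" by auto
    then have "x + k \<in> D" by simp
    with \<open>k \<in> K\<close> show "x \<in> {x. \<exists>k\<in>K. x + k \<in> D}" by blast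
  qed
  ultimately show ?thesis using compact_imp_closed by simp
qed

lemma invariant_ideal_I0: "invariant_ideal (ideal_I0 euclidean A (coset_preimage E))"
  unfolding invariant_ideal_def
proof (intro conjI ballI)
  let ?Z = "ideal_I0 euclidean A (coset_preimage E)"
  show "cfun.subspace ?Z"
  proof (rule cfun.subspaceI)
    show "0 \<in> ?Z" unfolding ideal_I0_iff using zero_closed by (intro conjI exI[of _ "{}"]) auto
  next
    fix f g assume f: "f \<in> ?Z" and g: "g \<in> ?Z"
    obtain D where D: "closed D" "\<forall>x. f x \<noteq> 0 \<longrightarrow> x \<in> D" "D \<inter> coset_preimage E = {}"
      using f unfolding ideal_I0_iff by blast
    obtain D' where D': "closed D'" "\<forall>x. g x \<noteq> 0 \<longrightarrow> x \<in> D'" "D' \<inter> coset_preimage E = {}"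
      using g unfolding ideal_I0_iff by blast
    have "\<forall>x. (f + g) x \<noteq> 0 \<longrightarrow> x \<in> D \<union> D'"
      using D(2) D'(2) by (metis UnCI add.right_neutral plus_fun_apply)
    moreover have "f + g \<in> A" using f g unfolding ideal_I0_iff by (blast intro: add_closed)
    ultimately show "f + g \<in> ?Z"
      unfolding ideal_I0_iff using D(1,3) D'(1,3) by (intro conjI exI[of _ "D \<union> D'"] closed_Un) auto
  next
    fix c f assume "f \<in> ?Z"
    then show "(\<lambda>x. c * f x) \<in> ?Z" unfolding ideal_I0_iff by (auto intro: scale_closed)
  qed
  show "a * f \<in> ?Z" if "a \<in> A" "f \<in> ?Z" for a f
    using that mult_closed[of a f] unfolding ideal_I0_iff by auto
  show "right_transl k f \<in> ?Z" if k: "k \<in> K" and f: "f \<in> ?Z" for k f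
  proof -
    obtain D where D: "closed D" "\<forall>x. f x \<noteq> 0 \<longrightarrow> x \<in> D" "D \<inter> coset_preimage E = {}"
      using f unfolding ideal_I0_iff by blast
    have "closed ((\<lambda>x. x + k) -` D)" by (intro closed_vimage D continuous_intros)
    moreover have "(\<lambda>x. x + k) -` D \<inter> coset_preimage E = {}"
      using D(3) left_coset_add[OF k] by auto
    moreover have "right_transl k f \<in> A" using f unfolding ideal_I0_iff by (blast intro: transl)
    ultimately show ?thesis
      unfolding ideal_I0_iff using D(2)
      by (intro conjI exI[of _ "(\<lambda>x. x + k) -` D"]) (auto simp: right_transl_def)
  qed
qed (auto simp: ideal_I0_def)

text \<open>\<open>average f\<close> vanishes off the saturation of \<open>D\<close>, which avoids
  \<open>coset_preimage E\<close> because the latter is a union of cosets.\<close>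

lemma average_ideal_I0:
  assumes f: "f \<in> ideal_I0 euclidean A (coset_preimage E)"
  shows "average f \<in> ideal_I0 euclidean A (coset_preimage E)"
proof -
  obtain D where D: "closed D" "\<forall>x. f x \<noteq> 0 \<longrightarrow> x \<in> D" "D \<inter> coset_preimage E = {}"
    using f unfolding ideal_I0_iff by blast
  let ?D = "{x. \<exists>k\<in>K. x + k \<in> D}"
  have "average f x = 0" if "x \<notin> ?D" for x
  proof -
    have "average f x = H.cmean (\<lambda>_. 0)"
      unfolding average_def using that D(2) by (intro H.cmean_cong) blast
    then show ?thesis by (simp add: H.cmean_const)
  qed
  moreover have "?D \<inter> coset_preimage E = {}"
    using D(3) left_coset_add by force
  moreover have "average f \<in> A" using f unfolding ideal_I0_iff by (blast intro: average_mem)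
  ultimately show ?thesis
    unfolding ideal_I0_iff using closed_saturation[OF D(1)] by blast
qed

section \<open>The correspondence between functions on cosets and invariant functions\<close>

lemma subspace_inv_alg: "cfun.subspace B"
  by (rule cfun.subspaceI)
    (auto simp: inv_alg_def right_transl_def fun_eq_iff intro: add_closed scale_closed zero_closed
      cfun.subspace_0[OF subspace])

lemma coset_alg_iff:
  "F \<in> C \<longleftrightarrow> pull F \<in> B \<and> (\<forall>c. c \<notin> range (left_coset K) \<longrightarrow> F c = 0)"
proof
  assume "F \<in> C"
  then obtain f where f: "f \<in> B" "F = coset_map K f" by (auto simp: coset_alg_def)
  have "pull F = f"
    by (rule ext) (simp add: pull_def f(2) coset_map_left_coset[OF K_subgroup f(1)])
  with f show "pull F \<in> B \<and> (\<forall>c. c \<notin> range (left_coset K) \<longrightarrow> F c = 0)"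
    by (simp add: coset_map_def)
next
  assume F: "pull F \<in> B \<and> (\<forall>c. c \<notin> range (left_coset K) \<longrightarrow> F c = 0)"
  have "coset_map K (pull F) = F"
  proof
    fix c
    show "coset_map K (pull F) c = F c"
    proof (cases "c \<in> range (left_coset K)")
      case True
      then obtain s where "c = left_coset K s" by blast
      then show ?thesis
        using coset_map_left_coset[OF K_subgroup, of "pull F" A s] F by (simp add: pull_def)
    qed (use F in \<open>simp add: coset_map_def\<close>)
  qed
  then show "F \<in> C" unfolding coset_alg_def using F by (metis imageI)
qed

lemma pull_coset_map: "f \<in> B \<Longrightarrow> pull (coset_map K f) = f"
  by (rule ext) (simp add: pull_def coset_map_left_coset[OF K_subgroup])

lemma coset_map_mem: "f \<in> B \<Longrightarrow> coset_map K f \<in> C"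
  by (auto simp: coset_alg_def)

lemma pull_mem: "F \<in> C \<Longrightarrow> pull F \<in> B"
  by (simp add: coset_alg_iff)

lemma inj_on_pull: "inj_on pull C"
proof (rule inj_onI)
  fix F G assume "F \<in> C" "G \<in> C" "pull F = pull G"
  then show "F = G"
    using pull_coset_map by (auto simp: coset_alg_def)
qed

lemma coset_norm_eq: "F \<in> C \<Longrightarrow> coset_norm K A N F = N (pull F)"
  using pull_coset_map by (auto simp: coset_alg_def coset_norm_coset_map[OF K_subgroup])

lemma pull_diff: "pull (F - G) = pull F - pull G"
  by (rule ext) (simp add: pull_def)

lemma subspace_coset_alg: "cfun.subspace C"
proof (rule cfun.subspaceI)
  have "pull 0 = 0" by (rule ext) (simp add: pull_def)
  then have "pull 0 \<in> B" by (simp only: cfun.subspace_0[OF subspace_inv_alg])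
  then show "0 \<in> C" by (simp add: coset_alg_iff)
next
  fix F G assume FG: "F \<in> C" "G \<in> C"
  have "pull (F + G) = pull F + pull G" by (rule ext) (simp add: pull_def)
  then have "pull (F + G) \<in> B" using FG by (simp only: cfun.subspace_add[OF subspace_inv_alg] pull_mem)
  with FG show "F + G \<in> C" unfolding coset_alg_iff by simp
next
  fix c F assume F: "F \<in> C"
  have "pull (\<lambda>x. c * F x) = (\<lambda>x. c * pull F x)" by (rule ext) (simp add: pull_def)
  then have "pull (\<lambda>x. c * F x) \<in> B" using F by (simp only: cfun.subspace_scale[OF subspace_inv_alg] pull_mem)
  with F show "(\<lambda>x. c * F x) \<in> C" unfolding coset_alg_iff by simp
qed

lemma coset_dist:
  assumes "F \<in> C" "G \<in> C"
  shows "alg_dist C (coset_norm K A N) F G = alg_dist A N (pull F) (pull G)"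
proof -
  have "pull F \<in> A" "pull G \<in> A" using assms pull_mem inv_alg_subset by blast+
  then show ?thesis
    using assms coset_norm_eq[OF cfun.subspace_diff[OF subspace_coset_alg assms]]
    by (simp add: alg_dist_def pull_diff)
qed

lemma coset_metric: "Metric_space C (alg_dist C (coset_norm K A N))"
proof
  have pA: "pull F \<in> A" if "F \<in> C" for F using that pull_mem inv_alg_subset by blast
  show "0 \<le> alg_dist C (coset_norm K A N) F G" for F G
    using coset_dist[of F G] nonneg by (cases "F \<in> C \<and> G \<in> C") (auto simp: alg_dist_def)
  show "alg_dist C (coset_norm K A N) F G = alg_dist C (coset_norm K A N) G F" for F G
    using coset_dist[of F G] coset_dist[of G F] commute
    by (cases "F \<in> C \<and> G \<in> C") (auto simp: alg_dist_def)
  show "alg_dist C (coset_norm K A N) F G = 0 \<longleftrightarrow> F = G" if "F \<in> C" "G \<in> C" for F G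
    using that inj_on_pull pA by (auto simp: coset_dist dest: inj_onD)
  show "alg_dist C (coset_norm K A N) F H \<le> alg_dist C (coset_norm K A N) F G + alg_dist C (coset_norm K A N) G H"
    if "F \<in> C" "G \<in> C" "H \<in> C" for F G H
    using that pA by (simp add: coset_dist triangle)
qed

lemma coset_closure_of:
  "alg_topology C (coset_norm K A N) closure_of S = {F \<in> C. pull F \<in> cl (pull ` (S \<inter> C))}"
proof -
  have "(\<exists>G\<in>S \<inter> C. coset_norm K A N (F - G) < e) \<longleftrightarrow> (\<exists>g\<in>pull ` (S \<inter> C) \<inter> A. N (pull F - g) < e)"
    if F: "F \<in> C" for F e
  proof -
    have "coset_norm K A N (F - G) = N (pull F - pull G)" "pull G \<in> A" if "G \<in> C" for G
      using coset_norm_eq[OF cfun.subspace_diff[OF subspace_coset_alg F that]] pull_mem[OF that] inv_alg_subset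
      by (auto simp: pull_diff)
    then show ?thesis by auto
  qed
  moreover have "pull F \<in> A" if "F \<in> C" for F using pull_mem[OF that] inv_alg_subset by blast
  ultimately show ?thesis
    unfolding alg_topology_closure_of[OF coset_metric] alg_closure_def by blast
qed

text \<open>As \<open>pull\<close> is an isometry of \<open>C\<close> onto \<open>B\<close>,
  comparing closures in \<open>C\<close> amounts to comparing the invariant parts of closures in
  \<open>A\<close>.\<close>

lemma coset_closure_of_eq_iff:
  "alg_topology C (coset_norm K A N) closure_of S = alg_topology C (coset_norm K A N) closure_of T \<longleftrightarrow>
    cl (pull ` (S \<inter> C)) \<inter> B = cl (pull ` (T \<inter> C)) \<inter> B"
  (is "?L = ?R \<longleftrightarrow> _")
proof -
  have *: "pull ` {F \<in> C. pull F \<in> X} = X \<inter> B" for X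
  proof
    show "X \<inter> B \<subseteq> pull ` {F \<in> C. pull F \<in> X}"
    proof
      fix f assume f: "f \<in> X \<inter> B"
      then have "coset_map K f \<in> C" "pull (coset_map K f) = f"
        by (auto intro: coset_map_mem pull_coset_map)
      with f show "f \<in> pull ` {F \<in> C. pull F \<in> X}" by (intro image_eqI[of _ _ "coset_map K f"]) auto
    qed
  qed (use pull_mem in blast)
  have "?L = ?R \<longleftrightarrow> pull ` ?L = pull ` ?R"
    unfolding coset_closure_of by (rule inj_on_image_eq_iff[OF inj_on_pull, symmetric]) auto
  then show ?thesis unfolding coset_closure_of * .
qed

lemma continuous_left_coset: "continuous_map euclidean (coset_space K) (left_coset K)"
  by (rule quotient_imp_continuous_map[OF quotient_map_left_coset])

lemma compactin_supp: "compactin (coset_space K) (supp (coset_space K) F)"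
proof -
  have "compactin (coset_space K) (left_coset K ` UNIV)"
    by (rule image_compactin[OF _ continuous_left_coset]) (simp add: compact_UNIV)
  then have "compact_space (coset_space K)"
    by (simp add: compact_space_def topspace_coset_space)
  then show ?thesis by (simp add: supp_def closedin_compact_space)
qed

lemma pull_ideal_I:
  assumes "E \<subseteq> range (left_coset K)"
  shows "pull ` ideal_I C E = ideal_I A (coset_preimage E) \<inter> B"
proof
  show "pull ` ideal_I C E \<subseteq> ideal_I A (coset_preimage E) \<inter> B"
    using pull_mem inv_alg_subset by (auto simp: ideal_I_def pull_def)
  show "ideal_I A (coset_preimage E) \<inter> B \<subseteq> pull ` ideal_I C E"
  proof
    fix f assume f: "f \<in> ideal_I A (coset_preimage E) \<inter> B"
    have "coset_map K f \<in> ideal_I C E"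
      using f assms coset_map_mem[of f] coset_map_left_coset[OF K_subgroup, of f A]
      by (auto simp: ideal_I_def)
    with f pull_coset_map[of f] show "f \<in> pull ` ideal_I C E" by (metis IntD2 imageI)
  qed
qed

lemma pull_ideal_I0:
  "pull ` ideal_I0 (coset_space K) C E = ideal_I0 euclidean A (coset_preimage E) \<inter> B"
proof -
  have iff: "F \<in> ideal_I0 (coset_space K) C E \<longleftrightarrow> pull F \<in> ideal_I0 euclidean A (coset_preimage E)"
    if F: "F \<in> C" for F
  proof
    assume "F \<in> ideal_I0 (coset_space K) C E"
    then have disj: "supp (coset_space K) F \<inter> E = {}" by (simp add: ideal_I0_def)
    have "closedin (coset_space K) (supp (coset_space K) F)" by (simp add: supp_def)
    then have "closedin euclidean {s \<in> topspace euclidean. left_coset K s \<in> supp (coset_space K) F}"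
      by (rule closedin_continuous_map_preimage[OF continuous_left_coset])
    then have "closed {s. left_coset K s \<in> supp (coset_space K) F}" by simp
    moreover have "{c \<in> topspace (coset_space K). F c \<noteq> 0} \<subseteq> supp (coset_space K) F"
      unfolding supp_def by (rule closure_of_subset) auto
    then have "\<forall>s. pull F s \<noteq> 0 \<longrightarrow> s \<in> {s. left_coset K s \<in> supp (coset_space K) F}"
      by (auto simp: pull_def topspace_coset_space)
    moreover have "pull F \<in> A" using pull_mem[OF F] inv_alg_subset by blast
    ultimately show "pull F \<in> ideal_I0 euclidean A (coset_preimage E)"
      unfolding ideal_I0_iff using disj
      by (intro conjI exI[of _ "{s. left_coset K s \<in> supp (coset_space K) F}"]) auto
  next
    assume "pull F \<in> ideal_I0 euclidean A (coset_preimage E)"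
    then obtain D where D: "closed D" "\<forall>x. pull F x \<noteq> 0 \<longrightarrow> x \<in> D" "D \<inter> coset_preimage E = {}"
      unfolding ideal_I0_iff by blast
    \<comment> \<open>\<open>D\<close> is enlarged to a union of cosets, so that the complement of
      its image has an open preimage in the group and the image is closed in the quotient
      topology.\<close>
    define S where "S = {x. \<exists>k\<in>K. x + k \<in> D}"
    have S: "closed S" unfolding S_def by (rule closed_saturation[OF D(1)])
    have sat: "t \<in> S" if ts: "left_coset K t = left_coset K s" and s: "s \<in> S" for s t
    proof -
      obtain l where "l \<in> K" "t + l = s" using left_coset_eqD[OF ts] by blast
      moreover obtain k where "k \<in> K" "s + k \<in> D" using s by (auto simp: S_def)
      ultimately have "t + (l + k) \<in> D" "l + k \<in> K" by (auto simp: add.assoc intro: H.add_mem)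
      then show ?thesis by (auto simp: S_def)
    qed
    have "left_coset K -` (range (left_coset K) - left_coset K ` S) = - S"
      using sat by auto
    then have "openin (coset_space K) (range (left_coset K) - left_coset K ` S)"
      using S by (simp add: openin_coset_space open_Compl)
    then have cl: "closedin (coset_space K) (left_coset K ` S)"
      by (auto simp: closedin_def topspace_coset_space)
    have "{c \<in> topspace (coset_space K). F c \<noteq> 0} \<subseteq> left_coset K ` S"
    proof
      fix c assume "c \<in> {c \<in> topspace (coset_space K). F c \<noteq> 0}"
      then obtain s where s: "c = left_coset K s" "pull F s \<noteq> 0"
        by (auto simp: topspace_coset_space pull_def)
      then have "s + 0 \<in> D" using D(2) by simp
      then have "s \<in> S" unfolding S_def using H.zero_mem by blast
      with s show "c \<in> left_coset K ` S" by blast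
    qed
    then have "supp (coset_space K) F \<subseteq> left_coset K ` S"
      unfolding supp_def using cl by (rule closure_of_minimal)
    moreover have "left_coset K ` S \<inter> E = {}"
      using D(3) left_coset_add by (force simp: S_def)
    ultimately show "F \<in> ideal_I0 (coset_space K) C E"
      using F compactin_supp by (auto simp: ideal_I0_def)
  qed
  show ?thesis
  proof
    show "pull ` ideal_I0 (coset_space K) C E \<subseteq> ideal_I0 euclidean A (coset_preimage E) \<inter> B"
      using iff pull_mem by (auto simp: ideal_I0_def)
    show "ideal_I0 euclidean A (coset_preimage E) \<inter> B \<subseteq> pull ` ideal_I0 (coset_space K) C E"
    proof
      fix f assume f: "f \<in> ideal_I0 euclidean A (coset_preimage E) \<inter> B"
      then have "coset_map K f \<in> ideal_I0 (coset_space K) C E"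
        using iff[OF coset_map_mem[of f]] pull_coset_map[of f] by auto
      with f pull_coset_map[of f] show "f \<in> pull ` ideal_I0 (coset_space K) C E" by (metis IntD2 imageI)
    qed
  qed
qed

lemma pull_prod: "pull (\<Prod>i<n. F i) = (\<Prod>i<n. pull (F i))" for n :: nat
proof (induction n)
  case 0
  show ?case by (rule ext) (simp add: pull_def)
next
  case (Suc n)
  show ?case unfolding prod.lessThan_Suc Suc[symmetric] by (rule ext) (simp add: pull_def)
qed

lemma pull_products: "pull ` products I d = products (pull ` I) d"
proof
  show "pull ` products I d \<subseteq> products (pull ` I) d"
  proof
    fix p assume "p \<in> pull ` products I d"
    then obtain F where F: "p = pull (\<Prod>i<d. F i)" "\<forall>i<d. F i \<in> I" by (auto simp: products_def)
    then show "p \<in> products (pull ` I) d"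
      unfolding products_def by (intro CollectI exI[of _ "\<lambda>i. pull (F i)"]) (simp add: pull_prod)
  qed
  show "products (pull ` I) d \<subseteq> pull ` products I d"
  proof
    fix p assume "p \<in> products (pull ` I) d"
    then obtain f where f: "p = (\<Prod>i<d. f i)" "\<forall>i<d. f i \<in> pull ` I" by (auto simp: products_def)
    then have "\<forall>i. \<exists>F. i < d \<longrightarrow> F \<in> I \<and> f i = pull F" by blast
    then obtain F where F: "\<And>i. i < d \<Longrightarrow> F i \<in> I \<and> f i = pull (F i)" by metis
    then have "p = pull (\<Prod>i<d. F i)" unfolding f(1) pull_prod by (intro prod.cong) auto
    moreover have "(\<Prod>i<d. F i) \<in> products I d" unfolding products_def using F by blast
    ultimately show "p \<in> pull ` products I d" by blast
  qed
qed

lemma pull_span: "pull ` cfun.span M = cfun.span (pull ` M)"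
proof -
  interpret L: module_hom "(\<lambda>c f x. c * f x) :: complex \<Rightarrow> ('g set \<Rightarrow> complex) \<Rightarrow> 'g set \<Rightarrow> complex"
    "(\<lambda>c f x. c * f x) :: complex \<Rightarrow> ('g \<Rightarrow> complex) \<Rightarrow> 'g \<Rightarrow> complex" pull
    by unfold_locales (auto simp: pull_def fun_eq_iff algebra_simps)
  show ?thesis by (rule L.span_image[symmetric])
qed

text \<open>For \<open>d = 0\<close> this would fail: the empty product is the constant 1, which
  does not vanish off the cosets.\<close>

lemma products_coset_subset:
  assumes "I \<subseteq> C" "d \<ge> 1"
  shows "products I d \<subseteq> C"
proof
  fix p assume p: "p \<in> products I d"
  then obtain F where F: "p = (\<Prod>i<d. F i)" "\<forall>i<d. F i \<in> I" by (auto simp: products_def)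
  have "pull p \<in> products (A \<inter> B) d"
  proof -
    have "pull p \<in> products (pull ` I) d" unfolding pull_products[symmetric] using p by (rule imageI)
    moreover have "pull ` I \<subseteq> A \<inter> B" using assms(1) pull_mem inv_alg_subset by blast
    ultimately show ?thesis unfolding products_def by blast
  qed
  then have "pull p \<in> B" using products_inv_alg[of A d] by blast
  moreover have "p c = 0" if c: "c \<notin> range (left_coset K)" for c
  proof -
    obtain m where m: "d = Suc m" using assms(2) by (cases d) auto
    have "F m c = 0" using F(2) assms(1) c m unfolding coset_alg_iff subset_iff by auto
    then show ?thesis unfolding F(1) m prod.lessThan_Suc by simp
  qed
  ultimately show "p \<in> C" unfolding coset_alg_iff by blast
qed

section \<open>The two equivalences\<close>

lemma weak_synthesis_iff:
  assumes E: "E \<subseteq> range (left_coset K)" and d: "d \<ge> 1"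
  shows "weak_synthesis (coset_space K) C (coset_norm K A N) d E \<longleftrightarrow>
    weak_synthesis euclidean A N d (coset_preimage E)"
proof -
  define I where "I = ideal_I A (coset_preimage E)"
  define Z where "Z = ideal_I0 euclidean A (coset_preimage E)"
  have I: "invariant_ideal I" "cl I \<subseteq> I"
    unfolding I_def by (rule invariant_ideal_I, rule closed_ideal_I)
  have Z: "invariant_ideal Z" unfolding Z_def by (rule invariant_ideal_I0)
  have ZA: "Z \<subseteq> A" using Z by (simp add: invariant_ideal_def)
  have P: "invariant_ideal (cfun.span (products I d))" by (rule span_products_ideal[OF I(1) d])
  have IC: "ideal_I C E \<subseteq> C" by (auto simp: ideal_I_def)
  have "cfun.span (products (ideal_I C E) d) \<inter> C = cfun.span (products (ideal_I C E) d)"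
    using cfun.span_minimal[OF products_coset_subset[OF IC d] subspace_coset_alg] by blast
  then have pow: "pull ` (cfun.span (products (ideal_I C E) d) \<inter> C) = cfun.span (products (I \<inter> B) d)"
    by (simp only: pull_span pull_products pull_ideal_I[OF E] I_def)
  have "ideal_I0 (coset_space K) C E \<inter> C = ideal_I0 (coset_space K) C E"
    by (auto simp: ideal_I0_def)
  then have zer: "pull ` (ideal_I0 (coset_space K) C E \<inter> C) = Z \<inter> B"
    by (simp only: pull_ideal_I0 Z_def)
  have "weak_synthesis (coset_space K) C (coset_norm K A N) d E \<longleftrightarrow>
      cl (cfun.span (products (I \<inter> B) d)) \<inter> B = cl (Z \<inter> B) \<inter> B"
    unfolding weak_synthesis_def ideal_power_def products_def[symmetric] coset_closure_of_eq_iff pow zer ..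
  also have "\<dots> \<longleftrightarrow> cl (cfun.span (products I d)) \<inter> B = cl Z \<inter> B"
    unfolding power_inter_inv_alg[OF I d, symmetric]
    using closure_inter_inv_alg[OF ZA] average_ideal_I0 by (simp add: Z_def)
  also have "\<dots> \<longleftrightarrow> cl (cfun.span (products I d)) = cl Z"
    using invariant_ideal_eq[OF invariant_ideal_closure[OF P] closure_closure
        invariant_ideal_closure[OF Z] closure_closure] by auto
  also have "\<dots> \<longleftrightarrow> weak_synthesis euclidean A N d (coset_preimage E)"
    unfolding weak_synthesis_def ideal_power_def products_def[symmetric]
      alg_topology_closure_of[OF Metric_space_axioms] I_def Z_def ..
  finally show ?thesis .
qed

lemma ideal_J_euclidean: "ideal_J euclidean A N S = ideal_I A S"
proof -
  have "ideal_I A S \<subseteq> cl (ideal_I A S)" by (rule subset_closure) (auto simp: ideal_I_def)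
  moreover have "{f \<in> ideal_I A S. compactin euclidean (supp euclidean f)} = ideal_I A S"
    using compactin_supp_euclidean by blast
  ultimately show ?thesis
    unfolding ideal_J_def alg_topology_closure_of[OF Metric_space_axioms]
    using closed_ideal_I[of S] by simp
qed

lemma ideal_J_coset:
  assumes E: "E \<subseteq> range (left_coset K)"
  shows "ideal_J (coset_space K) C (coset_norm K A N) E = ideal_I C E"
proof -
  have eq: "{F \<in> ideal_I C E. compactin (coset_space K) (supp (coset_space K) F)} \<inter> C = ideal_I C E"
    by (auto simp: compactin_supp ideal_I_def)
  have "ideal_J (coset_space K) C (coset_norm K A N) E
      = {F \<in> C. pull F \<in> cl (ideal_I A (coset_preimage E) \<inter> B)}"
    unfolding ideal_J_def coset_closure_of eq pull_ideal_I[OF E] ..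
  also have "\<dots> = ideal_I C E"
  proof
    show "{F \<in> C. pull F \<in> cl (ideal_I A (coset_preimage E) \<inter> B)} \<subseteq> ideal_I C E"
    proof
      fix F assume F: "F \<in> {F \<in> C. pull F \<in> cl (ideal_I A (coset_preimage E) \<inter> B)}"
      then have "pull F \<in> ideal_I A (coset_preimage E)"
        using closure_mono[of "ideal_I A (coset_preimage E) \<inter> B" "ideal_I A (coset_preimage E)"]
          closed_ideal_I by blast
      then show "F \<in> ideal_I C E" using F E by (auto simp: ideal_I_def pull_def)
    qed
    have "ideal_I A (coset_preimage E) \<inter> B \<subseteq> cl (ideal_I A (coset_preimage E) \<inter> B)"
      by (rule subset_closure) (auto simp: ideal_I_def)
    then show "ideal_I C E \<subseteq> {F \<in> C. pull F \<in> cl (ideal_I A (coset_preimage E) \<inter> B)}"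
      using pull_ideal_I[OF E] by (auto simp: ideal_I_def)
  qed
  finally show ?thesis .
qed

lemma local_weak_synthesis_iff:
  assumes "E \<subseteq> range (left_coset K)" "d \<ge> 1"
  shows "local_weak_synthesis (coset_space K) C (coset_norm K A N) d E \<longleftrightarrow>
    local_weak_synthesis euclidean A N d (coset_preimage E)"
  using weak_synthesis_iff[OF assms]
  unfolding local_weak_synthesis_def weak_synthesis_def ideal_J_coset[OF assms(1)] ideal_J_euclidean .

end

theorem theorem13:
  fixes K :: "'g::{topological_group_add,t2_space} set"
    and A :: "('g \<Rightarrow> complex) set"
    and N :: "('g \<Rightarrow> complex) \<Rightarrow> real"
    and E :: "'g set set"
    and d :: nat
  assumes "compact (UNIV :: 'g set)"
    and "is_subgroup K" and "closed K"
    and "regular_banach_function_algebra euclidean A N"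
    and "\<And>f s. f \<in> A \<Longrightarrow> right_transl s f \<in> A"
    and "\<And>f s. f \<in> A \<Longrightarrow> N (right_transl s f) = N f"
    and "\<And>f. f \<in> A \<Longrightarrow> continuous_map euclidean (alg_topology A N) (\<lambda>s. right_transl s f)"
    and "\<And>h f. h \<in> trig_polys \<Longrightarrow> f \<in> A \<Longrightarrow> h * f \<in> A"
    and "closedin (coset_space K) E"
    and "d \<ge> 1"
  shows
    "(weak_synthesis (coset_space K) (coset_alg K A) (coset_norm K A N) d E \<longleftrightarrow>
      weak_synthesis euclidean A N d {s. left_coset K s \<in> E}) \<and>
     (local_weak_synthesis (coset_space K) (coset_alg K A) (coset_norm K A N) d E \<longleftrightarrow>
      local_weak_synthesis euclidean A N d {s. left_coset K s \<in> E})"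
proof -
  interpret regular_banach_function_algebra euclidean A N by (rule assms(4))
  interpret translation_algebra A N K
    by unfold_locales (use assms in auto)
  have "E \<subseteq> range (left_coset K)"
    using closedin_subset[OF assms(9)] by (simp add: topspace_coset_space)
  with weak_synthesis_iff local_weak_synthesis_iff assms(10) show ?thesis by blast
qed

end
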